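(* There exists $u\in\dot{\mathscr W}^{1,2}$ such that $\mathcal E(u)\le\mathcal E(v)$ for all $v\in\dot{\mathscr W}^{1,2}$.
   Context: Let $\mathsf R_6$ be rotation through $\pi/3$, $a_1=(1,0)^T$, $a_i=\mathsf R_6^{i-1}a_1$, $\Lambda:=(\tfrac12,\tfrac{\sqrt3}{6})^T+\{m a_1+n a_2:m,n\in\mathbb Z\}$. Bonds: $\mathcal B=\{(\xi,\eta)\in\Lambda^2:|\xi-\eta|=1\}$ (ordered pairs); $Dy_b=y(\eta)-y(\xi)$ for $b=(\xi,\eta)$. Let $\xi_0=(0,\sqrt3/3)^T$, $\mathscr W_0=\{v:\Lambda\to\mathbb R: v(\xi_0)=0,\ \{b:Dv_b\neq0\}\text{ bounded}\}$, and $\dot{\mathscr W}^{1,2}=\{v:\Lambda\to\mathbb R: v(\xi_0)=0,\ Dv\in\ell^2(\mathcal B)\}$ with norm $\|Dv\|_2=(\sum_{b\in\mathcal B}|Dv_b|^2)^{1/2}$ ($\mathscr W_0$ is dense in it). The potential $\psi\in C(\mathbb R)\cap C^4(\mathbb R\setminus(\mathbb Z+\tfrac12))$ satisfies: ($\psi$1) 1-periodic; ($\psi$2) $\psi$ and $\psi(\tfrac12+\cdot)$ even; ($\psi$3) $\psi(r)=0$ iff $r\in\mathbb Z$; ($\psi$4) $\psi''(0)=\mu>0$; ($\psi$5) $\psi(x)\ge\tfrac12\psi''(0)x^2$ for $x\in[-\tfrac12,\tfrac12]$. Let $\hat y(x)=\frac1{2\pi}\arg(x)$ (identifying $x$ with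 $x_1+ix_2$, branch cut along the positive $x_1$-axis), restricted to $\Lambda$. For $u\in\mathscr W_0$ set $\mathcal E(u):=\sum_{b\in\mathcal B}[\psi(D\hat y_b+Du_b)-\psi(D\hat y_b)]$ (a finite sum); $\mathcal E$ is continuous on $\mathscr W_0$ with respect to $\|D\cdot\|_2$ and $\mathcal E$ on $\dot{\mathscr W}^{1,2}$ denotes its unique continuous extension.
   Formalization: The point ξ₀=(0,√3/3) does not lie in Λ, so v(ξ₀) is undefined as written; functions are extended by 0 off Λ, which makes the normalisation v(ξ₀)=0 automatic, so the minimizer is found among all v with Dv∈ℓ² (energy unaffected by adding constants). *)

theory Defs
  imports "HOL-Analysis.Analysis"
begin

text \<open>Points of the plane are identified with complex numbers x1 + i x2.\<close>

definition a1 :: complex where "a1 = 1"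
definition a2 :: complex where "a2 = Complex (1/2) (sqrt 3 / 2)"

definition Lat :: "complex set" where
  "Lat = {Complex (1/2) (sqrt 3 / 6) + of_int m * a1 + of_int n * a2 | m n :: int. True}"

definition Bonds :: "(complex \<times> complex) set" where
  "Bonds = {(xi, eta). xi \<in> Lat \<and> eta \<in> Lat \<and> cmod (xi - eta) = 1}"

definition Dif :: "(complex \<Rightarrow> real) \<Rightarrow> complex \<times> complex \<Rightarrow> real" where
  "Dif y b = y (snd b) - y (fst b)"

definition xi0 :: complex where "xi0 = Complex 0 (sqrt 3 / 3)"

definition LatFun :: "(complex \<Rightarrow> real) set" where
  "LatFun = {v. \<forall>x. x \<notin> Lat \<longrightarrow> v x = 0}"

definition W0 :: "(complex \<Rightarrow> real) set" where
  "W0 = {v \<in> LatFun. v xi0 = 0 \<and> bounded {b \<in> Bonds. Dif v b \<noteq> 0}}"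

definition W12 :: "(complex \<Rightarrow> real) set" where
  "W12 = {v \<in> LatFun. v xi0 = 0 \<and> (\<lambda>b. (Dif v b)\<^sup>2) summable_on Bonds}"

definition Dnorm :: "(complex \<Rightarrow> real) \<Rightarrow> real" where
  "Dnorm v = sqrt (infsum (\<lambda>b. (Dif v b)\<^sup>2) Bonds)"

text \<open>The dislocation predictor, branch cut along the positive x1-axis (argument in [0, 2 pi)).\<close>
definition yhat :: "complex \<Rightarrow> real" where
  "yhat x = (if x \<in> Lat then Arg2pi x / (2 * pi) else 0)"

text \<open>Energy on W0: a finite sum over the (bounded, hence finite) set of bonds where Du is nonzero.\<close>
definition Energy0 :: "(real \<Rightarrow> real) \<Rightarrow> (complex \<Rightarrow> real) \<Rightarrow> real" where
  "Energy0 psi u = (\<Sum>b \<in> {b \<in> Bonds. Dif u b \<noteq> 0}. psi (Dif yhat b + Dif u b) - psi (Dif yhat b))"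

text \<open>The continuous extension of Energy0 to W12 (with respect to Dnorm): its value at v is
  the common limit of Energy0 along sequences in W0 converging to v.\<close>
definition Energy :: "(real \<Rightarrow> real) \<Rightarrow> (complex \<Rightarrow> real) \<Rightarrow> real" where
  "Energy psi v = (THE L. \<forall>vs. (\<forall>n. vs n \<in> W0) \<and> (\<lambda>n. Dnorm (\<lambda>x. vs n x - v x)) \<longlonglongrightarrow> 0
      \<longrightarrow> (\<lambda>n. Energy0 psi (vs n)) \<longlonglongrightarrow> L)"

definition halfints :: "real set" where
  "halfints = {of_int k + 1/2 | k :: int. True}"

definition admissible_psi :: "(real \<Rightarrow> real) \<Rightarrow> bool" where
  "admissible_psi psi \<longleftrightarrow>
     continuous_on UNIV psi \<and>
     (\<forall>k<4. \<forall>x. x \<notin> halfints \<longrightarrow>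
        ((deriv ^^ k) psi has_real_derivative (deriv ^^ Suc k) psi x) (at x)) \<and>
     continuous_on (- halfints) ((deriv ^^ 4) psi) \<and>
     (\<forall>x. psi (x + 1) = psi x) \<and>
     (\<forall>x. psi (- x) = psi x) \<and>
     (\<forall>x. psi (1/2 + (- x)) = psi (1/2 + x)) \<and>
     (\<forall>r. psi r = 0 \<longleftrightarrow> r \<in> \<int>) \<and>
     (deriv ^^ 2) psi 0 > 0 \<and>
     (\<forall>x. -1/2 \<le> x \<and> x \<le> 1/2 \<longrightarrow> psi x \<ge> (1/2) * (deriv ^^ 2) psi 0 * x\<^sup>2)"

end

theory Submission
  imports Defs "HOL-Complex_Analysis.Great_Picard" "HOL-Real_Asymp.Real_Asymp"
begin

text \<open>
  Reducing the bond differences of \<open>y = yhat + u\<close> modulo 1 to \<open>[-1/2, 1/2]\<close> gives the elastic strain,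
  an alternating field on bonds whose circulation around each triangle is an integer (the charge);
  for a compactly supported \<open>Du\<close> the charges sum to 1, and \<open>psi\<close> dominates \<open>mu/2\<close> times the squared strain.

  A function H on triangle centres induces an exactly divergence-free bond field, and pairing it with
  a strain field gives \<open>2 * (\<Sum>T. H T * charge T)\<close>. Taking H to be a truncated logarithm yields a lower
  bound \<open>2 * c0 * ln (s / r)\<close> for the squared strain on an annulus of radii r, s around a nonzero charge,
  and \<open>yhat\<close> attains it up to a vanishing error: the strain of \<open>yhat\<close> is \<open>c0\<close> times the divergence-free field
  of the logarithm up to a square summable remainder. The same remark makes the linear part of the
  energy bounded, so that the energy extends continuously to the closure.

  Growing and merging balls around the charges turns the annulus bound into a global one. Since each
  charge costs a fixed core energy while the merging loses only the logarithm of their number, the number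
  of charges of a low-energy configuration is bounded, and the energy outside a large ball around
  any lattice point is at least that of \<open>yhat\<close> up to a vanishing error. For a minimising sequence we
  centre at a cluster of positive total charge and pass to the pointwise limit of the strains. The limit
  has total charge exactly 1 (a larger charge would cost a multiple of the available logarithm), differs from the
  strain of \<open>yhat\<close> by a square summable field, and hence comes from an admissible displacement,
  whose energy is at most the infimum.
\<close>

text \<open>Compactness fails in two ways. Since \<open>psi\<close> is periodic, the energy does not
  control \<open>Dif u\<close>, so only strains can be passed to a limit; and the charges may drift
  to infinity, because the displacement is tied to the origin only through \<open>yhat\<close>.
  Moreover the energy of a single charge grows like \<open>mu * c0 * ln R\<close>, and
  \<open>Energy0\<close> is a difference of two such divergent quantities. Any loss in the
  coefficient of the logarithm would be fatal, so all leading constants have to be exact: the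
  quadratic lower bound on \<open>psi\<close> and its Taylor expansion share the coefficient
  \<open>mu / 2\<close>, and the test field of the annulus bound is, to leading order, the field of
  the predictor itself. The remaining errors vanish as the inner radius grows, and changing the
  centre is harmless because \<open>ln R - ln (R + cmod q)\<close> tends to 0. The price of a charge
  k is k squared times the logarithm, which is what rules out a limit of charge 2 or more. The
  limiting strain determines a displacement only modulo integer fields; finite integer strings move
  its charges to the origin, and \<open>psi\<close> does not see them.\<close>

declare split_paired_All [simp del] split_paired_Ex [simp del]

section \<open>Geometry of the triangular lattice\<close>

text \<open>Two roles: it is the base point of \<open>Lat\<close>, and it is the centroid of the
  triangle 0, 1, \<open>a2\<close>, so that multiplying a bond vector by \<open>z0\<close> leads
  from its tail to the centre of the triangle on its left.\<close>

abbreviation z0 :: complex where "z0 \<equiv> Complex (1/2) (sqrt 3 / 6)"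

text \<open>The group of translations of \<open>Lat\<close>, which is the coset
  \<open>z0 + Lam\<close>.\<close>

definition Lam :: "complex set" where
  "Lam = {of_int m + of_int n * a2 | m n :: int. True}"

definition Units :: "complex set" where
  "Units = {1, a2, a2 - 1, - 1, - a2, 1 - a2}"

text \<open>\<open>Lc b\<close> is the centre of the triangle to the left of the bond b, and \<open>nxt b\<close> the following edge of that
  triangle in counterclockwise order. The origin is one of these centres.\<close>

definition Lc :: "complex \<times> complex \<Rightarrow> complex" where
  "Lc b = fst b + (snd b - fst b) * z0"

definition md :: "complex \<times> complex \<Rightarrow> complex" where
  "md b = (fst b + snd b) / 2"

definition Tri :: "complex set" where "Tri = Lc ` Bonds"

abbreviation rv :: "complex \<times> complex \<Rightarrow> complex \<times> complex" where
  "rv \<equiv> prod.swap"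

definition nxt :: "complex \<times> complex \<Rightarrow> complex \<times> complex" where
  "nxt b = (snd b, snd b + (snd b - fst b) * (a2 - 1))"

definition tr :: "complex \<Rightarrow> complex \<times> complex \<Rightarrow> complex \<times> complex" where
  "tr p b = (fst b + p, snd b + p)"

lemma a2_sq: "a2 * a2 = a2 - 1"
  by (simp add: a2_def complex_eq_iff)



lemma a2_coords_eq_iff:
  fixes m n m' n' :: int
  shows "of_int m + of_int n * a2 = of_int m' + of_int n' * a2 \<longleftrightarrow> m = m' \<and> n = n'"
  by (auto simp: a2_def complex_eq_iff)

lemma cmod_a2_coords:
  fixes m n :: int
  shows "(cmod (of_int m + of_int n * a2))\<^sup>2 = of_int (m * m + m * n + n * n)"
  unfolding cmod_power2 by (simp add: a2_def power2_eq_square algebra_simps)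

lemma Lam_coords: "of_int m + of_int n * a2 \<in> Lam"
  unfolding Lam_def by blast

lemma LamE:
  assumes "p \<in> Lam"
  obtains m n :: int where "p = of_int m + of_int n * a2"
  using assms unfolding Lam_def by blast

lemma Lam_add: "p \<in> Lam \<Longrightarrow> q \<in> Lam \<Longrightarrow> p + q \<in> Lam"
proof (elim LamE)
  fix m n m' n' :: int
  assume "p = of_int m + of_int n * a2" "q = of_int m' + of_int n' * a2"
  then have "p + q = of_int (m + m') + of_int (n + n') * a2"
    by (simp add: algebra_simps)
  then show ?thesis by (metis Lam_coords)
qed

lemma Lam_minus: "p \<in> Lam \<Longrightarrow> - p \<in> Lam"
proof (elim LamE)
  fix m n :: int
  assume "p = of_int m + of_int n * a2"
  then have "- p = of_int (- m) + of_int (- n) * a2"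
    by (simp add: algebra_simps)
  then show ?thesis by (metis Lam_coords)
qed

lemma Lam_diff: "p \<in> Lam \<Longrightarrow> q \<in> Lam \<Longrightarrow> p - q \<in> Lam"
  using Lam_add[of p "- q"] Lam_minus[of q] by simp

lemma Lam_0: "0 \<in> Lam"
  using Lam_coords[of 0 0] by simp

lemma Lat_iff: "x \<in> Lat \<longleftrightarrow> x - z0 \<in> Lam"
proof
  assume "x \<in> Lat"
  then obtain m n :: int where "x = z0 + of_int m * a1 + of_int n * a2"
    unfolding Lat_def by blast
  then have "x - z0 = of_int m + of_int n * a2" by (simp add: a1_def)
  then show "x - z0 \<in> Lam" by (metis Lam_coords)
next
  assume "x - z0 \<in> Lam"
  then obtain m n :: int where "x - z0 = of_int m + of_int n * a2" by (rule LamE)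
  then have "x = z0 + of_int m * a1 + of_int n * a2"
    unfolding a1_def by (metis add.assoc add_diff_cancel_left' diff_add_cancel add.commute mult.right_neutral)
  then show "x \<in> Lat" unfolding Lat_def by blast
qed

lemma Lat_add: "x \<in> Lat \<Longrightarrow> p \<in> Lam \<Longrightarrow> x + p \<in> Lat"
  using Lam_add[of "x - z0" p] unfolding Lat_iff by (simp add: algebra_simps)

lemma Lat_add_iff: "p \<in> Lam \<Longrightarrow> x + p \<in> Lat \<longleftrightarrow> x \<in> Lat"
  using Lat_add[of x p] Lat_add[of "x + p" "- p"] Lam_minus by auto

lemma Lat_diff: "x \<in> Lat \<Longrightarrow> y \<in> Lat \<Longrightarrow> x - y \<in> Lam"
  using Lam_diff[of "x - z0" "y - z0"] unfolding Lat_iff by simp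

text \<open>These are the units of the Eisenstein norm form: four times the form is
  \<open>(2 * m + n)\<^sup>2 + 3 * n\<^sup>2\<close>, and symmetrically in \<open>m\<close>, so both
  coordinates lie in {-1, 0, 1}.\<close>

lemma sq_form_eq_1:
  fixes m n :: int
  assumes "m * m + m * n + n * n = 1"
  shows "(m, n) \<in> {(1,0), (0,1), (-1,1), (-1,0), (0,-1), (1,-1)}"
proof -
  have e: "(2 * m + n)\<^sup>2 + 3 * n\<^sup>2 = 4" "(2 * n + m)\<^sup>2 + 3 * m\<^sup>2 = 4"
    using assms by (simp_all add: power2_eq_square algebra_simps)
  have small: "\<bar>k\<bar> \<le> 1" if "3 * k\<^sup>2 \<le> 4" for k :: int
  proof (rule ccontr)
    assume "\<not> \<bar>k\<bar> \<le> 1"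
    then have "\<bar>k\<bar> \<ge> 2" by simp
    then have "2\<^sup>2 \<le> \<bar>k\<bar>\<^sup>2" by (intro power_mono) auto
    then show False using that by simp
  qed
  have "3 * n\<^sup>2 \<le> 4" "3 * m\<^sup>2 \<le> 4"
    using e zero_le_power2[of "2 * m + n"] zero_le_power2[of "2 * n + m"] by linarith+
  then have "\<bar>m\<bar> \<le> 1" "\<bar>n\<bar> \<le> 1" using small by auto
  then have "m \<in> {-1,0,1}" "n \<in> {-1,0,1}" by auto
  then show ?thesis using assms by auto
qed

lemma Units_eq: "Units = {p \<in> Lam. cmod p = 1}"
proof (intro set_eqI iffI)
  fix e assume "e \<in> Units"
  then consider "e = of_int 1 + of_int 0 * a2" | "e = of_int 0 + of_int 1 * a2"
    | "e = of_int (-1) + of_int 1 * a2" | "e = of_int (-1) + of_int 0 * a2"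
    | "e = of_int 0 + of_int (-1) * a2" | "e = of_int 1 + of_int (-1) * a2"
    unfolding Units_def by (auto simp: algebra_simps)
  then obtain m n :: int where e: "e = of_int m + of_int n * a2" "m * m + m * n + n * n = 1"
    by cases (fastforce simp: algebra_simps)+
  have "(cmod e)\<^sup>2 = 1" unfolding e(1) cmod_a2_coords e(2) by simp
  then have "cmod e = 1" by (simp add: abs_square_eq_1 power2_eq_1_iff)
  then show "e \<in> {p \<in> Lam. cmod p = 1}" using e(1) Lam_coords by auto
next
  fix e assume "e \<in> {p \<in> Lam. cmod p = 1}"
  then obtain m n :: int where e: "e = of_int m + of_int n * a2" and "cmod e = 1"
    by (auto elim: LamE)
  then have "real_of_int (m * m + m * n + n * n) = 1"
    using cmod_a2_coords[of m n] by simp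
  then have "m * m + m * n + n * n = 1" by linarith
  then have "(m, n) \<in> {(1,0), (0,1), (-1,1), (-1,0), (0,-1), (1,-1)}" by (rule sq_form_eq_1)
  then show "e \<in> Units" unfolding Units_def e by auto
qed

lemma finite_Units: "finite Units" by (simp add: Units_def)

lemma Units_mult: "e \<in> Units \<Longrightarrow> e * (a2 - 1) \<in> Units" "e \<in> Units \<Longrightarrow> e * a2 \<in> Units"
proof -
  have 1: "a2 * (a2 - 1) = - 1" "(a2 - 1) * (a2 - 1) = - a2" "(1 - a2) * (a2 - 1) = a2"
    "(a2 - 1) * a2 = - 1" "(1 - a2) * a2 = 1"
    using a2_sq by (simp_all add: algebra_simps)
  show "e \<in> Units \<Longrightarrow> e * (a2 - 1) \<in> Units" "e \<in> Units \<Longrightarrow> e * a2 \<in> Units"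
    unfolding Units_def using 1 a2_sq by (elim insertE; simp)+
qed

lemma Bonds_iff: "b \<in> Bonds \<longleftrightarrow> fst b \<in> Lat \<and> snd b - fst b \<in> Units"
proof (cases b)
  case (Pair x y)
  have "y \<in> Lat \<longleftrightarrow> y - x \<in> Lam" if "x \<in> Lat"
    using Lat_diff[of y x] Lat_add[of x "y - x"] that by auto
  then show ?thesis
    unfolding Pair Bonds_def Units_eq by (auto simp: norm_minus_commute)
qed

lemma rv_Bonds: "b \<in> Bonds \<Longrightarrow> rv b \<in> Bonds"
  by (cases b) (simp add: Bonds_def norm_minus_commute)

lemma rv_Bonds_iff: "rv b \<in> Bonds \<longleftrightarrow> b \<in> Bonds"
  using rv_Bonds[of b] rv_Bonds[of "rv b"] by auto



lemma md_rv [simp]: "md (rv b) = md b"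
  by (cases b) (simp add: md_def add.commute)

lemma tr_Bonds: "p \<in> Lam \<Longrightarrow> tr p b \<in> Bonds \<longleftrightarrow> b \<in> Bonds"
  by (simp add: Bonds_iff tr_def Lat_add_iff)

lemma tr_inverse [simp]: "tr p (tr (- p) b) = b" "tr (- p) (tr p b) = b"
  by (simp_all add: tr_def)

lemma inj_tr: "inj_on (tr p) A"
  by (rule inj_on_inverseI[where g = "tr (- p)"]) simp

lemma Lc_tr [simp]: "Lc (tr p b) = Lc b + p"
  by (simp add: Lc_def tr_def)

lemma md_tr [simp]: "md (tr p b) = md b + p"
  by (simp add: md_def tr_def field_simps)

lemma rv_tr: "rv (tr p b) = tr p (rv b)"
  by (simp add: tr_def prod.swap_def)

lemma Tri_add: "p \<in> Lam \<Longrightarrow> T + p \<in> Tri \<longleftrightarrow> T \<in> Tri"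
proof -
  have *: "T + p \<in> Tri" if "p \<in> Lam" "T \<in> Tri" for T p
  proof -
    obtain b where "b \<in> Bonds" "T = Lc b" using \<open>T \<in> Tri\<close> by (auto simp: Tri_def)
    then have "T + p = Lc (tr p b)" "tr p b \<in> Bonds" using tr_Bonds[OF that(1)] by simp_all
    then show ?thesis by (metis Tri_def image_eqI)
  qed
  assume "p \<in> Lam"
  then show ?thesis using *[of p T] *[of "- p" "T + p"] Lam_minus by auto
qed

lemma Lc_md: "b \<in> Bonds \<Longrightarrow> cmod (Lc b - md b) \<le> 1/2"
proof -
  assume "b \<in> Bonds"
  then have 1: "cmod (snd b - fst b) = 1" by (simp add: Bonds_iff Units_eq)
  have "Lc b - md b = (snd b - fst b) * Complex 0 (sqrt 3 / 6)"
    by (simp add: Lc_def md_def complex_eq_iff algebra_simps)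
  then have "cmod (Lc b - md b) = sqrt 3 / 6"
    using 1 by (simp add: norm_mult complex_norm)
  moreover have "sqrt 3 \<le> 3" by (rule real_le_lsqrt) auto
  ultimately show ?thesis by simp
qed

lemma Lc_rv_md: "b \<in> Bonds \<Longrightarrow> cmod (Lc (rv b) - md b) \<le> 1/2"
  using Lc_md[OF rv_Bonds, of b] by simp

lemma fst_md: "b \<in> Bonds \<Longrightarrow> cmod (fst b - md b) = 1/2"
proof -
  assume "b \<in> Bonds"
  then have 1: "cmod (snd b - fst b) = 1" by (simp add: Bonds_iff Units_eq)
  have "fst b - md b = - ((snd b - fst b) / 2)" by (simp add: md_def field_simps)
  then show ?thesis using 1 by (simp add: norm_divide)
qed

lemma nxt_Bonds: "b \<in> Bonds \<Longrightarrow> nxt b \<in> Bonds"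
proof -
  assume b: "b \<in> Bonds"
  then have "rv b \<in> Bonds" by (rule rv_Bonds)
  then show ?thesis using b Units_mult by (auto simp: Bonds_iff nxt_def)
qed

lemma Lc_nxt: "Lc (nxt b) = Lc b"
proof -
  have "Lc (nxt b) - Lc b = (snd b - fst b) * (1 + (a2 - 1) * z0 - z0)"
    by (simp add: Lc_def nxt_def algebra_simps)
  also have "1 + (a2 - 1) * z0 - z0 = 0"
    by (simp add: a2_def complex_eq_iff)
  finally show ?thesis by simp
qed

lemma snd_nxt_nxt: "snd (nxt (nxt b)) = fst b"
  by (simp add: nxt_def complex_eq_iff a2_def algebra_simps)

lemma nxt_neq: "b \<in> Bonds \<Longrightarrow> nxt b \<noteq> b" "b \<in> Bonds \<Longrightarrow> nxt (nxt b) \<noteq> b"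
proof -
  assume b: "b \<in> Bonds"
  then have ne: "fst b \<noteq> snd b" by (cases b) (auto simp: Bonds_def)
  show 1: "nxt b \<noteq> b" using ne by (auto simp: nxt_def prod_eq_iff)
  show "nxt (nxt b) \<noteq> b"
    using ne snd_nxt_nxt[of b] by auto
qed

text \<open>Bonds with the same left centre have vectors whose difference times \<open>z0\<close>
  lies in \<open>Lam\<close>. This is a congruence modulo 3 that separates the six unit vectors into
  two classes of three, each closed under rotation by 120 degrees.\<close>

lemma fibre_eq:
  assumes b: "b \<in> Bonds"
  shows "{b' \<in> Bonds. Lc b' = Lc b} = {b, nxt b, nxt (nxt b)}"
proof
  show "{b, nxt b, nxt (nxt b)} \<subseteq> {b' \<in> Bonds. Lc b' = Lc b}"
    using b nxt_Bonds Lc_nxt by auto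
  show "{b' \<in> Bonds. Lc b' = Lc b} \<subseteq> {b, nxt b, nxt (nxt b)}"
  proof
    fix b' assume "b' \<in> {b' \<in> Bonds. Lc b' = Lc b}"
    moreover obtain x y where bxy: "b' = (x, y)" by (cases b')
    ultimately have b': "(x, y) \<in> Bonds" and L: "Lc (x, y) = Lc b" by auto
    define e e' where "e = snd b - fst b" and "e' = y - x"
    have u: "e \<in> Units" "e' \<in> Units" using b b' by (auto simp: Bonds_iff e_def e'_def)
    have "x - fst b \<in> Lam" using b b' Lat_diff by (auto simp: Bonds_iff)
    then obtain m n :: int where mn: "x - fst b = of_int m + of_int n * a2" by (rule LamE)
    from u obtain i j i' j' :: int where ij: "e = of_int i + of_int j * a2" "e' = of_int i' + of_int j' * a2"
      unfolding Units_eq by (auto elim!: LamE)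
    have q: "i * i + i * j + j * j = 1" "i' * i' + i' * j' + j' * j' = 1"
      using u unfolding Units_eq ij using cmod_a2_coords[of i j] cmod_a2_coords[of i' j']
      by (simp_all flip: of_int_mult of_int_add)
    \<comment> \<open>The factor 3 clears the denominator: \<open>3 * z0 = 1 + a2\<close> lies in
      \<open>Lam\<close>, so integer coordinates can be compared.\<close>
    have "3 * (x - fst b) = 3 * z0 * (e - e')"
    proof -
      have "x - fst b = z0 * (e - e')" using L by (simp add: Lc_def e_def e'_def algebra_simps)
      then show ?thesis by (simp only: mult.assoc)
    qed
    also have "3 * z0 = 1 + a2" by (simp add: a2_def complex_eq_iff)
    also have "(1 + a2) * (e - e') = of_int ((i - i') - (j - j')) + of_int ((i - i') + 2 * (j - j')) * a2"
    proof -
      have "(1 + a2) * (e - e') = (1 + a2) * (of_int (i - i') + of_int (j - j') * a2)"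
        unfolding ij by (simp add: algebra_simps)
      also have "\<dots> = of_int (i - i') + (of_int (i - i') + of_int (j - j')) * a2 + of_int (j - j') * (a2 * a2)"
        by (simp add: algebra_simps)
      finally show ?thesis unfolding a2_sq by (simp add: algebra_simps)
    qed
    finally have "of_int (3 * m) + of_int (3 * n) * a2 = of_int ((i - i') - (j - j')) + of_int ((i - i') + 2 * (j - j')) * a2"
      unfolding mn by (simp add: algebra_simps)
    then have dv: "3 * m = (i - i') - (j - j')" "3 * n = (i - i') + 2 * (j - j')"
      unfolding a2_coords_eq_iff by auto
    have tri: "e' = e \<or> e' = e * (a2 - 1) \<or> e' = e * (a2 - 1) * (a2 - 1)"
    proof -
      have 1: "e * (a2 - 1) = of_int (- i - j) + of_int i * a2"
        "e * (a2 - 1) * (a2 - 1) = of_int j + of_int (- i - j) * a2"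
        by (simp_all add: ij a2_def complex_eq_iff algebra_simps)
      \<comment> \<open>Rotation by 120 degrees preserves \<open>i - j\<close> modulo 3, which is 1
        on one class of units and -1 on the other.\<close>
      have "i' = i \<and> j' = j \<or> i' = - i - j \<and> j' = i \<or> i' = j \<and> j' = - i - j"
        using sq_form_eq_1[OF q(1)] sq_form_eq_1[OF q(2)] dv(1)
        by (simp only: insert_iff empty_iff prod.inject simp_thms) presburger
      then consider (a) "i' = i" "j' = j" | (b) "i' = - i - j" "j' = i" | (c) "i' = j" "j' = - i - j"
        by blast
      then show ?thesis
      proof cases
        case a then show ?thesis using ij by simp
      next
        case b then have "e' = e * (a2 - 1)" unfolding 1(1) ij(2) by simp
        then show ?thesis by simp
      next
        case c then have "e' = e * (a2 - 1) * (a2 - 1)" unfolding 1(2) ij(2) by simp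
        then show ?thesis by simp
      qed
    qed
    have same: "c = (x, y)" if "Lc c = Lc b" "snd c - fst c = e'" for c
    proof -
      have "Lc c = Lc (x, y)" using that(1) L by simp
      then have "fst c + e' * z0 = x + e' * z0"
        using that(2) by (simp add: Lc_def e'_def)
      then have "fst c = x" by simp
      moreover have "snd c = fst c + e'" using that(2) by (simp add: algebra_simps)
      ultimately show ?thesis by (simp add: prod_eq_iff e'_def)
    qed
    have nx: "snd (nxt b) - fst (nxt b) = e * (a2 - 1)"
      "snd (nxt (nxt b)) - fst (nxt (nxt b)) = e * (a2 - 1) * (a2 - 1)"
      by (simp_all add: nxt_def e_def algebra_simps)
    have "Lc (nxt b) = Lc b" "Lc (nxt (nxt b)) = Lc b" by (simp_all add: Lc_nxt)
    then have "b = (x, y) \<or> nxt b = (x, y) \<or> nxt (nxt b) = (x, y)"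
      using same[of b, OF refl] same[of "nxt b"] same[of "nxt (nxt b)"] tri
      unfolding nx by (metis e_def)
    then show "b' \<in> {b, nxt b, nxt (nxt b)}" unfolding bxy by auto
  qed
qed

lemma Lam_near: "\<exists>p \<in> Lam. cmod (z - p) \<le> 1"
proof -
  define n where "n = round (Im z / (sqrt 3 / 2))"
  define m where "m = round (Re z - of_int n / 2)"
  let ?p = "of_int m + of_int n * a2"
  have i1: "\<bar>Im z / (sqrt 3 / 2) - of_int n\<bar> \<le> 1/2"
    using of_int_round_abs_le[of "Im z / (sqrt 3 / 2)"] by (simp add: n_def abs_minus_commute)
  have "Im (z - ?p) = (Im z / (sqrt 3 / 2) - of_int n) * (sqrt 3 / 2)"
    by (simp add: a2_def field_simps)
  then have "\<bar>Im (z - ?p)\<bar> = \<bar>Im z / (sqrt 3 / 2) - of_int n\<bar> * (sqrt 3 / 2)"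
    by (simp only: abs_mult) simp
  also have "\<dots> \<le> (1/2) * (sqrt 3 / 2)" using i1 by (intro mult_right_mono) auto
  finally have i2: "\<bar>Im (z - ?p)\<bar> \<le> 1/2" 
    using real_le_lsqrt[of 2 3] by simp
  have "Re (z - ?p) = (Re z - of_int n / 2) - of_int m"
    by (simp add: a2_def)
  then have "\<bar>Re (z - ?p)\<bar> \<le> 1/2"
    using of_int_round_abs_le[of "Re z - of_int n / 2"] unfolding m_def
    by (simp only: abs_minus_commute)
  then have "cmod (z - ?p) \<le> 1" using i2 cmod_le[of "z - ?p"] by linarith
  then show ?thesis using Lam_coords by blast
qed

section \<open>Summability over bonds\<close>

text \<open>The decay of a first-order times a second-order field. In the plane the third power is
  summable while the second is not, so tails of \<open>wt\<close> serve as the vanishing errors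
  below.\<close>

definition wt :: "complex \<times> complex \<Rightarrow> real" where
  "wt b = 1 / (1 + cmod (md b)) ^ 3"

lemma wt_pos: "wt b > 0"
  unfolding wt_def by (intro divide_pos_pos zero_less_power) (auto intro: add_pos_nonneg)

lemma int_powr_summable: "(\<lambda>m::int. (1 + \<bar>of_int m\<bar>) powr (- 3/2) :: real) summable_on UNIV"
proof -
  let ?h = "\<lambda>m::int. (1 + \<bar>of_int m\<bar>) powr (- 3/2) :: real"
  have s: "summable (\<lambda>n::nat. ?h (int n))"
  proof -
    have "summable (\<lambda>n. real n powr (- 3/2))" by (simp add: summable_real_powr_iff)
    then have "summable (\<lambda>n. real (Suc n) powr (- 3/2))" by (subst summable_Suc_iff)
    then show ?thesis by (simp add: add.commute)
  qed
  have n: "(\<lambda>n::nat. ?h (int n)) summable_on UNIV"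
    by (rule norm_summable_imp_summable_on) (use s in simp)
  have 1: "?h summable_on (int ` UNIV)"
    using n by (subst summable_on_reindex) (auto simp: o_def)
  have 2: "?h summable_on ((\<lambda>n. - int n) ` UNIV)"
    using n by (subst summable_on_reindex) (auto simp: o_def inj_on_def)
  have "m \<in> range int \<union> range (\<lambda>n. - int n)" for m
    by (cases m) (auto simp del: of_nat_Suc)
  then have U: "UNIV = int ` UNIV \<union> ((\<lambda>n. - int n) ` UNIV - int ` UNIV)" by auto
  have "?h summable_on ((\<lambda>n. - int n) ` UNIV - int ` UNIV)"
    by (rule summable_on_subset_banach[OF 2]) auto
  then show ?thesis
    by (subst U, intro summable_on_Un_disjoint 1) auto
qed

lemma summable_on_prod_nonneg:
  fixes h :: "'a \<Rightarrow> real" and g :: "'b \<Rightarrow> real"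
  assumes "h summable_on A" "g summable_on B" "\<And>x. h x \<ge> 0" "\<And>x. g x \<ge> 0"
  shows "(\<lambda>(x, y). h x * g y) summable_on (A \<times> B)"
proof (rule nonneg_bdd_above_summable_on)
  show "0 \<le> (case z of (x, y) \<Rightarrow> h x * g y)" for z using assms by (auto split: prod.splits)
  show "bdd_above (sum (\<lambda>(x, y). h x * g y) ` {F. F \<subseteq> A \<times> B \<and> finite F})"
  proof (rule bdd_aboveI2)
    fix F assume F: "F \<in> {F. F \<subseteq> A \<times> B \<and> finite F}"
    let ?X = "fst ` F" and ?Y = "snd ` F"
    have "sum (\<lambda>(x, y). h x * g y) F \<le> sum (\<lambda>(x, y). h x * g y) (?X \<times> ?Y)"
      using F assms by (intro sum_mono2) (auto simp: image_iff, force+)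
    also have "\<dots> = sum h ?X * sum g ?Y" by (simp add: sum_product sum.cartesian_product)
    also have "\<dots> \<le> infsum h A * infsum g B"
    proof (intro mult_mono)
      show "sum h ?X \<le> infsum h A" "sum g ?Y \<le> infsum g B"
        by (rule finite_sum_le_infsum; use F assms in auto)+
    qed (auto intro!: sum_nonneg infsum_nonneg assms)
    finally show "sum (\<lambda>(x, y). h x * g y) F \<le> infsum h A * infsum g B" .
  qed
qed

lemma abs_sum_sq_le:
  fixes x y :: real
  shows "(\<bar>x\<bar> + \<bar>y\<bar>)\<^sup>2 \<le> 4 * (x * x + x * y + y * y)"
proof -
  have e: "(\<bar>x\<bar> + \<bar>y\<bar>)\<^sup>2 = x * x + y * y + 2 * \<bar>x * y\<bar>"
    by (simp add: power2_eq_square algebra_simps abs_mult)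
  have s: "0 \<le> x * x + 2 * (x * y) + y * y" "0 \<le> x * x" "0 \<le> y * y"
    using zero_le_power2[of "x + y"] by (simp_all add: power2_eq_square algebra_simps)
  show ?thesis
  proof (cases "x * y \<ge> 0")
    case True
    then have "\<bar>x * y\<bar> = x * y" by simp
    then show ?thesis unfolding e distrib_left using s by linarith
  next
    case False
    then have "\<bar>x * y\<bar> = - (x * y)" by simp
    then show ?thesis unfolding e distrib_left using s by linarith
  qed
qed

lemma cmod_a2_coords_ge:
  fixes m n :: int
  shows "cmod (of_int m + of_int n * a2) \<ge> (\<bar>of_int m\<bar> + \<bar>of_int n\<bar>) / 2"
proof (rule power2_le_imp_le)
  show "((\<bar>real_of_int m\<bar> + \<bar>of_int n\<bar>) / 2)\<^sup>2 \<le> (cmod (of_int m + of_int n * a2))\<^sup>2"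
    unfolding cmod_a2_coords using abs_sum_sq_le[of "of_int m" "of_int n"] by (simp add: power_divide)
qed auto

text \<open>Bonds are indexed by two integers and a unit. Since
  \<open>1 + \<bar>m\<bar> + \<bar>n\<bar>\<close> dominates the geometric mean of
  \<open>1 + \<bar>m\<bar>\<close> and \<open>1 + \<bar>n\<bar>\<close>, the cube splits into a
  product of one-dimensional series with exponent 3/2; 216 is the cube of the factor 6 lost in
  comparing norms.\<close>

lemma wt_summable: "wt summable_on Bonds"
proof -
  let ?h = "\<lambda>m::int. (1 + \<bar>of_int m\<bar>) powr (- 3/2) :: real"
  define ph where "ph = (\<lambda>(mn :: int \<times> int, e). 
     let x = z0 + of_int (fst mn) + of_int (snd mn) * a2 in (x, x + e))"
  have img: "Bonds \<subseteq> ph ` (UNIV \<times> Units)"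
  proof
    fix b assume b: "b \<in> Bonds"
    then obtain m n :: int where "fst b - z0 = of_int m + of_int n * a2"
      by (auto simp: Bonds_iff Lat_iff elim: LamE)
    then have "b = ph ((m, n), snd b - fst b)"
      by (simp add: ph_def Let_def prod_eq_iff algebra_simps)
    then show "b \<in> ph ` (UNIV \<times> Units)" using b by (auto simp: Bonds_iff)
  qed
  have inj: "inj_on ph (UNIV \<times> Units)"
    using a2_coords_eq_iff by (auto simp: inj_on_def ph_def Let_def add.assoc)
  have "(\<lambda>(m, n). ?h m * ?h n) summable_on (UNIV \<times> UNIV)"
    by (rule summable_on_prod_nonneg) (use int_powr_summable in auto)
  then have S: "(\<lambda>(mn, e::complex). (\<lambda>(m, n). ?h m * ?h n) mn * 216) summable_on ((UNIV \<times> UNIV) \<times> Units)"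
    by (rule summable_on_prod_nonneg) (auto simp: finite_Units)
  have bd: "wt (ph ((m, n), e)) \<le> (?h m * ?h n) * 216" if "e \<in> Units" for m n e
  proof -
    let ?p = "of_int m + of_int n * a2" and ?M = "1 + \<bar>of_int m\<bar> :: real" and ?N = "1 + \<bar>of_int n\<bar> :: real"
    have m: "md (ph ((m, n), e)) = ?p + (z0 + e / 2)"
      by (simp add: ph_def Let_def md_def field_simps)
    have "cmod (z0 + e/2) \<le> 2"
    proof -
      have "cmod z0 \<le> 1" using cmod_le[of z0] real_le_lsqrt[of 2 3] by simp
      moreover have "cmod (e/2) \<le> 1" using that by (simp add: Units_eq norm_divide)
      ultimately show ?thesis using norm_triangle_ineq[of z0 "e/2"] by linarith
    qed
    then have "cmod (md (ph ((m, n), e))) \<ge> cmod ?p - 2"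
      unfolding m using norm_diff_ineq[of ?p "z0 + e/2"] by linarith
    then have g: "1 + cmod (md (ph ((m, n), e))) \<ge> (1 + \<bar>of_int m\<bar> + \<bar>of_int n\<bar>) / 6"
    proof -
      have "1 + x \<ge> (1 + s) / 6" if "x \<ge> y - 2" "y \<ge> s / 2" "x \<ge> 0" for x y s :: real
        using that by (simp add: field_simps)
      from this[OF \<open>cmod (md (ph ((m, n), e))) \<ge> cmod ?p - 2\<close> cmod_a2_coords_ge norm_ge_zero]
      show ?thesis by (simp only: add.assoc)
    qed
    have "(?M * ?N) powr (1/2) \<le> 1 + \<bar>of_int m\<bar> + \<bar>of_int n\<bar>"
    proof -
      have "0 \<le> ?M * ?N" by simp
      then have "(?M * ?N) powr (1/2) = sqrt (?M * ?N)" by (rule powr_half_sqrt)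
      also have "\<dots> \<le> 1 + \<bar>of_int m\<bar> + \<bar>of_int n\<bar>"
        by (rule real_le_lsqrt) (auto simp: power2_eq_square algebra_simps)
      finally show ?thesis .
    qed
    then have "(?M * ?N) powr (1/2) / 6 \<le> (1 + \<bar>of_int m\<bar> + \<bar>of_int n\<bar>) / 6"
      by (rule divide_right_mono) simp
    with g have g2: "1 + cmod (md (ph ((m, n), e))) \<ge> (?M * ?N) powr (1/2) / 6" by (rule order_trans[rotated])
    have pos: "(?M * ?N) powr (1/2) / 6 > 0"
      by (intro divide_pos_pos) (auto simp: add_pos_nonneg intro!: mult_pos_pos add_pos_nonneg)
    have "wt (ph ((m, n), e)) \<le> 1 / ((?M * ?N) powr (1/2) / 6) ^ 3"
      unfolding wt_def using g2 pos by (intro divide_left_mono power_mono mult_pos_pos zero_less_power) (auto intro: add_pos_nonneg)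
    also have "\<dots> = 216 / ((?M * ?N) powr (1/2)) ^ 3" by (simp add: power_divide)
    also have "((?M * ?N) powr (1/2)) ^ 3 = (?M * ?N) powr (3/2)"
      by (subst powr_power) auto
    also have "216 / (?M * ?N) powr (3/2) = 216 * (?M * ?N) powr (- 3/2)"
      by (simp add: powr_minus_divide)
    also have "(?M * ?N) powr (- 3/2) = ?h m * ?h n" by (subst powr_mult) auto
    finally show ?thesis by simp
  qed
  have "(\<lambda>x. wt (ph x)) summable_on ((UNIV \<times> UNIV) \<times> Units)"
    by (rule summable_on_comparison_test[OF S]) (use bd wt_pos in \<open>auto simp: less_imp_le\<close>)
  then have "wt summable_on (ph ` (UNIV \<times> Units))" unfolding UNIV_Times_UNIV
    by (subst summable_on_reindex[OF inj]) (simp add: o_def)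
  then show ?thesis by (rule summable_on_subset_banach[OF _ img])
qed

definition Bd :: "complex \<Rightarrow> real \<Rightarrow> (complex \<times> complex) set" where
  "Bd p R = {b \<in> Bonds. cmod (md b - p) \<le> R}"

definition Tr :: "complex \<Rightarrow> real \<Rightarrow> complex set" where
  "Tr p R = {T \<in> Tri. cmod (T - p) \<le> R}"

lemma summable_on_imp_finite_ge:
  fixes f :: "'a \<Rightarrow> real"
  assumes "f summable_on A" "\<And>x. x \<in> A \<Longrightarrow> f x \<ge> 0" "e > 0"
  shows "finite {x \<in> A. f x \<ge> e}"
proof (rule ccontr)
  assume inf: "infinite {x \<in> A. f x \<ge> e}"
  obtain n :: nat where n: "real n * e > infsum f A"
    using reals_Archimedean3[OF assms(3)] by blast
  obtain F where F: "finite F" "card F = n" "F \<subseteq> {x \<in> A. f x \<ge> e}"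
    using infinite_arbitrarily_large[OF inf] by blast
  have "real n * e = (\<Sum>x\<in>F. e)" using F by simp
  also have "\<dots> \<le> sum f F" using F by (intro sum_mono) auto
  also have "\<dots> \<le> infsum f A" using F assms by (intro finite_sum_le_infsum) auto
  finally show False using n by simp
qed

text \<open>Local finiteness is read off from summability: only finitely many bonds can have weight
  above a positive threshold.\<close>

lemma finite_Bd [simp]: "finite (Bd p R)"
proof -
  have "Bd p R \<subseteq> {b \<in> Bonds. wt b \<ge> 1 / (1 + (\<bar>R\<bar> + cmod p)) ^ 3}"
  proof
    fix b assume "b \<in> Bd p R"
    then have "b \<in> Bonds" "cmod (md b) \<le> \<bar>R\<bar> + cmod p"
      using norm_triangle_sub[of "md b" p] by (auto simp: Bd_def)
    then show "b \<in> {b \<in> Bonds. wt b \<ge> 1 / (1 + (\<bar>R\<bar> + cmod p)) ^ 3}"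
      unfolding wt_def by (auto intro!: divide_left_mono power_mono mult_pos_pos zero_less_power add_pos_nonneg)
  qed
  moreover have "finite {b \<in> Bonds. wt b \<ge> 1 / (1 + (\<bar>R\<bar> + cmod p)) ^ 3}"
    by (rule summable_on_imp_finite_ge[OF wt_summable])
       (auto simp: less_imp_le[OF wt_pos] intro!: divide_pos_pos zero_less_power add_pos_nonneg)
  ultimately show ?thesis by (rule finite_subset)
qed

lemma Tr_subset: "Tr p R \<subseteq> Lc ` Bd p (R + 1)"
proof
  fix T assume "T \<in> Tr p R"
  then obtain b where b: "b \<in> Bonds" "T = Lc b" "cmod (Lc b - p) \<le> R" by (auto simp: Tr_def Tri_def)
  then have "cmod (md b - p) \<le> R + 1"
    using Lc_md[OF b(1)] norm_triangle_ineq[of "md b - Lc b" "Lc b - p"] by (simp add: norm_minus_commute)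
  then show "T \<in> Lc ` Bd p (R + 1)" using b by (auto simp: Bd_def)
qed

lemma finite_Tr [simp]: "finite (Tr p R)"
  by (rule finite_subset[OF Tr_subset]) simp

lemma Bd_rv: "b \<in> Bd p R \<longleftrightarrow> rv b \<in> Bd p R"
  by (simp add: Bd_def rv_Bonds_iff)

lemma Bd_mono: "R \<le> R' \<Longrightarrow> Bd p R \<subseteq> Bd p R'"
  by (auto simp: Bd_def)

lemma Bd_subset_Bonds: "Bd p R \<subseteq> Bonds"
  by (auto simp: Bd_def)

lemma Bd_translate: "cmod (p - q) + R \<le> R' \<Longrightarrow> Bd p R \<subseteq> Bd q R'"
proof
  fix b assume "cmod (p - q) + R \<le> R'" "b \<in> Bd p R"
  then show "b \<in> Bd q R'"
    using norm_triangle_ineq[of "md b - p" "p - q"] by (auto simp: Bd_def)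
qed

lemma finite_bonds_subset_Bd:
  assumes "finite A" "A \<subseteq> Bonds"
  obtains R where "R > 0" "A \<subseteq> Bd 0 R"
proof -
  define R where "R = 1 + (\<Sum>b\<in>A. cmod (md b))"
  have "cmod (md b) \<le> R" if "b \<in> A" for b
    using member_le_sum[of b A "\<lambda>b. cmod (md b)"] that assms(1) by (simp add: R_def)
  moreover have "R > 0" unfolding R_def by (intro add_pos_nonneg sum_nonneg) auto
  ultimately show thesis using assms by (intro that[of R]) (auto simp: Bd_def)
qed

lemma W0_support:
  assumes "u \<in> W0"
  obtains R where "R > 0" "\<And>b. b \<in> Bonds \<Longrightarrow> b \<notin> Bd 0 R \<Longrightarrow> Dif u b = 0"
proof -
  have "bounded {b \<in> Bonds. Dif u b \<noteq> 0}" using assms by (simp add: W0_def)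
  then obtain B where "\<forall>b\<in>{b \<in> Bonds. Dif u b \<noteq> 0}. norm b \<le> B" unfolding bounded_iff by blast
  then have B: "\<And>b. b \<in> Bonds \<Longrightarrow> Dif u b \<noteq> 0 \<Longrightarrow> norm b \<le> B" by blast
  have "Dif u b = 0" if "b \<in> Bonds" "b \<notin> Bd 0 (\<bar>B\<bar> + 1)" for b
  proof (rule ccontr)
    assume "Dif u b \<noteq> 0"
    then have "norm b \<le> B" using B that by blast
    then have "cmod (fst b) \<le> B" using norm_fst_le[of "fst b" "snd b"] by simp
    then have "cmod (md b) \<le> \<bar>B\<bar> + 1"
      using fst_md[OF that(1)] norm_triangle_ineq[of "fst b" "md b - fst b"] by (simp add: norm_minus_commute)
    then show False using that by (simp add: Bd_def)
  qed
  moreover have "\<bar>B\<bar> + 1 > 0" by simp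
  ultimately show thesis using that[of "\<bar>B\<bar> + 1"] by blast
qed

lemma countable_Bonds: "countable Bonds"
proof -
  have "Bonds = (\<Union>n::nat. Bd 0 (real n))"
    using real_arch_simple by (auto simp: Bd_def)
  then show ?thesis by (metis countable_UN countableI_type countable_finite finite_Bd)
qed

section \<open>Fields on bonds, circulation and discrete Stokes formula\<close>

definition alternating :: "(complex \<times> complex \<Rightarrow> real) \<Rightarrow> bool" where
  "alternating \<alpha> \<longleftrightarrow> (\<forall>b \<in> Bonds. \<alpha> (rv b) = - \<alpha> b)"

text \<open>The fibre of \<open>Lc\<close> over a centre consists of the three counterclockwise
  edges of its triangle; over any other point it is empty and the value is 0.\<close>

definition curl :: "(complex \<times> complex \<Rightarrow> real) \<Rightarrow> complex \<Rightarrow> real" where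
  "curl \<alpha> T = (\<Sum>b \<in> {b \<in> Bonds. Lc b = T}. \<alpha> b)"

text \<open>The gradient of \<open>H\<close> across the bond, from the right triangle to the left
  one; read along the bond it is the rotated, divergence-free field of the overview.\<close>

definition grd :: "(complex \<Rightarrow> real) \<Rightarrow> complex \<times> complex \<Rightarrow> real" where
  "grd H b = H (Lc b) - H (Lc (rv b))"

lemma curl_eq:
  assumes "b \<in> Bonds"
  shows "curl \<alpha> (Lc b) = \<alpha> b + \<alpha> (nxt b) + \<alpha> (nxt (nxt b))"
  unfolding curl_def fibre_eq[OF assms]
  using nxt_neq[OF assms] nxt_neq[OF nxt_Bonds[OF assms]] by auto

lemma finite_fibre: "finite {b \<in> Bonds. Lc b = T}"
proof (cases "T \<in> Tri")
  case True
  then obtain b where "b \<in> Bonds" "T = Lc b" by (auto simp: Tri_def)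
  then show ?thesis using fibre_eq by simp
next
  case False
  then have "{b \<in> Bonds. Lc b = T} = {}" by (auto simp: Tri_def)
  then show ?thesis by (simp only: finite.emptyI)
qed

lemma curl_not_Tri: "T \<notin> Tri \<Longrightarrow> curl \<alpha> T = 0"
  unfolding curl_def by (rule sum.neutral) (auto simp: Tri_def)

lemma curl_Dif: "curl (Dif u) T = 0"
proof (cases "T \<in> Tri")
  case True
  then obtain b where b: "b \<in> Bonds" "T = Lc b" by (auto simp: Tri_def)
  have "fst (nxt b) = snd b" "fst (nxt (nxt b)) = snd (nxt b)" by (simp_all add: nxt_def)
  then show ?thesis using b snd_nxt_nxt[of b] by (simp add: curl_eq Dif_def)
qed (rule curl_not_Tri)

lemma alternating_Dif: "alternating (Dif u)"
  by (simp add: alternating_def Dif_def)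

lemma alternating_add: "alternating \<alpha> \<Longrightarrow> alternating \<beta> \<Longrightarrow> alternating (\<lambda>b. \<alpha> b + \<beta> b)"
  and alternating_diff: "alternating \<alpha> \<Longrightarrow> alternating \<beta> \<Longrightarrow> alternating (\<lambda>b. \<alpha> b - \<beta> b)"
  by (auto simp: alternating_def)

lemma curl_add: "curl (\<lambda>b. \<alpha> b + \<beta> b) T = curl \<alpha> T + curl \<beta> T"
  and curl_diff: "curl (\<lambda>b. \<alpha> b - \<beta> b) T = curl \<alpha> T - curl \<beta> T"
  by (simp_all add: curl_def sum.distrib sum_subtractf)

lemma sum_alternating:
  assumes "alternating \<alpha>" "B \<subseteq> Bonds" "\<And>b. b \<in> B \<Longrightarrow> rv b \<in> B"
  shows "(\<Sum>b\<in>B. g b * \<alpha> b) = - (\<Sum>b\<in>B. g (rv b) * \<alpha> b)"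
proof -
  have "(\<Sum>b\<in>B. g b * \<alpha> b) = (\<Sum>b\<in>B. g (rv b) * \<alpha> (rv b))"
    by (rule sum.reindex_bij_witness[where i = rv and j = rv]) (use assms in auto)
  also have "\<dots> = (\<Sum>b\<in>B. - (g (rv b) * \<alpha> b))"
    by (intro sum.cong refl) (use assms in \<open>simp add: alternating_def subset_eq\<close>)
  finally show ?thesis by (simp add: sum_negf)
qed

lemma sum_curl:
  assumes "finite B" "B \<subseteq> Bonds" "finite S" "\<And>b. b \<in> Bonds \<Longrightarrow> b \<notin> B \<Longrightarrow> H (Lc b) * \<alpha> b = 0"
    and "\<And>b. b \<in> B \<Longrightarrow> H (Lc b) * \<alpha> b \<noteq> 0 \<Longrightarrow> Lc b \<in> S"
  shows "(\<Sum>T\<in>S. H T * curl \<alpha> T) = (\<Sum>b\<in>B. H (Lc b) * \<alpha> b)"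
proof -
  let ?B = "{b \<in> B. H (Lc b) * \<alpha> b \<noteq> 0}"
  have "(\<Sum>b\<in>B. H (Lc b) * \<alpha> b) = (\<Sum>b\<in>?B. H (Lc b) * \<alpha> b)"
    by (rule sum.mono_neutral_right) (use assms in auto)
  also have "\<dots> = (\<Sum>T\<in>S. \<Sum>b\<in>{b \<in> ?B. Lc b = T}. H (Lc b) * \<alpha> b)"
    by (rule sum.group[symmetric]) (use assms in auto)
  also have "\<dots> = (\<Sum>T\<in>S. \<Sum>b\<in>{b \<in> Bonds. Lc b = T}. H (Lc b) * \<alpha> b)"
    by (intro sum.cong refl sum.mono_neutral_left) (use assms finite_fibre in auto)
  also have "\<dots> = (\<Sum>T\<in>S. H T * curl \<alpha> T)"
    unfolding curl_def sum_distrib_left by (intro sum.cong refl) auto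
  finally show ?thesis by simp
qed

text \<open>Alternation turns the contribution of the right triangle of a bond into that of the left
  triangle of its reverse, whence the factor 2. The margin 1 ensures that every edge of a triangle
  in the support of \<open>H\<close> lies in \<open>Bd p R\<close>.\<close>

lemma stokes_Bd:
  assumes "alternating \<alpha>" "\<And>T. cmod (T - p) > R' \<Longrightarrow> H T = 0" "R' + 1 \<le> R"
  shows "(\<Sum>b\<in>Bd p R. grd H b * \<alpha> b) = 2 * (\<Sum>T\<in>Tr p R'. H T * curl \<alpha> T)"
proof -
  have "(\<Sum>b\<in>Bd p R. grd H b * \<alpha> b) = (\<Sum>b\<in>Bd p R. H (Lc b) * \<alpha> b) - (\<Sum>b\<in>Bd p R. H (Lc (rv b)) * \<alpha> b)"
    by (simp add: grd_def left_diff_distrib sum_subtractf)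
  also have "(\<Sum>b\<in>Bd p R. H (Lc (rv b)) * \<alpha> b) = - (\<Sum>b\<in>Bd p R. H (Lc b) * \<alpha> b)"
    using sum_alternating[OF assms(1), of "Bd p R" "\<lambda>b. H (Lc (rv b))"] Bd_rv by (simp add: Bd_subset_Bonds)
  also have "(\<Sum>b\<in>Bd p R. H (Lc b) * \<alpha> b) = (\<Sum>T\<in>Tr p R'. H T * curl \<alpha> T)"
  proof (rule sum_curl[symmetric])
    fix b assume b: "b \<in> Bonds" "b \<notin> Bd p R"
    then have "cmod (md b - p) > R" by (simp add: Bd_def)
    then have "cmod (Lc b - p) > R'"
      using Lc_md[OF b(1)] norm_triangle_ineq[of "md b - Lc b" "Lc b - p"] assms(3)
      by (simp add: norm_minus_commute)
    then show "H (Lc b) * \<alpha> b = 0" using assms(2) by simp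
  next
    fix b assume b: "b \<in> Bd p R" "H (Lc b) * \<alpha> b \<noteq> 0"
    then have "\<not> cmod (Lc b - p) > R'" using assms(2) by auto
    then show "Lc b \<in> Tr p R'" using b by (auto simp: Tr_def Tri_def Bd_def)
  qed (auto simp: Bd_subset_Bonds)
  finally show ?thesis by simp
qed

text \<open>Each bond is counted together with its reverse, so a field of bounded support has no
  total charge. Hence the total charge is invariant under such perturbations.\<close>

lemma total_curl_0:
  assumes "alternating \<gamma>" "\<And>b. b \<in> Bonds \<Longrightarrow> b \<notin> Bd p R \<Longrightarrow> \<gamma> b = 0" "finite S" "Tr p (R + 1) \<subseteq> S"
  shows "(\<Sum>T\<in>S. curl \<gamma> T) = 0"
proof -
  have "(\<Sum>T\<in>S. 1 * curl \<gamma> T) = (\<Sum>b\<in>Bd p R. 1 * \<gamma> b)"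
  proof (rule sum_curl)
    fix b assume b: "b \<in> Bd p R"
    then have "b \<in> Bonds" "cmod (md b - p) \<le> R" by (auto simp: Bd_def)
    then have "cmod (Lc b - p) \<le> R + 1"
      using Lc_md[of b] norm_triangle_ineq[of "Lc b - md b" "md b - p"] by simp
    then have "Lc b \<in> Tr p (R + 1)" using \<open>b \<in> Bonds\<close> by (auto simp: Tr_def Tri_def)
    then show "Lc b \<in> S" using assms by auto
  qed (use assms in \<open>auto simp: Bd_subset_Bonds\<close>)
  also have "\<dots> = 0"
    using sum_alternating[OF assms(1), of "Bd p R" "\<lambda>b. 1"] Bd_rv by (simp add: Bd_subset_Bonds)
  finally show ?thesis by simp
qed

section \<open>Potentials of irrotational fields\<close>

lemma int_antidifference: "\<exists>s :: int \<Rightarrow> real. s 0 = 0 \<and> (\<forall>i. s (i + 1) - s i = a i)"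
proof -
  define s where "s i = (if i \<ge> 0 then \<Sum>j\<in>{0..<i}. a j else - (\<Sum>j\<in>{i..<0}. a j))" for i :: int
  have "s (i + 1) - s i = a i" for i
  proof (cases "i \<ge> 0")
    case True
    then have "{0..<i + 1} = insert i {0..<i}" by auto
    then show ?thesis using True by (simp add: s_def)
  next
    case False
    then have "{i..<0} = insert i {i + 1..<0}" by auto
    moreover have "s (i + 1) = - (\<Sum>j\<in>{i + 1..<0}. a j)"
      using False by (cases "i = - 1") (auto simp: s_def)
    ultimately show ?thesis using False by (simp add: s_def)
  qed
  moreover have "s 0 = 0" by (simp add: s_def)
  ultimately show ?thesis by blast
qed

lemma int2_potential:
  fixes A B :: "int \<Rightarrow> int \<Rightarrow> real"
  assumes "\<And>m n. A m n + B (m + 1) n = B m n + A m (n + 1)"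
  shows "\<exists>U. \<forall>m n. U (m + 1) n - U m n = A m n \<and> U m (n + 1) - U m n = B m n"
proof -
  obtain s where s: "\<And>i. s (i + 1) - s i = A i 0"
    using int_antidifference[of "\<lambda>i. A i 0"] by auto
  have "\<forall>m. \<exists>t. t 0 = 0 \<and> (\<forall>i. t (i + 1) - t i = B m i)"
    using int_antidifference by blast
  then obtain t where t0: "\<And>m. t m 0 = 0" and t: "\<And>m i. t m (i + 1) - t m i = B m i" by metis
  define U where "U m n = s m + t m n" for m n
  have v: "U m (n + 1) - U m n = B m n" for m n using t by (simp add: U_def)
  have h: "U (m + 1) n - U m n = A m n" for m n
  proof (induction n rule: int_induct[where k = 0])
    case base show ?case using s t0 by (simp add: U_def)
  next
    case (step1 i) then show ?case using v[of m i] v[of "m + 1" i] assms[of m i] by simp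
  next
    case (step2 i) then show ?case using v[of m "i - 1"] v[of "m + 1" "i - 1"] assms[of m "i - 1"] by simp
  qed
  show ?thesis using v h by blast
qed

definition pt :: "int \<Rightarrow> int \<Rightarrow> complex" where
  "pt m n = z0 + of_int m + of_int n * a2"

lemma Lat_pt: "x \<in> Lat \<longleftrightarrow> (\<exists>m n. x = pt m n)"
  unfolding Lat_def pt_def a1_def by auto

lemma pt_eq_iff: "pt m n = pt m' n' \<longleftrightarrow> m = m' \<and> n = n'"
  using a2_coords_eq_iff[of m n m' n'] by (auto simp: pt_def add.assoc)

lemma pt_bonds: "(pt m n, pt (m + 1) n) \<in> Bonds" "(pt m n, pt m (n + 1)) \<in> Bonds"
  "(pt (m + 1) n, pt m (n + 1)) \<in> Bonds"
  using Lat_pt by (auto simp: Bonds_iff) (auto simp: pt_def Units_def algebra_simps)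

lemma bond_cases:
  assumes "b \<in> Bonds"
  obtains m n where "b = (pt m n, pt (m + 1) n) \<or> rv b = (pt m n, pt (m + 1) n)"
  | m n where "b = (pt m n, pt m (n + 1)) \<or> rv b = (pt m n, pt m (n + 1))"
  | m n where "b = (pt (m + 1) n, pt m (n + 1)) \<or> rv b = (pt (m + 1) n, pt m (n + 1))"
proof -
  obtain m n where f: "fst b = pt m n" using assms by (auto simp: Bonds_iff Lat_pt)
  obtain e where e: "e \<in> Units" "b = (pt m n, pt m n + e)"
    using assms f by (intro that[of "snd b - fst b"]) (auto simp: Bonds_iff prod_eq_iff)
  from e(1) consider "e = 1" | "e = a2" | "e = a2 - 1" | "e = - 1" | "e = - a2" | "e = 1 - a2"
    by (auto simp: Units_def)
  then show thesis
  proof cases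
    case 1 then have "b = (pt m n, pt (m + 1) n)" using e by (simp add: pt_def)
    then show thesis using that(1) by blast
  next
    case 2 then have "b = (pt m n, pt m (n + 1))" using e by (simp add: pt_def algebra_simps)
    then show thesis using that(2) by blast
  next
    case 3 then have "b = (pt (m - 1 + 1) n, pt (m - 1) (n + 1))" using e by (simp add: pt_def algebra_simps)
    then show thesis using that(3) by blast
  next
    case 4 then have "rv b = (pt (m - 1) n, pt (m - 1 + 1) n)" using e by (simp add: pt_def)
    then show thesis using that(1) by blast
  next
    case 5 then have "rv b = (pt m (n - 1), pt m (n - 1 + 1))" using e by (simp add: pt_def algebra_simps)
    then show thesis using that(2) by blast
  next
    case 6 then have "rv b = (pt (m + 1) (n - 1), pt m (n - 1 + 1))" using e by (simp add: pt_def algebra_simps)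
    then show thesis using that(3) by blast
  qed
qed

lemma nxt_nxt: "nxt (nxt b) = (snd (nxt b), fst b)"
  using snd_nxt_nxt[of b] by (simp add: prod_eq_iff) (simp add: nxt_def)

text \<open>Upward triangles give \<open>A + C = B\<close>, downward ones a second relation.
  Eliminating the diagonal \<open>C\<close> leaves the closedness condition on unit parallelograms,
  under which the two-dimensional integer array has a potential.\<close>

lemma irrotational_imp_potential:
  assumes as: "alternating \<gamma>" and cu: "\<And>T. T \<in> Tri \<Longrightarrow> curl \<gamma> T = 0"
  shows "\<exists>u \<in> LatFun. \<forall>b \<in> Bonds. Dif u b = \<gamma> b"
proof -
  define A where "A m n = \<gamma> (pt m n, pt (m + 1) n)" for m n
  define B where "B m n = \<gamma> (pt m n, pt m (n + 1))" for m n
  define C where "C m n = \<gamma> (pt (m + 1) n, pt m (n + 1))" for m n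
  have rev: "\<gamma> (y, x) = - \<gamma> (x, y)" if "(x, y) \<in> Bonds" for x y
    using as[unfolded alternating_def, rule_format, OF that] by simp
  have up: "A m n + C m n = B m n" for m n
  proof -
    let ?b = "(pt m n, pt (m + 1) n)"
    have n1: "nxt ?b = (pt (m + 1) n, pt m (n + 1))"
      using a2_sq by (simp add: nxt_def pt_def algebra_simps)
    moreover have "nxt (nxt ?b) = (pt m (n + 1), pt m n)"
      by (subst nxt_nxt) (simp add: n1)
    moreover have "curl \<gamma> (Lc ?b) = 0" using cu pt_bonds(1) by (auto simp: Tri_def)
    ultimately show ?thesis
      using curl_eq[OF pt_bonds(1), of \<gamma> m n] rev[OF pt_bonds(2), of m n] by (simp add: A_def B_def C_def)
  qed
  have down: "B (m + 1) n = A m (n + 1) + C m n" for m n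
  proof -
    let ?b = "(pt (m + 1) n, pt (m + 1) (n + 1))"
    have n1: "nxt ?b = (pt (m + 1) (n + 1), pt m (n + 1))"
      using a2_sq by (simp add: nxt_def pt_def algebra_simps)
    moreover have "nxt (nxt ?b) = (pt m (n + 1), pt (m + 1) n)"
      by (subst nxt_nxt) (simp add: n1)
    moreover have "curl \<gamma> (Lc ?b) = 0" using cu pt_bonds(2) by (auto simp: Tri_def)
    ultimately show ?thesis
      using curl_eq[OF pt_bonds(2), of \<gamma> "m + 1" n] rev[OF pt_bonds(1), of m "n + 1"] rev[OF pt_bonds(3), of m n]
      by (simp add: A_def B_def C_def)
  qed
  obtain U where U: "\<And>m n. U (m + 1) n - U m n = A m n" "\<And>m n. U m (n + 1) - U m n = B m n"
  proof -
    have "A m n + B (m + 1) n = B m n + A m (n + 1)" for m n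
      using up[of m n] down[of m n] by linarith
    from int2_potential[of A B, OF this] show thesis using that by blast
  qed
  \<comment> \<open>\<open>SOME\<close> inverts the injective parametrisation \<open>pt\<close> of
    the lattice.\<close>
  define u where "u x = (if x \<in> Lat then (let mn = SOME mn. x = pt (fst mn) (snd mn) in U (fst mn) (snd mn)) else 0)" for x
  have u: "u (pt m n) = U m n" for m n
  proof -
    let ?mn = "SOME mn. pt m n = pt (fst mn) (snd mn)"
    have "pt m n = pt (fst ?mn) (snd ?mn)" by (rule someI[of _ "(m, n)"]) simp
    then have "fst ?mn = m" "snd ?mn = n" by (auto simp: pt_eq_iff)
    then show ?thesis using Lat_pt by (auto simp: u_def Let_def)
  qed
  have "Dif u b = \<gamma> b" if b: "b \<in> Bonds" for b
  proof -
    have sw: "Dif u b = \<gamma> b" if "b' = b \<or> b' = rv b" "Dif u b' = \<gamma> b'" for b'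
    proof -
      have "Dif u (rv b) = - Dif u b" "\<gamma> (rv b) = - \<gamma> b"
        using as b by (simp_all add: Dif_def alternating_def)
      then show ?thesis using that by fastforce
    qed
    from b show ?thesis
    proof (cases rule: bond_cases)
      case (1 m n) then show ?thesis using U(1)[of m n] by (intro sw[of "(pt m n, pt (m + 1) n)"]) (auto simp: Dif_def u A_def)
    next
      case (2 m n) then show ?thesis using U(2)[of m n] by (intro sw[of "(pt m n, pt m (n + 1))"]) (auto simp: Dif_def u B_def)
    next
      case (3 m n) then show ?thesis using U(1)[of m n] U(2)[of m n] up[of m n]
        by (intro sw[of "(pt (m + 1) n, pt m (n + 1))"]) (auto simp: Dif_def u C_def)
    qed
  qed
  moreover have "u \<in> LatFun" by (auto simp: LatFun_def u_def)
  ultimately show ?thesis by blast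
qed

section \<open>Integer fields moving a unit charge from the origin to a given triangle\<close>

definition string_to :: "complex \<Rightarrow> bool" where
  "string_to T \<longleftrightarrow> (\<exists>s. alternating s \<and> (\<forall>b. s b \<in> \<int>) \<and> finite {b \<in> Bonds. s b \<noteq> 0} \<and>
     (\<forall>T'. curl s T' = of_bool (T' = T) - of_bool (T' = 0)))"

text \<open>A unit field on \<open>b\<close>, with the opposite value on its reverse, has charge +1
  to the left of \<open>b\<close> and -1 to the right; adding it moves the end of the string across
  the bond.\<close>

lemma string_step:
  assumes b: "b \<in> Bonds" and "string_to (Lc (rv b))"
  shows "string_to (Lc b)"
proof -
  obtain s where s: "alternating s" "\<forall>b. s b \<in> \<int>" "finite {b \<in> Bonds. s b \<noteq> 0}"
    "\<And>T'. curl s T' = of_bool (T' = Lc (rv b)) - of_bool (T' = 0)"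
    using assms(2) unfolding string_to_def by blast
  define e :: "complex \<times> complex \<Rightarrow> real" where "e c = of_bool (c = b) - of_bool (c = rv b)" for c
  have sw: "rv c = b \<longleftrightarrow> c = rv b" "rv c = rv b \<longleftrightarrow> c = b" for c
    by (metis swap_swap)+
  have ae: "alternating e" unfolding alternating_def e_def sw by simp
  have dl: "(\<Sum>c\<in>A. of_bool (c = x)) = (of_bool (x \<in> A) :: real)" if "finite A" for A and x :: "complex \<times> complex"
    using that by (simp add: of_bool_def)
  have ce: "curl e T = of_bool (T = Lc b) - of_bool (T = Lc (rv b))" for T
    unfolding curl_def e_def sum_subtractf dl[OF finite_fibre]
    using b rv_Bonds[OF b] by (auto simp: eq_commute)
  show ?thesis unfolding string_to_def
  proof (intro exI[of _ "\<lambda>c. s c + e c"] conjI allI)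
    show "alternating (\<lambda>c. s c + e c)" using s(1) ae by (rule alternating_add)
    show "s c + e c \<in> \<int>" for c unfolding e_def by (intro Ints_add Ints_diff s(2)[rule_format]) auto
    have "{c \<in> Bonds. s c + e c \<noteq> 0} \<subseteq> {c \<in> Bonds. s c \<noteq> 0} \<union> {b, rv b}"
      by (auto simp: e_def)
    then show "finite {c \<in> Bonds. s c + e c \<noteq> 0}" by (rule finite_subset) (use s(3) in auto)
    show "curl (\<lambda>c. s c + e c) T' = of_bool (T' = Lc b) - of_bool (T' = 0)" for T'
      unfolding curl_add s(4) ce by simp
  qed
qed

lemma string_to_0: "string_to 0"
  unfolding string_to_def by (intro exI[of _ "\<lambda>_. 0"]) (auto simp: alternating_def curl_def)

lemma zero_bond: "(z0, z0 - 1) \<in> Bonds" "Lc (z0, z0 - 1) = 0"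
  using Lam_0 by (auto simp: Bonds_iff Lat_iff Units_def Lc_def)

lemma zero_Tri: "0 \<in> Tri"
  using zero_bond by (auto simp: Tri_def image_iff intro!: bexI[of _ "(z0, z0 - 1)"])

text \<open>Consecutive spokes of a vertex share a triangle, left of the first and right of the
  second; this permits walking around the vertex.\<close>

lemma Lc_rv_rotate: "Lc (rv (x, x + e * a2)) = Lc (x, x + e)"
proof -
  have "Lc (rv (x, x + e * a2)) = x + e * (a2 - a2 * z0)"
    by (simp add: Lc_def algebra_simps)
  also have "a2 - a2 * z0 = z0" by (simp add: a2_def complex_eq_iff)
  finally show ?thesis by (simp add: Lc_def)
qed

lemma string_rotate:
  assumes "x \<in> Lat" "e \<in> Units" "string_to (Lc (x, x + e))"
  shows "string_to (Lc (x, x + e * a2))"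
proof (rule string_step)
  show "(x, x + e * a2) \<in> Bonds" using assms Units_mult by (auto simp: Bonds_iff)
  show "string_to (Lc (rv (x, x + e * a2)))" unfolding Lc_rv_rotate by (rule assms(3))
qed

lemma string_vertex:
  assumes x: "x \<in> Lat" and e: "e \<in> Units" "string_to (Lc (x, x + e))" and f: "f \<in> Units"
  shows "string_to (Lc (x, x + f))"
proof -
  have 1: "1 * a2 = a2" "a2 * a2 = a2 - 1" "(a2 - 1) * a2 = - 1" "(- 1) * a2 = - a2"
    "(- a2) * a2 = 1 - a2" "(1 - a2) * a2 = 1"
    using a2_sq by (simp_all add: algebra_simps)
  define Q where "Q g = string_to (Lc (x, x + g))" for g
  have "Q (g * a2)" if "Q g" "g \<in> Units" for g
    using string_rotate[OF x that(2)] that(1) by (simp add: Q_def)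
  from this[of 1] this[of a2] this[of "a2 - 1"] this[of "- 1"] this[of "- a2"] this[of "1 - a2"]
  have c: "Q 1 \<Longrightarrow> Q a2" "Q a2 \<Longrightarrow> Q (a2 - 1)" "Q (a2 - 1) \<Longrightarrow> Q (- 1)" "Q (- 1) \<Longrightarrow> Q (- a2)"
    "Q (- a2) \<Longrightarrow> Q (1 - a2)" "Q (1 - a2) \<Longrightarrow> Q 1"
    unfolding 1 by (auto simp: Units_def)
  have "Q e" using e by (simp add: Q_def)
  then have "Q f" using e(1) f c unfolding Units_def by blast
  then show ?thesis by (simp add: Q_def)
qed

text \<open>Connectivity of the dual lattice: the property of reaching all six triangles around a
  vertex spreads to each neighbour through a shared triangle, starting from \<open>z0\<close>, one
  of whose triangles is centred at the origin.\<close>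

lemma string_to_Tri:
  assumes "T \<in> Tri"
  shows "string_to T"
proof -
  define P where "P x \<longleftrightarrow> (\<forall>e\<in>Units. string_to (Lc (x, x + e)))" for x
  have mv: "P (x + e)" if "x \<in> Lat" "e \<in> Units" "P x" for x e
  proof -
    have b: "(x, x + e) \<in> Bonds" using that by (simp add: Bonds_iff)
    have "Lc (x + e, x + e + e * (a2 - 1)) = Lc (x, x + e)"
      using Lc_nxt[of "(x, x + e)"] by (simp add: nxt_def)
    then have "string_to (Lc (x + e, x + e + e * (a2 - 1)))" using that by (simp add: P_def)
    moreover have "x + e \<in> Lat" using nxt_Bonds[OF b] by (simp add: Bonds_iff nxt_def)
    ultimately show ?thesis using string_vertex that Units_mult unfolding P_def by blast
  qed
  have "P z0"
    unfolding P_def using string_vertex[of z0 "- 1"] zero_bond string_to_0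
    by (auto simp: Bonds_iff)
  then have "P (pt 0 0)" by (simp add: pt_def)
  have Lp: "pt m n \<in> Lat" for m n using Lat_pt by blast
  have U: "1 \<in> Units" "- 1 \<in> Units" "a2 \<in> Units" "- a2 \<in> Units" by (auto simp: Units_def)
  have "P (pt m 0)" for m
  proof (induction m rule: int_induct[where k = 0])
    case base show ?case by fact
  next
    case (step1 i) then show ?case using mv[OF Lp U(1), of i 0] by (simp add: pt_def algebra_simps)
  next
    case (step2 i) then show ?case using mv[OF Lp U(2), of i 0] by (simp add: pt_def algebra_simps)
  qed
  then have P: "P (pt m n)" for m n
  proof (induction n rule: int_induct[where k = 0])
    case base then show ?case .
  next
    case (step1 i) then show ?case using mv[OF Lp U(3), of m i] by (simp add: pt_def algebra_simps)
  next
    case (step2 i) then show ?case using mv[OF Lp U(4), of m i] by (simp add: pt_def algebra_simps)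
  qed
  obtain b where b: "b \<in> Bonds" "T = Lc b" using assms by (auto simp: Tri_def)
  then obtain m n where "fst b = pt m n" using Lat_pt by (auto simp: Bonds_iff)
  then show ?thesis using P[of m n] b unfolding P_def Bonds_iff
    by (metis add.commute diff_add_cancel prod.collapse)
qed

text \<open>Superposition of strings. The strings leave minus the sum of \<open>d\<close> at the
  origin, which is -1 by the last hypothesis; this is the charge needed to cancel that of the
  predictor.\<close>

lemma integer_field_with_curl:
  assumes "finite S" "S \<subseteq> Tri" "\<And>T. T \<in> S \<Longrightarrow> d T \<in> \<int>" "\<And>T. T \<notin> S \<Longrightarrow> d T = 0" "(\<Sum>T\<in>S. d T) = 1"
  shows "\<exists>s. alternating s \<and> (\<forall>b. s b \<in> \<int>) \<and> finite {b \<in> Bonds. s b \<noteq> 0} \<and>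
     (\<forall>T. curl s T = d T - of_bool (T = 0))"
proof -
  have "\<forall>T\<in>S. \<exists>s. alternating s \<and> (\<forall>b. s b \<in> \<int>) \<and> finite {b \<in> Bonds. s b \<noteq> 0} \<and>
     (\<forall>T'. curl s T' = of_bool (T' = T) - of_bool (T' = 0))"
    using string_to_Tri assms(2) unfolding string_to_def by blast
  from bchoice[OF this] obtain s where ss: "\<forall>T\<in>S. alternating (s T) \<and> (\<forall>b. s T b \<in> \<int>) \<and> 
     finite {b \<in> Bonds. s T b \<noteq> 0} \<and> (\<forall>T'. curl (s T) T' = of_bool (T' = T) - of_bool (T' = 0))"
    by blast
  then have s: "\<And>T. T \<in> S \<Longrightarrow> alternating (s T)" "\<And>T b. T \<in> S \<Longrightarrow> s T b \<in> \<int>"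
    "\<And>T. T \<in> S \<Longrightarrow> finite {b \<in> Bonds. s T b \<noteq> 0}"
    "\<And>T T'. T \<in> S \<Longrightarrow> curl (s T) T' = of_bool (T' = T) - of_bool (T' = 0)"
    by blast+
  show ?thesis
  proof (intro exI[of _ "\<lambda>b. \<Sum>T\<in>S. d T * s T b"] conjI allI)
    show "alternating (\<lambda>b. \<Sum>T\<in>S. d T * s T b)"
      unfolding alternating_def
    proof
      fix b assume "b \<in> Bonds"
      then show "(\<Sum>T\<in>S. d T * s T (rv b)) = - (\<Sum>T\<in>S. d T * s T b)"
        unfolding sum_negf[symmetric] using s(1) by (intro sum.cong) (simp_all add: alternating_def)
    qed
    show "(\<Sum>T\<in>S. d T * s T b) \<in> \<int>" for b using s(2) assms(3) by (intro Ints_sum Ints_mult) auto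
    have "{b \<in> Bonds. (\<Sum>T\<in>S. d T * s T b) \<noteq> 0} \<subseteq> (\<Union>T\<in>S. {b \<in> Bonds. s T b \<noteq> 0})"
    proof
      fix b assume b: "b \<in> {b \<in> Bonds. (\<Sum>T\<in>S. d T * s T b) \<noteq> 0}"
      then have "(\<Sum>T\<in>S. d T * s T b) \<noteq> 0" by simp
      then obtain T where "T \<in> S" "d T * s T b \<noteq> 0" by (rule sum.not_neutral_contains_not_neutral)
      then show "b \<in> (\<Union>T\<in>S. {b \<in> Bonds. s T b \<noteq> 0})" using b by auto
    qed
    then show "finite {b \<in> Bonds. (\<Sum>T\<in>S. d T * s T b) \<noteq> 0}"
      by (rule finite_subset) (use assms(1) s(3) in auto)
    fix T'
    have "curl (\<lambda>b. \<Sum>T\<in>S. d T * s T b) T' = (\<Sum>T\<in>S. d T * curl (s T) T')"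
      unfolding curl_def by (subst sum.swap) (simp add: sum_distrib_left)
    also have "\<dots> = (\<Sum>T\<in>S. d T * of_bool (T' = T)) - (\<Sum>T\<in>S. d T) * of_bool (T' = 0)"
      using s(4) by (simp add: right_diff_distrib sum_subtractf sum_distrib_right)
    also have "(\<Sum>T\<in>S. d T * of_bool (T' = T)) = d T'"
      using assms(1,4) by (cases "T' \<in> S") (auto simp: of_bool_def if_distrib cong: if_cong)
    finally show "curl (\<lambda>b. \<Sum>T\<in>S. d T * s T b) T' = d T' - of_bool (T' = 0)"
      using assms(5) by simp
  qed
qed

section \<open>Elastic strain and the predictor\<close>

text \<open>The tie at half-integers is broken so that the reduction is an odd function.\<close>

definition rd :: "real \<Rightarrow> real" where
  "rd t = t - sgn t * of_int \<lceil>\<bar>t\<bar> - 1/2\<rceil>"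

lemma rd_minus: "rd (- t) = - rd t"
  by (simp add: rd_def sgn_minus)

lemma rd_diff_Ints: "t - rd t \<in> \<int>"
  by (auto simp: rd_def sgn_if)

lemma abs_rd_le: "\<bar>rd t\<bar> \<le> 1/2"
proof -
  define k where "k = real_of_int \<lceil>\<bar>t\<bar> - 1/2\<rceil>"
  have "k \<ge> \<bar>t\<bar> - 1/2" "k < \<bar>t\<bar> - 1/2 + 1"
    using ceiling_correct[of "\<bar>t\<bar> - 1/2"] unfolding k_def by linarith+
  moreover have "t - sgn t * k = (if t > 0 then t - k else if t < 0 then t + k else 0)" by simp
  ultimately show ?thesis unfolding rd_def k_def[symmetric] by (simp only: split: if_split) linarith
qed

lemma Ints_abs_less_1: "x \<in> \<int> \<Longrightarrow> \<bar>x\<bar> < 1 \<Longrightarrow> x = (0::real)"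
  by (auto elim!: Ints_cases)

lemma rd_eqI:
  assumes "t - x \<in> \<int>" "\<bar>x\<bar> < 1/2"
  shows "rd t = x"
proof -
  have "(t - x) - (t - rd t) \<in> \<int>" using assms(1) rd_diff_Ints[of t] by (rule Ints_diff)
  then have "rd t - x \<in> \<int>" by simp
  moreover have "\<bar>rd t - x\<bar> < 1" using abs_rd_le[of t] assms(2) by linarith
  ultimately show ?thesis using Ints_abs_less_1 by force
qed

definition strain :: "(complex \<Rightarrow> real) \<Rightarrow> complex \<times> complex \<Rightarrow> real" where
  "strain y b = rd (Dif y b)"

abbreviation ahat :: "complex \<times> complex \<Rightarrow> real" where
  "ahat \<equiv> strain yhat"

lemma alternating_strain: "alternating (strain y)"
  by (simp add: alternating_def strain_def Dif_def rd_minus[symmetric])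

text \<open>The strain differs from \<open>Dif y\<close>, whose circulation is zero, by an integer
  field.\<close>

lemma curl_strain_Ints: "curl (strain y) T \<in> \<int>"
proof -
  have "curl (\<lambda>b. Dif y b - strain y b) T \<in> \<int>"
    unfolding curl_def strain_def by (intro Ints_sum rd_diff_Ints)
  then have "- curl (\<lambda>b. Dif y b - strain y b) T \<in> \<int>" by (rule Ints_minus)
  then show ?thesis unfolding curl_diff curl_Dif by simp
qed

section \<open>Angles, strain and circulation of the predictor\<close>

lemma cmod_pt: "(cmod (pt m n))\<^sup>2 = 1/3 + of_int (m * m + m * n + n * n + m + n)"
  unfolding cmod_power2 pt_def by (simp add: a2_def power2_eq_square field_simps)

lemma Lat_norm:
  assumes "x \<in> Lat"
  obtains k :: int where "k \<ge> 0" "(cmod x)\<^sup>2 = 1/3 + of_int k"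
proof -
  obtain m n where x: "x = pt m n" using assms Lat_pt by blast
  define k where "k = m * m + m * n + n * n + m + n"
  have e: "(cmod x)\<^sup>2 = 1/3 + of_int k" unfolding x cmod_pt k_def ..
  then have "1/3 + real_of_int k \<ge> 0" by (metis zero_le_power2)
  then have "k \<ge> 0" by linarith
  then show thesis using e that by blast
qed

lemma Lat_nonzero: "x \<in> Lat \<Longrightarrow> x \<noteq> 0"
  by (elim Lat_norm) (auto simp: add_pos_nonneg)

lemma Arg2pi_diff:
  assumes "z \<noteq> 0" "w \<noteq> 0"
  obtains k :: int where "Arg2pi w - Arg2pi z = Arg (w / z) + 2 * pi * of_int k"
proof -
  have w: "w = of_real (cmod w) * exp (\<i> * of_real (Arg2pi w))" by (rule Arg2pi_eq)
  have z: "z = of_real (cmod z) * exp (\<i> * of_real (Arg2pi z))" by (rule Arg2pi_eq)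
  have q: "w / z = of_real (cmod (w / z)) * exp (\<i> * of_real (Arg (w / z)))"
    by (rule Arg_eq) (use assms in auto)
  have "of_real (cmod (w / z)) * exp (\<i> * of_real (Arg2pi w - Arg2pi z)) = w / z"
  proof -
    have wz: "w / z = (of_real (cmod w) * exp (\<i> * of_real (Arg2pi w))) / (of_real (cmod z) * exp (\<i> * of_real (Arg2pi z)))"
      using w z by simp
    have g: "of_real (X / Y) * exp (\<i> * of_real (A - B)) =
        (of_real X * exp (\<i> * of_real A)) / (of_real Y * exp (\<i> * of_real B))" for X Y A B
      by (simp add: exp_diff right_diff_distrib)
    have "of_real (cmod (w / z)) * exp (\<i> * of_real (Arg2pi w - Arg2pi z))
       = of_real (cmod w / cmod z) * exp (\<i> * of_real (Arg2pi w - Arg2pi z))" by (simp only: norm_divide)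
    also note g
    finally show ?thesis using wz by (rule trans[OF _ sym])
  qed
  with q have "of_real (cmod (w / z)) * exp (\<i> * of_real (Arg2pi w - Arg2pi z))
     = of_real (cmod (w / z)) * exp (\<i> * of_real (Arg (w / z)))" by simp
  then have "exp (\<i> * of_real (Arg2pi w - Arg2pi z)) = exp (\<i> * of_real (Arg (w / z)))"
    using assms by simp
  then obtain k :: int where "\<i> * of_real (Arg2pi w - Arg2pi z) = \<i> * of_real (Arg (w / z)) + (of_int (2 * k) * pi) * \<i>"
    unfolding exp_eq by blast
  then have "Arg2pi w - Arg2pi z = Arg (w / z) + 2 * pi * of_int k"
    by (simp add: complex_eq_iff)
  then show thesis by (rule that)
qed

text \<open>Law of cosines: squared norms of lattice points are 1/3 plus nonnegative integers and
  the bond has length 1, so twice the inner product is at least -1/3 while the product of the norms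
  is at least 1/3. Equality leaves only edges of the triangle around the origin.\<close>

lemma bond_angle:
  assumes b: "b \<in> Bonds"
  shows "\<bar>Arg (snd b / fst b)\<bar> \<le> 2 * pi / 3"
    and "\<bar>Arg (snd b / fst b)\<bar> = 2 * pi / 3 \<Longrightarrow> (cmod (fst b))\<^sup>2 = 1/3 \<and> (cmod (snd b))\<^sup>2 = 1/3"
proof -
  let ?x = "fst b" and ?y = "snd b"
  define \<theta> where "\<theta> = Arg (?y / ?x)"
  have L: "?x \<in> Lat" "?y \<in> Lat" using b rv_Bonds[OF b] by (auto simp: Bonds_iff)
  obtain k l :: int where k: "k \<ge> 0" "(cmod ?x)\<^sup>2 = 1/3 + of_int k"
    and l: "l \<ge> 0" "(cmod ?y)\<^sup>2 = 1/3 + of_int l" using Lat_norm[OF L(1)] Lat_norm[OF L(2)] by metis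
  have nz: "?x \<noteq> 0" "?y \<noteq> 0" using L Lat_nonzero by auto
  have one: "(cmod (?y - ?x))\<^sup>2 = 1" using b by (simp add: Bonds_iff Units_eq)
  have "cos \<theta> = Re (?y / ?x) / cmod (?y / ?x)"
    using cis_Arg[of "?y / ?x"] nz unfolding \<theta>_def
    by (metis Re_sgn cis.sel(1) divide_eq_0_iff)
  also have "Re (?y / ?x) = Re (?y * cnj ?x) / (cmod ?x)\<^sup>2"
    by (subst complex_div_cnj) (simp flip: of_real_power)
  also have "cmod (?y / ?x) = cmod ?y / cmod ?x" by (rule norm_divide)
  finally have co: "cos \<theta> = Re (?y * cnj ?x) / (cmod ?x)\<^sup>2 / (cmod ?y / cmod ?x)" .
  have "cos \<theta> * (cmod ?x * cmod ?y) = Re (?y * cnj ?x)"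
  proof -
    have *: "c / X\<^sup>2 / (Y / X) * (X * Y) = c" if "X \<noteq> 0" "Y \<noteq> 0" for c X Y :: real
      using that by (simp add: field_simps power2_eq_square)
    show ?thesis unfolding co by (rule *) (use nz in auto)
  qed
  moreover have "(cmod (?y - ?x))\<^sup>2 = (cmod ?x)\<^sup>2 + (cmod ?y)\<^sup>2 - 2 * Re (?y * cnj ?x)"
    unfolding cmod_power2 by (simp add: power2_eq_square algebra_simps)
  ultimately have cs: "2 * (cos \<theta> * (cmod ?x * cmod ?y)) = of_int k + of_int l - 1/3"
    using one k l by simp
  have P: "cmod ?x * cmod ?y \<ge> 1/3"
  proof (rule power2_le_imp_le)
    have "(1/3) * (1/3) \<le> (cmod ?x)\<^sup>2 * (cmod ?y)\<^sup>2"
      unfolding k(2) l(2) using k l by (intro mult_mono) auto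
    then show "(1/3)\<^sup>2 \<le> (cmod ?x * cmod ?y)\<^sup>2" unfolding power_mult_distrib power2_eq_square[of "1/3"] .
  qed simp
  have "2 * (cos \<theta> * (cmod ?x * cmod ?y)) \<ge> - (1/3)" using cs k l by simp
  then have "(2 * cos \<theta> + 1) * (cmod ?x * cmod ?y) \<ge> 0" using P by (simp add: algebra_simps)
  then have c1: "cos \<theta> \<ge> - 1/2"
    using P by (simp add: zero_le_mult_iff)
  have th: "\<bar>\<theta>\<bar> \<le> pi" unfolding \<theta>_def using mpi_less_Arg[of "?y / ?x"] Arg_le_pi[of "?y / ?x"] by linarith
  have ca: "cos \<bar>\<theta>\<bar> = cos \<theta>" by (simp add: abs_if)
  show le: "\<bar>Arg (?y / ?x)\<bar> \<le> 2 * pi / 3"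
  proof (rule ccontr)
    assume "\<not> ?thesis"
    then have "cos \<bar>\<theta>\<bar> < cos (2 * pi / 3)" using th unfolding \<theta>_def by (intro cos_monotone_0_pi) auto
    then show False using c1 unfolding ca cos_120 by simp
  qed
  assume "\<bar>Arg (?y / ?x)\<bar> = 2 * pi / 3"
  then have "cos \<bar>\<theta>\<bar> = cos (2 * pi / 3)" unfolding \<theta>_def by (simp only:)
  then have "cos \<theta> = - 1/2" unfolding ca cos_120 .
  then have "- (cmod ?x * cmod ?y) = of_int k + of_int l - 1/3" using cs by simp
  then have "of_int k + of_int l \<le> (0 :: real)" using P by simp
  then have "k = 0" "l = 0" using k l by linarith+
  then show "(cmod ?x)\<^sup>2 = 1/3 \<and> (cmod ?y)\<^sup>2 = 1/3" using k l by simp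
qed

text \<open>Reduction modulo 1 removes the branch cut: the strain is the principal angle under which
  the bond is seen from the origin. The bound of 120 degrees keeps it away from the tie at
  1/2.\<close>

lemma ahat_eq:
  assumes b: "b \<in> Bonds"
  shows "ahat b = Arg (snd b / fst b) / (2 * pi)"
proof -
  have L: "fst b \<in> Lat" "snd b \<in> Lat" using b rv_Bonds[OF b] by (auto simp: Bonds_iff)
  then have nz: "fst b \<noteq> 0" "snd b \<noteq> 0" using Lat_nonzero by auto
  obtain k :: int where k: "Arg2pi (snd b) - Arg2pi (fst b) = Arg (snd b / fst b) + 2 * pi * of_int k"
    using Arg2pi_diff[OF nz] by blast
  have "Dif yhat b = (Arg2pi (snd b) - Arg2pi (fst b)) / (2 * pi)"
    using L by (simp add: Dif_def yhat_def diff_divide_distrib)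
  also have "\<dots> = Arg (snd b / fst b) / (2 * pi) + of_int k"
    unfolding k by (simp add: add_divide_distrib)
  finally have "Dif yhat b - Arg (snd b / fst b) / (2 * pi) \<in> \<int>" by simp
  moreover have "\<bar>Arg (snd b / fst b) / (2 * pi)\<bar> < 1/2"
  proof -
    have "\<bar>Arg (snd b / fst b)\<bar> < pi" using bond_angle(1)[OF b] pi_gt_zero by linarith
    then show ?thesis using pi_gt_zero by (simp add: field_simps)
  qed
  ultimately show ?thesis unfolding strain_def by (rule rd_eqI)
qed

lemma abs_ahat_le:
  assumes b: "b \<in> Bonds"
  shows "\<bar>ahat b\<bar> \<le> 1/3"
    and "\<bar>ahat b\<bar> = 1/3 \<Longrightarrow> (cmod (fst b))\<^sup>2 = 1/3 \<and> (cmod (snd b))\<^sup>2 = 1/3"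
  using bond_angle[OF b] pi_gt_zero unfolding ahat_eq[OF b] by (simp_all add: field_simps)

text \<open>The parallel-axis identity for the vertices of an equilateral triangle and its centroid
  \<open>v + e * z0\<close>.\<close>

lemma triangle_norms:
  "(cmod v)\<^sup>2 + (cmod (v + e))\<^sup>2 + (cmod (v + e * a2))\<^sup>2 = 3 * (cmod (v + e * z0))\<^sup>2 + (cmod e)\<^sup>2"
proof -
  obtain a b c d where v: "v = Complex a b" and e: "e = Complex c d" by (metis complex.exhaust)
  define s3 where "s3 = sqrt 3"
  have s: "s3 * s3 = 3" by (simp add: s3_def)
  have *: "s3 * (s3 * x) = 3 * x" for x using s by (metis mult.assoc)
  show ?thesis unfolding v e cmod_power2 a2_def s3_def[symmetric]
    by (simp add: power2_eq_square field_simps s *)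
qed

text \<open>Three strains of modulus at most 1/3 sum to an integer, so a nonzero value forces all of
  them to be extreme. Then all vertices have squared norm 1/3, and the parallel-axis identity puts
  the centroid at 0. There each edge subtends exactly 120 degrees.\<close>

lemma curl_ahat: "curl ahat T = of_bool (T = 0)"
proof (cases "T \<in> Tri")
  case False
  then show ?thesis using zero_Tri curl_not_Tri by auto
next
  case True
  then obtain b where b: "b \<in> Bonds" "T = Lc b" by (auto simp: Tri_def)
  define e where "e = snd b - fst b"
  have bs: "nxt b \<in> Bonds" "nxt (nxt b) \<in> Bonds" using b nxt_Bonds by auto
  have cu: "curl ahat T = ahat b + ahat (nxt b) + ahat (nxt (nxt b))" using b curl_eq by simp
  show ?thesis
  proof (cases "T = 0")
    case True
    have a3: "ahat c = 1/3" if c: "c \<in> Bonds" "Lc c = 0" for c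
    proof -
      define f where "f = snd c - fst c"
      have f0: "f \<noteq> 0" using c by (auto simp: Bonds_iff Units_eq f_def)
      have "fst c = - (f * z0)" using c(2) by (simp add: Lc_def f_def add_eq_0_iff)
      moreover have "snd c = f + fst c" by (simp add: f_def)
      ultimately have "snd c = f * (1 - z0)" by (simp add: algebra_simps)
      moreover have "1 - z0 = - (z0 * (a2 - 1))" by (simp add: a2_def complex_eq_iff)
      ultimately have "snd c = (a2 - 1) * fst c" using \<open>fst c = _\<close> by (simp add: algebra_simps)
      moreover have "fst c \<noteq> 0" using c Lat_nonzero by (auto simp: Bonds_iff)
      ultimately have "snd c / fst c = a2 - 1" by simp
      also have "a2 - 1 = cis (2 * pi / 3)"
        by (simp add: a2_def complex_eq_iff cos_120 sin_120)
      finally have "Arg (snd c / fst c) = 2 * pi / 3"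
        using pi_gt_zero by (simp add: Arg_cis)
      then show ?thesis using ahat_eq[OF c(1)] by simp
    qed
    have "Lc b = 0" "Lc (nxt b) = 0" "Lc (nxt (nxt b)) = 0" using True b Lc_nxt by simp_all
    then have "ahat b = 1/3" "ahat (nxt b) = 1/3" "ahat (nxt (nxt b)) = 1/3"
      using a3 b(1) bs by blast+
    then show ?thesis unfolding cu using True by simp
  next
    case False
    have "\<bar>curl ahat T\<bar> < 1"
    proof (rule ccontr)
      assume n: "\<not> \<bar>curl ahat T\<bar> < 1"
      then have "\<bar>ahat b\<bar> = 1/3" "\<bar>ahat (nxt b)\<bar> = 1/3"
        using abs_ahat_le(1)[OF b(1)] abs_ahat_le(1)[OF bs(1)] abs_ahat_le(1)[OF bs(2)] unfolding cu by linarith+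
      then have "(cmod (fst b))\<^sup>2 = 1/3" "(cmod (snd b))\<^sup>2 = 1/3" "(cmod (snd (nxt b)))\<^sup>2 = 1/3"
        using abs_ahat_le(2)[OF b(1)] abs_ahat_le(2)[OF bs(1)] by auto
      moreover have "snd b = fst b + e" "snd (nxt b) = fst b + e * a2"
        by (simp_all add: e_def nxt_def algebra_simps)
      moreover have "cmod e = 1" using b by (simp add: e_def Bonds_iff Units_eq)
      ultimately have "(cmod (fst b))\<^sup>2 = 1/3" "(cmod (fst b + e))\<^sup>2 = 1/3" "(cmod (fst b + e * a2))\<^sup>2 = 1/3"
        "(cmod e)\<^sup>2 = 1" by (simp_all only: one_power2)
      then have "3 * (cmod (fst b + e * z0))\<^sup>2 = 0"
        using triangle_norms[of "fst b" e] by linarith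
      then have "T = 0" unfolding b(2) by (simp add: Lc_def e_def)
      then show False using False by simp
    qed
    then show ?thesis using Ints_abs_less_1[OF curl_strain_Ints] False by simp
  qed
qed

text \<open>As the argument and the logarithm are conjugate harmonic functions, \<open>ahat b\<close> equals \<open>c0 * ff b\<close> up to
  a term quadratic in \<open>1 / cmod (md b)\<close>; the factor \<open>sqrt 3\<close> is the ratio of the length of a bond to the distance of the
  two triangle centres next to it.\<close>

definition c0 :: real where "c0 = sqrt 3 / (2 * pi)"

definition ff :: "complex \<times> complex \<Rightarrow> real" where
  "ff b = ln (cmod (Lc (rv b))) - ln (cmod (Lc b))"

lemma c0_pos: "c0 > 0" by (simp add: c0_def)

section \<open>Decay of the predictor strain and its comparison with the logarithm\<close>

lemma Ln_one_plus:
  fixes u :: complex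
  assumes "cmod u \<le> t" "t \<le> 1/2"
  shows "cmod (Ln (1 + u) - u) \<le> 2 * t\<^sup>2" "1 + u \<noteq> 0"
proof -
  have "cmod (Ln (1 + u) - u) \<le> (cmod u)\<^sup>2 / (1 - cmod u)"
    using Ln_approx_linear[of u] assms by simp
  also have "\<dots> \<le> t\<^sup>2 / (1/2)"
    using assms by (intro frac_le power_mono) auto
  finally show "cmod (Ln (1 + u) - u) \<le> 2 * t\<^sup>2" by simp
  show "1 + u \<noteq> 0"
  proof
    assume "1 + u = 0"
    then have "u = - 1" by (simp add: add_eq_0_iff)
    then show False using assms by simp
  qed
qed

text \<open>The endpoints have ratio \<open>1 + u\<close> and the two centres ratio
  \<open>1 + v\<close>. To first order the logarithms are \<open>u\<close> and \<open>v\<close>, and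
  \<open>sqrt 3 * (1 - 2 * z0) = - \<i>\<close> turns the imaginary part of one into the real part
  of the other. \<open>t\<close> bounds the inverse norm of any point within 1/2 of the
  midpoint.\<close>

lemma far_expansion:
  assumes b: "b \<in> Bonds" and r: "cmod (md b) \<ge> 4"
  defines "t \<equiv> 2 / (1 + cmod (md b))"
  shows "\<bar>ff b\<bar> \<le> 2 * t" "\<bar>ahat b\<bar> \<le> 2 * t" "\<bar>ahat b - c0 * ff b\<bar> \<le> 7 * t\<^sup>2"
proof -
  define x where "x = fst b"
  define e where "e = snd b - fst b"
  define L where "L = Lc b"
  define L' where "L' = Lc (rv b)"
  have e1: "cmod e = 1" using b by (simp add: e_def Bonds_iff Units_eq)
  have x: "cmod x \<ge> cmod (md b) - 1/2"
    using fst_md[OF b] norm_triangle_ineq2[of "md b" "md b - x"] by (simp add: x_def norm_minus_commute)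
  have Lm: "cmod L \<ge> cmod (md b) - 1/2"
    using Lc_md[OF b] norm_triangle_ineq2[of "md b" "md b - L"] by (simp add: L_def norm_minus_commute)
  have t: "t > 0" "t \<le> 1/2" using r by (auto simp: t_def field_simps)
  have inv: "1 / cmod z \<le> t" if "cmod z \<ge> cmod (md b) - 1/2" for z
  proof -
    have "(1 + cmod (md b)) / 2 \<le> cmod z" using that r by (simp add: field_simps)
    then have "1 / cmod z \<le> 1 / ((1 + cmod (md b)) / 2)"
      using r by (intro divide_left_mono mult_pos_pos divide_pos_pos) auto
    then show ?thesis by (simp add: t_def)
  qed
  have nz: "x \<noteq> 0" "L \<noteq> 0" using x Lm r by auto
  define u where "u = e / x"
  define v where "v = e * (1 - 2 * z0) / L"
  have z1: "cmod (1 - 2 * z0) \<le> 1"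
  proof -
    have "1 - 2 * z0 = Complex 0 (- (sqrt 3 / 3))" by (simp add: complex_eq_iff)
    then show ?thesis using real_le_lsqrt[of 3 3] by (simp add: complex_norm)
  qed
  have u: "cmod u \<le> t" using inv[OF x] e1 by (simp add: u_def norm_divide)
  have v: "cmod v \<le> t"
  proof -
    have "cmod v = cmod (1 - 2 * z0) / cmod L" using e1 by (simp only: v_def norm_divide norm_mult mult_1)
    also have "\<dots> \<le> 1 / cmod L" using z1 by (intro divide_right_mono) auto
    also have "\<dots> \<le> t" by (rule inv[OF Lm])
    finally show ?thesis .
  qed
  note Lu = Ln_one_plus[OF u t(2)] and Lv = Ln_one_plus[OF v t(2)]
  have q1: "snd b / fst b = 1 + u" using nz by (simp add: u_def e_def x_def field_simps)
  have q2: "L' / L = 1 + v"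
  proof -
    have "L' = L + e * (1 - 2 * z0)" by (simp add: L'_def L_def Lc_def e_def algebra_simps)
    then show ?thesis using nz by (simp add: v_def add_divide_distrib)
  qed
  have A: "2 * pi * ahat b = Im (Ln (1 + u))"
    unfolding ahat_eq[OF b] q1 using Arg_eq_Im_Ln[OF Lu(2)] by simp
  have nz': "L' \<noteq> 0" using q2 Lv(2) nz by auto
  have F: "ff b = Re (Ln (1 + v))"
    unfolding ff_def L_def[symmetric] L'_def[symmetric]
    using nz nz' Lv(2) by (simp add: norm_divide ln_div flip: q2)
  have A1: "\<bar>2 * pi * ahat b - Im u\<bar> \<le> 2 * t\<^sup>2"
    using abs_Im_le_cmod[of "Ln (1 + u) - u"] Lu(1) unfolding A by simp
  have F1: "\<bar>ff b - Re v\<bar> \<le> 2 * t\<^sup>2"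
    using abs_Re_le_cmod[of "Ln (1 + v) - v"] Lv(1) unfolding F by simp
  have tt: "2 * t\<^sup>2 \<le> t" using t mult_right_mono[of "2 * t" 1 t] by (simp add: power2_eq_square)
  show "\<bar>ff b\<bar> \<le> 2 * t" using F1 abs_Re_le_cmod[of v] v tt by linarith
  have "\<bar>2 * pi * ahat b\<bar> \<le> 2 * t" using A1 abs_Im_le_cmod[of u] u tt by linarith
  moreover have pi1: "\<bar>z\<bar> \<le> \<bar>2 * pi * z\<bar>" for z :: real
    using mult_right_mono[of 1 "2 * pi" "\<bar>z\<bar>"] pi_gt3 by (simp add: abs_mult)
  ultimately show "\<bar>ahat b\<bar> \<le> 2 * t" using pi1[of "ahat b"] by linarith
  have sq: "sqrt 3 * Re v = Im (e / L)"
  proof -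
    have "of_real (sqrt 3) * (1 - 2 * z0) = - \<i>" by (simp add: complex_eq_iff)
    then have "of_real (sqrt 3) * v = - \<i> * (e / L)"
      unfolding v_def by (metis mult.assoc mult.commute times_divide_eq_right)
    then have "Re (of_real (sqrt 3) * v) = Re (- \<i> * (e / L))" by (rule arg_cong)
    moreover have "Re (- \<i> * w) = Im w" "Re (of_real s * w) = s * Re w" for w s by simp_all
    ultimately show ?thesis by (simp only:)
  qed
  have dx: "\<bar>Im u - Im (e / L)\<bar> \<le> t\<^sup>2"
  proof -
    have "\<bar>Im u - Im (e / L)\<bar> \<le> cmod (u - e / L)" using abs_Im_le_cmod[of "u - e / L"] by simp
    also have "u - e / L = e * (L - x) / (x * L)" using nz by (simp add: u_def field_simps)
    also have "L - x = e * z0" by (simp add: L_def Lc_def e_def x_def)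
    also have "cmod (e * (e * z0) / (x * L)) = cmod z0 * ((1 / cmod x) * (1 / cmod L))"
      using e1 by (simp add: norm_divide norm_mult)
    also have "\<dots> \<le> 1 * (t * t)"
    proof (intro mult_mono inv x Lm)
      show "cmod z0 \<le> 1" using cmod_le[of z0] real_le_lsqrt[of 2 3] by simp
    qed (use t in auto)
    finally show ?thesis by (simp add: power2_eq_square)
  qed
  have s2: "sqrt 3 \<le> 2" by (rule real_le_lsqrt) auto
  have "\<bar>sqrt 3 * ff b - sqrt 3 * Re v\<bar> \<le> 2 * (2 * t\<^sup>2)"
  proof -
    have "\<bar>sqrt 3 * ff b - sqrt 3 * Re v\<bar> = sqrt 3 * \<bar>ff b - Re v\<bar>"
      by (simp add: abs_mult flip: right_diff_distrib)
    also have "\<dots> \<le> 2 * (2 * t\<^sup>2)" using F1 s2 by (intro mult_mono) auto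
    finally show ?thesis .
  qed
  \<comment> \<open>The constant 7 collects 2 from linearising the angle, 1 from moving the base
    point from \<open>x\<close> to \<open>L\<close>, and 4 from linearising \<open>ff\<close> times
    \<open>sqrt 3 \<le> 2\<close>.\<close>
  then have "\<bar>2 * pi * ahat b - sqrt 3 * ff b\<bar> \<le> 7 * t\<^sup>2"
    using A1 dx unfolding sq by linarith
  moreover have "2 * pi * (ahat b - c0 * ff b) = 2 * pi * ahat b - sqrt 3 * ff b"
    by (simp add: c0_def field_simps)
  ultimately show "\<bar>ahat b - c0 * ff b\<bar> \<le> 7 * t\<^sup>2" using pi1[of "ahat b - c0 * ff b"] by linarith
qed

text \<open>Far bonds obey the expansion; the finitely many bonds of \<open>Bd 0 4\<close> are
  absorbed into the constant. There 36 is 4 + 4 + 28, the sum of the three far bounds after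
  scaling.\<close>

lemma ex_decay_const:
  "\<exists>K>0. \<forall>b\<in>Bonds. \<bar>ff b\<bar> \<le> K / (1 + cmod (md b)) \<and> \<bar>ahat b\<bar> \<le> K / (1 + cmod (md b)) \<and>
     \<bar>ahat b - c0 * ff b\<bar> \<le> K / (1 + cmod (md b))\<^sup>2"
proof -
  define g where "g b = \<bar>ff b\<bar> * (1 + cmod (md b)) + \<bar>ahat b\<bar> * (1 + cmod (md b)) 
     + \<bar>ahat b - c0 * ff b\<bar> * (1 + cmod (md b))\<^sup>2" for b
  define K where "K = 36 + (\<Sum>b\<in>Bd 0 4. g b)"
  have g0: "g b \<ge> 0" for b unfolding g_def by (intro add_nonneg_nonneg mult_nonneg_nonneg) auto
  have s0: "(\<Sum>b\<in>Bd 0 4. g b) \<ge> 0" by (intro sum_nonneg g0)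
  have gK: "g b \<le> K" if b: "b \<in> Bonds" for b
  proof (cases "b \<in> Bd 0 4")
    case True
    then have "g b \<le> (\<Sum>b\<in>Bd 0 4. g b)" by (intro member_le_sum) (auto simp: g0)
    then show ?thesis by (simp add: K_def)
  next
    case False
    then have r: "cmod (md b) \<ge> 4" using b by (auto simp: Bd_def)
    define s where "s = 1 + cmod (md b)"
    have s: "s > 0" by (simp add: s_def add_pos_nonneg)
    note f = far_expansion[OF b r, folded s_def]
    have "\<bar>ff b\<bar> * s \<le> 2 * (2 / s) * s" "\<bar>ahat b\<bar> * s \<le> 2 * (2 / s) * s"
      "\<bar>ahat b - c0 * ff b\<bar> * s\<^sup>2 \<le> 7 * (2 / s)\<^sup>2 * s\<^sup>2"
      using f s by (intro mult_right_mono; simp)+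
    then have "g b \<le> 36" using s unfolding g_def s_def[symmetric] by (simp add: power_divide)
    then show ?thesis using s0 by (simp add: K_def)
  qed
  have "\<bar>ff b\<bar> \<le> K / (1 + cmod (md b)) \<and> \<bar>ahat b\<bar> \<le> K / (1 + cmod (md b)) \<and>
     \<bar>ahat b - c0 * ff b\<bar> \<le> K / (1 + cmod (md b))\<^sup>2" if "b \<in> Bonds" for b
  proof -
    define s where "s = 1 + cmod (md b)"
    have s: "s > 0" by (simp add: s_def add_pos_nonneg)
    have n: "0 \<le> \<bar>ff b\<bar> * s" "0 \<le> \<bar>ahat b\<bar> * s" "0 \<le> \<bar>ahat b - c0 * ff b\<bar> * s\<^sup>2" using s by auto
    have "\<bar>ff b\<bar> * s + \<bar>ahat b\<bar> * s + \<bar>ahat b - c0 * ff b\<bar> * s\<^sup>2 \<le> K"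
      using gK[OF that] by (simp add: g_def s_def)
    then have "\<bar>ff b\<bar> * s \<le> K" "\<bar>ahat b\<bar> * s \<le> K" "\<bar>ahat b - c0 * ff b\<bar> * s\<^sup>2 \<le> K"
      using n by linarith+
    then show ?thesis unfolding s_def[symmetric] using s by (simp add: pos_le_divide_eq)
  qed
  moreover have "K > 0" using s0 by (simp add: K_def)
  ultimately show ?thesis by blast
qed

definition K0 :: real where
  "K0 = (SOME K. K > 0 \<and> (\<forall>b\<in>Bonds. \<bar>ff b\<bar> \<le> K / (1 + cmod (md b)) \<and> \<bar>ahat b\<bar> \<le> K / (1 + cmod (md b)) \<and>
     \<bar>ahat b - c0 * ff b\<bar> \<le> K / (1 + cmod (md b))\<^sup>2))"

lemma K0_spec: "K0 > 0 \<and> (\<forall>b\<in>Bonds. \<bar>ff b\<bar> \<le> K0 / (1 + cmod (md b)) \<and> \<bar>ahat b\<bar> \<le> K0 / (1 + cmod (md b)) \<and>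
     \<bar>ahat b - c0 * ff b\<bar> \<le> K0 / (1 + cmod (md b))\<^sup>2)"
  unfolding K0_def by (rule someI_ex) (use ex_decay_const in blast)

lemma K0_pos: "K0 > 0" using K0_spec by blast

lemma decay:
  assumes "b \<in> Bonds"
  shows "\<bar>ff b\<bar> \<le> K0 / (1 + cmod (md b))" "\<bar>ahat b\<bar> \<le> K0 / (1 + cmod (md b))"
    "\<bar>ahat b - c0 * ff b\<bar> \<le> K0 / (1 + cmod (md b))\<^sup>2"
  using K0_spec assms by blast+

section \<open>Sharp energy bounds on annuli\<close>

definition ee :: "real \<Rightarrow> real" where
  "ee r = infsum wt (Bonds - Bd 0 r)"

lemma wt_summable_subset: "A \<subseteq> Bonds \<Longrightarrow> wt summable_on A"
  by (rule summable_on_subset_banach[OF wt_summable])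

lemma ee_nonneg: "ee r \<ge> 0"
  unfolding ee_def by (rule infsum_nonneg) (simp add: less_imp_le[OF wt_pos])

lemma sum_wt_le_ee:
  assumes "finite F" "F \<subseteq> Bonds - Bd 0 r"
  shows "sum wt F \<le> ee r"
  unfolding ee_def
  by (rule finite_sum_le_infsum[OF wt_summable_subset]) (use assms in \<open>auto simp: less_imp_le[OF wt_pos]\<close>)

lemma ee_antimono: "r \<le> r' \<Longrightarrow> ee r' \<le> ee r"
  unfolding ee_def
  by (rule infsum_mono2[OF wt_summable_subset wt_summable_subset])
     (use Bd_mono[of r r' 0] in \<open>auto simp: less_imp_le[OF wt_pos]\<close>)

lemma ee_tendsto: "(ee \<longlongrightarrow> 0) at_top"
proof (rule tendstoI)
  fix e :: real assume e: "e > 0"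
  obtain F where F: "finite F" "F \<subseteq> Bonds" "dist (sum wt F) (infsum wt Bonds) \<le> e / 2"
    using infsum_finite_approximation[OF wt_summable, of "e / 2"] e by auto
  obtain R where R: "F \<subseteq> Bd 0 R" using finite_bonds_subset_Bd[OF F(1,2)] by blast
  have "dist (ee r) 0 < e" if "r \<ge> R" for r
  proof -
    have "infsum wt Bonds = infsum wt (Bd 0 r) + ee r"
    proof -
      have "Bonds = Bd 0 r \<union> (Bonds - Bd 0 r)" using Bd_subset_Bonds by auto
      then show ?thesis unfolding ee_def
        using infsum_Un_disjoint[OF wt_summable_subset wt_summable_subset, of "Bd 0 r" "Bonds - Bd 0 r"]
          Bd_subset_Bonds by auto
    qed
    moreover have "sum wt F \<le> infsum wt (Bd 0 r)"
      using R Bd_mono[OF that, of 0] by (auto intro!: sum_mono2 simp: less_imp_le[OF wt_pos])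
    ultimately have "ee r \<le> e / 2" using F(3) by (simp add: dist_real_def abs_if split: if_splits)
    then show ?thesis using ee_nonneg[of r] e by (simp add: dist_real_def)
  qed
  then show "\<forall>\<^sub>F r in at_top. dist (ee r) 0 < e"
    unfolding eventually_at_top_linorder by blast
qed

text \<open>As \<open>ln 0 = 0\<close>, the truncation also gives the right value at the centre p when \<open>r1 \<ge> 1\<close>.\<close>

definition Hc :: "complex \<Rightarrow> real \<Rightarrow> real \<Rightarrow> complex \<Rightarrow> real" where
  "Hc p r1 r2 T = max 0 (min (ln r2 - ln r1) (ln r2 - ln (cmod (T - p))))"

lemma Hc_inside:
  assumes "1 \<le> r1" "r1 \<le> r2" "cmod (T - p) \<le> r1"
  shows "Hc p r1 r2 T = ln r2 - ln r1"
proof -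
  have "ln (cmod (T - p)) \<le> ln r1"
    using assms by (cases "T = p") auto
  moreover have "ln r1 \<le> ln r2" using assms by simp
  ultimately show ?thesis by (simp add: Hc_def)
qed

lemma Hc_outside:
  assumes "0 < r2" "r2 \<le> cmod (T - p)"
  shows "Hc p r1 r2 T = 0"
proof -
  have "ln r2 \<le> ln (cmod (T - p))" using assms by (intro ln_mono) auto
  then show ?thesis by (simp add: Hc_def)
qed

text \<open>Projection onto an interval is monotone and 1-Lipschitz, hence firmly nonexpansive. The
  product form lets the energy of a truncated logarithm be estimated by its pairing with the
  untruncated field \<open>ff\<close>.\<close>

lemma clamp_diff:
  fixes a b m :: real
  defines "c \<equiv> \<lambda>x. max 0 (min m x)"
  assumes "m \<ge> 0"
  shows "(c a - c b)\<^sup>2 \<le> (c a - c b) * (a - b)" "\<bar>c a - c b\<bar> \<le> \<bar>a - b\<bar>"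
proof -
  have 1: "0 \<le> c x - c y \<and> c x - c y \<le> x - y" if "x \<ge> y" for x y
    using that assms(2) unfolding c_def by (auto simp: max_def min_def)
  have *: "(c x - c y)\<^sup>2 \<le> (c x - c y) * (x - y)" if "x \<ge> y" for x y
    using 1[OF that] by (simp add: power2_eq_square mult_left_mono)
  show "\<bar>c a - c b\<bar> \<le> \<bar>a - b\<bar>" using 1[of a b] 1[of b a] by linarith
  show "(c a - c b)\<^sup>2 \<le> (c a - c b) * (a - b)"
  proof (cases "a \<ge> b")
    case False
    then have "(c b - c a)\<^sup>2 \<le> (c b - c a) * (b - a)" using *[of a b] by simp
    then show ?thesis by (simp add: power2_commute algebra_simps)
  qed (rule *)
qed

lemma grd_Hc_ff:
  assumes "r1 \<le> r2" "0 < r1"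
  shows "(grd (Hc 0 r1 r2) b)\<^sup>2 \<le> grd (Hc 0 r1 r2) b * ff b" "\<bar>grd (Hc 0 r1 r2) b\<bar> \<le> \<bar>ff b\<bar>"
proof -
  have m: "ln r2 - ln r1 \<ge> 0" using assms by simp
  have f: "ff b = (ln r2 - ln (cmod (Lc b))) - (ln r2 - ln (cmod (Lc (rv b))))" by (simp add: ff_def)
  show "(grd (Hc 0 r1 r2) b)\<^sup>2 \<le> grd (Hc 0 r1 r2) b * ff b" "\<bar>grd (Hc 0 r1 r2) b\<bar> \<le> \<bar>ff b\<bar>"
    unfolding f grd_def Hc_def diff_zero by (rule clamp_diff[OF m])+
qed

lemma centre_dist:
  assumes "b \<in> Bonds"
  shows "\<bar>cmod (Lc b - p) - cmod (md b - p)\<bar> \<le> 1/2" "\<bar>cmod (Lc (rv b) - p) - cmod (md b - p)\<bar> \<le> 1/2"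
proof -
  have *: "\<bar>cmod (z - p) - cmod (w - p)\<bar> \<le> cmod (z - w)" for z w
    using norm_triangle_ineq3[of "z - p" "w - p"] by simp
  show "\<bar>cmod (Lc b - p) - cmod (md b - p)\<bar> \<le> 1/2" "\<bar>cmod (Lc (rv b) - p) - cmod (md b - p)\<bar> \<le> 1/2"
    using *[of "Lc b" "md b"] *[of "Lc (rv b)" "md b"] Lc_md[OF assms] Lc_rv_md[OF assms] by linarith+
qed

lemma grd_Hc_inside:
  assumes "b \<in> Bonds" "1 \<le> r1" "r1 \<le> r2" "cmod (md b - p) \<le> r1 - 1"
  shows "grd (Hc p r1 r2) b = 0"
proof -
  have "cmod (Lc b - p) \<le> r1" "cmod (Lc (rv b) - p) \<le> r1"
    using centre_dist[OF assms(1), of p] assms(4) by linarith+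
  then show ?thesis using assms by (simp add: grd_def Hc_inside)
qed



lemma grd_Hc_between:
  assumes "b \<in> Bonds" "1 \<le> r1" "r1 + 1 \<le> cmod (md b)" "cmod (md b) \<le> r2 - 1"
  shows "grd (Hc 0 r1 r2) b = ff b"
proof -
  have *: "Hc 0 r1 r2 T = ln r2 - ln (cmod T)" if "r1 \<le> cmod T" "cmod T \<le> r2" for T
  proof -
    have "ln r1 \<le> ln (cmod T)" "ln (cmod T) \<le> ln r2" using that assms(2) by (intro ln_mono; linarith)+
    then show ?thesis by (simp add: Hc_def)
  qed
  have d: "\<bar>cmod (Lc b) - cmod (md b)\<bar> \<le> 1/2" "\<bar>cmod (Lc (rv b)) - cmod (md b)\<bar> \<le> 1/2"
    using centre_dist[OF assms(1), of 0] by simp_all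
  have "Hc 0 r1 r2 (Lc b) = ln r2 - ln (cmod (Lc b))"
    by (rule *) (use d assms in linarith)+
  moreover have "Hc 0 r1 r2 (Lc (rv b)) = ln r2 - ln (cmod (Lc (rv b)))"
    by (rule *) (use d assms in linarith)+
  ultimately show ?thesis by (simp add: grd_def ff_def)
qed

lemma ff_wt:
  assumes "b \<in> Bonds"
  shows "\<bar>ff b\<bar> * \<bar>ahat b - c0 * ff b\<bar> \<le> K0\<^sup>2 * wt b" "\<bar>ahat b\<bar> * \<bar>ahat b - c0 * ff b\<bar> \<le> K0\<^sup>2 * wt b"
proof -
  let ?s = "1 + cmod (md b)"
  have s: "?s > 0" by (simp add: add_pos_nonneg)
  have e: "K0 / ?s * (K0 / ?s\<^sup>2) = K0\<^sup>2 * wt b"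
    using s by (simp add: wt_def power2_eq_square power3_eq_cube)
  show "\<bar>ff b\<bar> * \<bar>ahat b - c0 * ff b\<bar> \<le> K0\<^sup>2 * wt b" "\<bar>ahat b\<bar> * \<bar>ahat b - c0 * ff b\<bar> \<le> K0\<^sup>2 * wt b"
    unfolding e[symmetric] using decay[OF assms] s K0_pos by (intro mult_mono; simp)+
qed

text \<open>After bounding the square by the pairing with \<open>ff\<close>, \<open>c0 * ff\<close>
  is replaced by \<open>ahat\<close>. The pairing with \<open>ahat\<close> is exact by Stokes, since
  its only charge is the unit one at 0; the replacement costs a tail of \<open>wt\<close>.\<close>

lemma grd_Hc_energy_0:
  assumes r: "1 \<le> r1" "r1 \<le> r2"
  shows "(\<Sum>b\<in>Bd 0 R. (grd (Hc 0 r1 r2) b)\<^sup>2) \<le> 2 / c0 * (ln r2 - ln r1) + K0\<^sup>2 / c0 * ee (r1 - 1)"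
proof -
  define R' where "R' = max R (r2 + 1)"
  let ?F = "grd (Hc 0 r1 r2)"
  have "(\<Sum>b\<in>Bd 0 R. (?F b)\<^sup>2) \<le> (\<Sum>b\<in>Bd 0 R'. (?F b)\<^sup>2)"
    by (intro sum_mono2 Bd_mono) (auto simp: R'_def)
  also have "\<dots> \<le> (\<Sum>b\<in>Bd 0 R'. ?F b * ff b)"
    using r by (intro sum_mono grd_Hc_ff) auto
  also have "\<dots> = (\<Sum>b\<in>Bd 0 R'. ?F b * ahat b / c0 - ?F b * (ahat b - c0 * ff b) / c0)"
    using c0_pos by (intro sum.cong refl) (simp add: field_simps)
  also have "\<dots> = (\<Sum>b\<in>Bd 0 R'. ?F b * ahat b) / c0 - (\<Sum>b\<in>Bd 0 R'. ?F b * (ahat b - c0 * ff b)) / c0"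
    by (simp add: sum_subtractf sum_divide_distrib)
  also have "(\<Sum>b\<in>Bd 0 R'. ?F b * ahat b) = 2 * (ln r2 - ln r1)"
  proof -
    have "(\<Sum>b\<in>Bd 0 R'. ?F b * ahat b) = 2 * (\<Sum>T\<in>Tr 0 r2. Hc 0 r1 r2 T * curl ahat T)"
      by (rule stokes_Bd[OF alternating_strain]) (use r in \<open>auto simp: R'_def intro!: Hc_outside\<close>)
    also have "(\<Sum>T\<in>Tr 0 r2. Hc 0 r1 r2 T * curl ahat T) = (\<Sum>T\<in>Tr 0 r2. if T = 0 then Hc 0 r1 r2 0 else 0)"
      by (intro sum.cong refl) (simp add: curl_ahat)
    also have "\<dots> = Hc 0 r1 r2 0"
    proof -
      have "0 \<in> Tr 0 r2" using r zero_Tri by (simp add: Tr_def)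
      then show ?thesis by simp
    qed
    also have "\<dots> = ln r2 - ln r1" using r by (intro Hc_inside) auto
    finally show ?thesis .
  qed
  finally have main: "(\<Sum>b\<in>Bd 0 R. (?F b)\<^sup>2) \<le> 2 * (ln r2 - ln r1) / c0
      - (\<Sum>b\<in>Bd 0 R'. ?F b * (ahat b - c0 * ff b)) / c0" .
  have "- (\<Sum>b\<in>Bd 0 R'. ?F b * (ahat b - c0 * ff b)) \<le> K0\<^sup>2 * ee (r1 - 1)"
  proof -
    have "- (\<Sum>b\<in>Bd 0 R'. ?F b * (ahat b - c0 * ff b)) \<le> (\<Sum>b\<in>Bd 0 R'. \<bar>?F b\<bar> * \<bar>ahat b - c0 * ff b\<bar>)"
      unfolding sum_negf[symmetric] by (intro sum_mono) (metis abs_ge_minus_self abs_mult)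
    \<comment> \<open>The truncation is constant up to \<open>r1\<close>, so bonds within
      \<open>r1 - 1\<close> contribute nothing and only a tail of \<open>wt\<close> remains.\<close>
    also have "\<dots> = (\<Sum>b\<in>Bd 0 R' - Bd 0 (r1 - 1). \<bar>?F b\<bar> * \<bar>ahat b - c0 * ff b\<bar>)"
    proof (rule sum.mono_neutral_right)
      show "\<forall>b\<in>Bd 0 R' - (Bd 0 R' - Bd 0 (r1 - 1)). \<bar>?F b\<bar> * \<bar>ahat b - c0 * ff b\<bar> = 0"
      proof
        fix b assume "b \<in> Bd 0 R' - (Bd 0 R' - Bd 0 (r1 - 1))"
        then have "b \<in> Bonds" "cmod (md b - 0) \<le> r1 - 1" by (auto simp: Bd_def)
        then have "?F b = 0" using r by (intro grd_Hc_inside) auto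
        then show "\<bar>?F b\<bar> * \<bar>ahat b - c0 * ff b\<bar> = 0" by simp
      qed
    qed auto
    also have "\<dots> \<le> (\<Sum>b\<in>Bd 0 R' - Bd 0 (r1 - 1). K0\<^sup>2 * wt b)"
    proof (rule sum_mono)
      fix b assume "b \<in> Bd 0 R' - Bd 0 (r1 - 1)"
      then have b: "b \<in> Bonds" by (auto simp: Bd_def)
      have "\<bar>?F b\<bar> * \<bar>ahat b - c0 * ff b\<bar> \<le> \<bar>ff b\<bar> * \<bar>ahat b - c0 * ff b\<bar>"
        using grd_Hc_ff(2)[of r1 r2 b] r by (intro mult_right_mono) auto
      also have "\<dots> \<le> K0\<^sup>2 * wt b" by (rule ff_wt[OF b])
      finally show "\<bar>?F b\<bar> * \<bar>ahat b - c0 * ff b\<bar> \<le> K0\<^sup>2 * wt b" .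
    qed
    also have "\<dots> = K0\<^sup>2 * sum wt (Bd 0 R' - Bd 0 (r1 - 1))" by (simp add: sum_distrib_left)
    also have "\<dots> \<le> K0\<^sup>2 * ee (r1 - 1)"
      using Bd_subset_Bonds by (intro mult_left_mono sum_wt_le_ee) auto
    finally show ?thesis .
  qed
  then have "- (\<Sum>b\<in>Bd 0 R'. ?F b * (ahat b - c0 * ff b)) / c0 \<le> K0\<^sup>2 * ee (r1 - 1) / c0"
    using c0_pos by (intro divide_right_mono) auto
  then show ?thesis using main by simp
qed

lemma Bd_tr: "p \<in> Lam \<Longrightarrow> Bd (q + p) R = tr p ` Bd q R"
proof (intro set_eqI iffI)
  fix b assume p: "p \<in> Lam" and "b \<in> Bd (q + p) R"
  then have "tr (- p) b \<in> Bd q R" using tr_Bonds[OF Lam_minus[OF p]] by (simp add: Bd_def algebra_simps)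
  then show "b \<in> tr p ` Bd q R" by (metis image_eqI tr_inverse(1))
next
  fix b assume p: "p \<in> Lam" and "b \<in> tr p ` Bd q R"
  then show "b \<in> Bd (q + p) R" using tr_Bonds[OF p] by (auto simp: Bd_def)
qed

text \<open>Translation by \<open>p\<close> preserves the bonds only for \<open>p\<close> in
  \<open>Lam\<close>; hence centres of balls are always taken there.\<close>

lemma grd_Hc_energy:
  assumes "p \<in> Lam" "1 \<le> r1" "r1 \<le> r2"
  shows "(\<Sum>b\<in>Bd p R. (grd (Hc p r1 r2) b)\<^sup>2) \<le> 2 / c0 * (ln r2 - ln r1) + K0\<^sup>2 / c0 * ee (r1 - 1)"
proof -
  have "(\<Sum>b\<in>Bd p R. (grd (Hc p r1 r2) b)\<^sup>2) = (\<Sum>b\<in>Bd 0 R. (grd (Hc p r1 r2) (tr p b))\<^sup>2)"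
    using Bd_tr[OF assms(1), of 0 R] by (simp add: sum.reindex[OF inj_tr] o_def)
  also have "\<dots> = (\<Sum>b\<in>Bd 0 R. (grd (Hc 0 r1 r2) b)\<^sup>2)"
    by (simp add: grd_def rv_tr Hc_def)
  finally show ?thesis using grd_Hc_energy_0[OF assms(2,3)] by simp
qed

text \<open>One error for the lower and the upper annulus bound. The coefficients come from shifting
  radii by 1, from the energy of the truncated logarithm, and from replacing \<open>ahat\<close> by
  \<open>c0 * ff\<close>; multiplying by the common sum keeps it monotone and simple.\<close>

definition err :: "real \<Rightarrow> real" where
  "err r = (6 * c0 + c0 * K0\<^sup>2 + K0\<^sup>2 * (1 + c0)) * (ee (r - 2) + 1 / r)"

lemma err_const_pos: "6 * c0 + c0 * K0\<^sup>2 + K0\<^sup>2 * (1 + c0) > 0"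
  using c0_pos by (intro add_pos_nonneg) auto

lemma err_nonneg: "r > 0 \<Longrightarrow> err r \<ge> 0"
  unfolding err_def using err_const_pos ee_nonneg[of "r - 2"]
  by (intro mult_nonneg_nonneg[OF less_imp_le] add_nonneg_nonneg) auto

lemma err_antimono: "0 < r \<Longrightarrow> r \<le> r' \<Longrightarrow> err r' \<le> err r"
  unfolding err_def using err_const_pos
  by (intro mult_left_mono add_mono ee_antimono divide_left_mono) auto

lemma err_tendsto: "(err \<longlongrightarrow> 0) at_top"
proof -
  have "filterlim (\<lambda>r::real. r - 2) at_top at_top" by real_asymp
  then have "((\<lambda>r. ee (r - 2)) \<longlongrightarrow> 0) at_top"
    by (rule filterlim_compose[OF ee_tendsto])
  moreover have "((\<lambda>r::real. 1 / r) \<longlongrightarrow> 0) at_top" by real_asymp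
  ultimately have "((\<lambda>r. (6 * c0 + c0 * K0\<^sup>2 + K0\<^sup>2 * (1 + c0)) * (ee (r - 2) + 1 / r)) \<longlongrightarrow> 
      (6 * c0 + c0 * K0\<^sup>2 + K0\<^sup>2 * (1 + c0)) * (0 + 0)) at_top"
    by (intro tendsto_intros)
  then show ?thesis by (simp add: err_def[abs_def])
qed

lemma err_ge:
  assumes "r > 0"
  shows "c0 * K0\<^sup>2 * ee (r - 2) + K0\<^sup>2 * (1 + c0) * ee (r - 2) + 6 * c0 / r \<le> err r"
proof -
  have "(a + b + c) * (e + i) = b * e + c * e + a * i + (a * e + b * i + c * i)" for a b c e i :: real
    by (simp add: algebra_simps)
  moreover have "0 \<le> 6 * c0 * ee (r - 2) + c0 * K0\<^sup>2 * (1 / r) + K0\<^sup>2 * (1 + c0) * (1 / r)"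
    using c0_pos ee_nonneg[of "r - 2"] assms by (intro add_nonneg_nonneg mult_nonneg_nonneg) auto
  ultimately show ?thesis unfolding err_def by simp
qed

lemma ln_add_1_diff: "0 < r \<Longrightarrow> ln (r + 1) - ln r \<le> 1 / (r::real)"
proof -
  assume r: "0 < r"
  then have "ln (r + 1) - ln r = ln ((r + 1) / r)" by (subst ln_div) auto
  also have "\<dots> \<le> (r + 1) / r - 1" using r by (intro ln_le_minus_one) auto
  also have "\<dots> = 1 / r" using r by (simp add: field_simps)
  finally show ?thesis .
qed

lemma ln_shift_lower:
  assumes "r \<ge> 2" "s \<ge> r + 2"
  shows "ln (s - 1) - ln (r + 1) \<ge> ln s - ln r - 3 / (r::real)"
proof -
  have 1: "ln (r + 1) - ln r \<le> 1 / r" using ln_add_1_diff[of r] assms by simp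
  have "ln s - ln (s - 1) \<le> 1 / (s - 1)" using ln_add_1_diff[of "s - 1"] assms by simp
  also have "\<dots> \<le> 1 / r" using assms by (intro divide_left_mono) auto
  finally have "ln s - ln (s - 1) \<le> 1 / r" .
  moreover have "3 / r = 1 / r + 1 / r + 1 / r" "1 / r \<ge> 0" using assms by simp_all
  ultimately show ?thesis using 1 by linarith
qed

lemma ln_shift_upper:
  assumes "r \<ge> 2" "s \<ge> r"
  shows "ln (s + 1) - ln (r - 1) \<le> ln s - ln r + 3 / (r::real)"
proof -
  have "ln (s + 1) - ln s \<le> 1 / s" using ln_add_1_diff[of s] assms by simp
  also have "\<dots> \<le> 1 / r" using assms by (intro divide_left_mono) auto
  finally have 1: "ln (s + 1) - ln s \<le> 1 / r" .
  have "ln r - ln (r - 1) \<le> 1 / (r - 1)" using ln_add_1_diff[of "r - 1"] assms by simp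
  also have "\<dots> \<le> 2 / r" using assms by (simp add: field_simps)
  finally have "ln r - ln (r - 1) \<le> 2 / r" .
  moreover have "3 / r = 1 / r + 2 / r" by simp
  ultimately show ?thesis using 1 by linarith
qed

text \<open>Duality: the square of \<open>\<alpha>\<close> minus a multiple of the field of a
  truncated logarithm is nonnegative, the pairing is determined by the enclosed charge, and the
  energy of the test field is known. Only a lower bound \<open>k\<close> for the charge enters; 1
  and 2 will be used.\<close>

lemma annulus_lower_bound:
  assumes al: "alternating \<alpha>" and p: "p \<in> Lam" and r: "2 \<le> r" "r \<le> s"
    and free: "\<And>T. T \<in> Tri \<Longrightarrow> r < cmod (T - p) \<Longrightarrow> cmod (T - p) \<le> s \<Longrightarrow> curl \<alpha> T = 0"
    and q: "0 \<le> k" "k \<le> \<bar>\<Sum>T\<in>Tr p r. curl \<alpha> T\<bar>"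
  shows "k\<^sup>2 * (2 * c0 * ln (s / r) - err r) \<le> (\<Sum>b\<in>Bd p s - Bd p r. (\<alpha> b)\<^sup>2)"
proof (cases "s \<ge> r + 2")
  \<comment> \<open>An annulus too thin for a cut-off between \<open>r + 1\<close> and
    \<open>s - 1\<close>: the logarithm is at most \<open>2 / r\<close>, so \<open>err\<close> makes
    the claimed bound nonpositive.\<close>
  case False
  have "ln (s / r) \<le> s / r - 1" using r by (intro ln_le_minus_one) auto
  also have "\<dots> = (s - r) / r" using r by (simp add: field_simps)
  also have "\<dots> \<le> 2 / r" using False r by (intro divide_right_mono) auto
  finally have "2 * c0 * ln (s / r) \<le> 2 * c0 * (2 / r)" using c0_pos by (intro mult_left_mono) auto
  also have "\<dots> \<le> 6 * c0 / r" using c0_pos r by (simp add: field_simps)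
  also have "\<dots> \<le> err r"
  proof -
    have "0 \<le> c0 * K0\<^sup>2 * ee (r - 2) + K0\<^sup>2 * (1 + c0) * ee (r - 2)"
      using c0_pos ee_nonneg[of "r - 2"] by (intro add_nonneg_nonneg mult_nonneg_nonneg) auto
    then show ?thesis using err_ge[of r] r by linarith
  qed
  finally have "k\<^sup>2 * (2 * c0 * ln (s / r) - err r) \<le> 0" by (intro mult_nonneg_nonpos) auto
  also have "0 \<le> (\<Sum>b\<in>Bd p s - Bd p r. (\<alpha> b)\<^sup>2)" by (intro sum_nonneg) auto
  finally show ?thesis .
next
  case True
  define l where "l = ln (s - 1) - ln (r + 1)"
  define Q where "Q = (\<Sum>T\<in>Tr p r. curl \<alpha> T)"
  define F where "F = grd (Hc p (r + 1) (s - 1))"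
  \<comment> \<open>Maximising \<open>4 * \<tau> * l * Q - 2 * \<tau>\<^sup>2 * l / c0\<close> gives
    \<open>c0 * Q\<close>; here the modulus of \<open>Q\<close> is replaced by its lower bound
    \<open>k\<close>.\<close>
  define \<tau> where "\<tau> = k * c0 * sgn Q"
  have l0: "l \<ge> 0" using True r by (simp add: l_def)
  have "(\<Sum>b\<in>Bd p s. F b * \<alpha> b) = 2 * (\<Sum>T\<in>Tr p (s - 1). Hc p (r + 1) (s - 1) T * curl \<alpha> T)"
    unfolding F_def by (rule stokes_Bd[OF al]) (use True r in \<open>auto intro!: Hc_outside\<close>)
  also have "(\<Sum>T\<in>Tr p (s - 1). Hc p (r + 1) (s - 1) T * curl \<alpha> T) = (\<Sum>T\<in>Tr p r. Hc p (r + 1) (s - 1) T * curl \<alpha> T)"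
  proof (rule sum.mono_neutral_right)
    show "Tr p r \<subseteq> Tr p (s - 1)" using True by (auto simp: Tr_def)
    show "\<forall>T\<in>Tr p (s - 1) - Tr p r. Hc p (r + 1) (s - 1) T * curl \<alpha> T = 0"
    proof
      fix T assume "T \<in> Tr p (s - 1) - Tr p r"
      then have "curl \<alpha> T = 0" by (intro free) (auto simp: Tr_def)
      then show "Hc p (r + 1) (s - 1) T * curl \<alpha> T = 0" by simp
    qed
  qed simp
  also have "\<dots> = (\<Sum>T\<in>Tr p r. l * curl \<alpha> T)"
    using True r by (intro sum.cong refl) (simp add: Tr_def Hc_inside l_def)
  also have "\<dots> = l * Q" by (simp add: Q_def sum_distrib_left)
  finally have S: "(\<Sum>b\<in>Bd p s. F b * \<alpha> b) = 2 * (l * Q)" .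
  have F0: "F b = 0" if "b \<in> Bd p r" for b
    unfolding F_def using that True r by (intro grd_Hc_inside) (auto simp: Bd_def)
  have S': "(\<Sum>b\<in>Bd p s - Bd p r. F b * \<alpha> b) = 2 * (l * Q)"
    unfolding S[symmetric] using F0 by (intro sum.mono_neutral_left) auto
  have E: "(\<Sum>b\<in>Bd p s - Bd p r. (F b)\<^sup>2) \<le> 2 / c0 * l + K0\<^sup>2 / c0 * ee (r - 2)"
  proof -
    have "(\<Sum>b\<in>Bd p s - Bd p r. (F b)\<^sup>2) \<le> (\<Sum>b\<in>Bd p s. (F b)\<^sup>2)" by (intro sum_mono2) auto
    also have "\<dots> \<le> 2 / c0 * l + K0\<^sup>2 / c0 * ee (r + 1 - 1)"
      unfolding F_def l_def using True r by (intro grd_Hc_energy p) auto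
    also have "\<dots> \<le> 2 / c0 * l + K0\<^sup>2 / c0 * ee (r - 2)"
      using c0_pos by (intro add_left_mono mult_left_mono ee_antimono) auto
    finally show ?thesis .
  qed
  have "0 \<le> (\<Sum>b\<in>Bd p s - Bd p r. (\<alpha> b - \<tau> * F b)\<^sup>2)" by (intro sum_nonneg) auto
  also have "\<dots> = (\<Sum>b\<in>Bd p s - Bd p r. (\<alpha> b)\<^sup>2) - 2 * \<tau> * (\<Sum>b\<in>Bd p s - Bd p r. F b * \<alpha> b) 
      + \<tau>\<^sup>2 * (\<Sum>b\<in>Bd p s - Bd p r. (F b)\<^sup>2)"
    by (simp add: power2_diff power_mult_distrib sum.distrib sum_subtractf sum_distrib_left mult_ac)
  also have "\<dots> \<le> (\<Sum>b\<in>Bd p s - Bd p r. (\<alpha> b)\<^sup>2) - 2 * \<tau> * (2 * (l * Q)) 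
      + \<tau>\<^sup>2 * (2 / c0 * l + K0\<^sup>2 / c0 * ee (r - 2))"
    unfolding S' by (intro add_left_mono mult_left_mono E) auto
  finally have "2 * \<tau> * (2 * (l * Q)) - \<tau>\<^sup>2 * (2 / c0 * l + K0\<^sup>2 / c0 * ee (r - 2)) \<le> (\<Sum>b\<in>Bd p s - Bd p r. (\<alpha> b)\<^sup>2)"
    by linarith
  moreover have "k\<^sup>2 * (2 * c0 * ln (s / r) - err r) \<le> 2 * \<tau> * (2 * (l * Q)) - \<tau>\<^sup>2 * (2 / c0 * l + K0\<^sup>2 / c0 * ee (r - 2))"
  proof -
    have t1: "2 * \<tau> * (2 * (l * Q)) = 4 * c0 * l * (k * \<bar>Q\<bar>)"
      unfolding \<tau>_def by (simp add: abs_sgn[of Q] mult_ac)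
    have "k * k \<le> k * \<bar>Q\<bar>" using q by (intro mult_left_mono) (auto simp: Q_def)
    moreover have "0 \<le> 4 * c0 * l" using c0_pos l0 by simp
    ultimately have t1': "4 * c0 * l * (k * k) \<le> 2 * \<tau> * (2 * (l * Q))"
      unfolding t1 by (rule mult_left_mono)
    have "(sgn Q)\<^sup>2 \<le> 1" by (simp add: sgn_if)
    then have "\<tau>\<^sup>2 \<le> (k * c0)\<^sup>2 * 1" unfolding \<tau>_def power_mult_distrib[of "k * c0" "sgn Q"]
      by (intro mult_left_mono) auto
    then have "\<tau>\<^sup>2 * (2 / c0 * l + K0\<^sup>2 / c0 * ee (r - 2)) \<le> (k * c0)\<^sup>2 * 1 * (2 / c0 * l + K0\<^sup>2 / c0 * ee (r - 2))"
      using c0_pos l0 ee_nonneg[of "r - 2"] by (intro mult_right_mono add_nonneg_nonneg mult_nonneg_nonneg) auto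
    also have "\<dots> = k\<^sup>2 * (2 * c0 * l + c0 * K0\<^sup>2 * ee (r - 2))"
      using c0_pos by (simp add: power2_eq_square field_simps)
    finally have t2: "\<tau>\<^sup>2 * (2 / c0 * l + K0\<^sup>2 / c0 * ee (r - 2)) \<le> k\<^sup>2 * (2 * c0 * l + c0 * K0\<^sup>2 * ee (r - 2))" .
    have "ln (s / r) \<le> l + 3 / r"
      using ln_shift_lower[OF r(1) True] True r by (simp add: l_def ln_div)
    then have "2 * c0 * ln (s / r) \<le> 2 * c0 * (l + 3 / r)" using c0_pos by (intro mult_left_mono) auto
    then have "2 * c0 * ln (s / r) \<le> 2 * c0 * l + 6 * c0 / r" by (simp add: algebra_simps)
    moreover have "c0 * K0\<^sup>2 * ee (r - 2) + 6 * c0 / r \<le> err r"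
    proof -
      have "0 \<le> K0\<^sup>2 * (1 + c0) * ee (r - 2)"
        using c0_pos ee_nonneg[of "r - 2"] by (intro mult_nonneg_nonneg) auto
      then show ?thesis using err_ge[of r] r by linarith
    qed
    ultimately have "2 * c0 * ln (s / r) - err r \<le> 2 * c0 * l - c0 * K0\<^sup>2 * ee (r - 2)" by linarith
    then have "k\<^sup>2 * (2 * c0 * ln (s / r) - err r) \<le> k\<^sup>2 * (2 * c0 * l - c0 * K0\<^sup>2 * ee (r - 2))"
      by (intro mult_left_mono) auto
    also have "\<dots> = 4 * c0 * l * (k * k) - k\<^sup>2 * (2 * c0 * l + c0 * K0\<^sup>2 * ee (r - 2))"
      by (simp add: power2_eq_square algebra_simps)
    finally show ?thesis using t1' t2 by linarith
  qed
  ultimately show ?thesis by linarith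
qed

text \<open>With truncation radii \<open>\<rho> - 1\<close> and \<open>R + 1\<close> the truncated
  field agrees with \<open>ff\<close> on the annulus, so its energy bound applies.\<close>

lemma ff_energy_upper:
  assumes "2 \<le> \<rho>" "\<rho> \<le> R"
  shows "(\<Sum>b\<in>Bd 0 R - Bd 0 \<rho>. (ff b)\<^sup>2) \<le> 2 / c0 * (ln (R / \<rho>) + 3 / \<rho>) + K0\<^sup>2 / c0 * ee (\<rho> - 2)"
proof -
  have "(\<Sum>b\<in>Bd 0 R - Bd 0 \<rho>. (ff b)\<^sup>2) = (\<Sum>b\<in>Bd 0 R - Bd 0 \<rho>. (grd (Hc 0 (\<rho> - 1) (R + 1)) b)\<^sup>2)"
    using assms by (intro sum.cong refl) (auto simp: Bd_def grd_Hc_between)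
  also have "\<dots> \<le> (\<Sum>b\<in>Bd 0 R. (grd (Hc 0 (\<rho> - 1) (R + 1)) b)\<^sup>2)" by (intro sum_mono2) auto
  also have "\<dots> \<le> 2 / c0 * (ln (R + 1) - ln (\<rho> - 1)) + K0\<^sup>2 / c0 * ee (\<rho> - 1 - 1)"
    using assms by (intro grd_Hc_energy_0) auto
  also have "\<dots> \<le> 2 / c0 * (ln (R / \<rho>) + 3 / \<rho>) + K0\<^sup>2 / c0 * ee (\<rho> - 2)"
    using ln_shift_upper[OF assms] assms c0_pos by (intro add_mono mult_left_mono) (auto simp: ln_div)
  finally show ?thesis .
qed

text \<open>The counterpart of the annulus bound with \<open>k = 1\<close>, with the same leading
  term. It follows from the energy of \<open>c0 * ff\<close>, as the difference of the squares
  decays like \<open>wt\<close>.\<close>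

lemma ahat_energy_upper:
  assumes "2 \<le> \<rho>" "\<rho> \<le> R"
  shows "(\<Sum>b\<in>Bd 0 R - Bd 0 \<rho>. (ahat b)\<^sup>2) \<le> 2 * c0 * ln (R / \<rho>) + err \<rho>"
proof -
  have "(\<Sum>b\<in>Bd 0 R - Bd 0 \<rho>. (ahat b)\<^sup>2) \<le> (\<Sum>b\<in>Bd 0 R - Bd 0 \<rho>. c0\<^sup>2 * (ff b)\<^sup>2 + K0\<^sup>2 * (1 + c0) * wt b)"
  proof (rule sum_mono)
    fix b assume "b \<in> Bd 0 R - Bd 0 \<rho>"
    then have b: "b \<in> Bonds" by (auto simp: Bd_def)
    have "(ahat b)\<^sup>2 = c0\<^sup>2 * (ff b)\<^sup>2 + (ahat b * (ahat b - c0 * ff b) + c0 * (ff b * (ahat b - c0 * ff b)))"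
      by (simp add: power2_eq_square algebra_simps)
    also have "\<dots> \<le> c0\<^sup>2 * (ff b)\<^sup>2 + (\<bar>ahat b\<bar> * \<bar>ahat b - c0 * ff b\<bar> + c0 * (\<bar>ff b\<bar> * \<bar>ahat b - c0 * ff b\<bar>))"
      using c0_pos by (intro add_left_mono add_mono mult_left_mono) (auto simp flip: abs_mult)
    also have "\<dots> \<le> c0\<^sup>2 * (ff b)\<^sup>2 + (K0\<^sup>2 * wt b + c0 * (K0\<^sup>2 * wt b))"
      using c0_pos ff_wt[OF b] by (intro add_left_mono add_mono mult_left_mono) auto
    finally show "(ahat b)\<^sup>2 \<le> c0\<^sup>2 * (ff b)\<^sup>2 + K0\<^sup>2 * (1 + c0) * wt b" by (simp add: algebra_simps)
  qed
  also have "\<dots> = c0\<^sup>2 * (\<Sum>b\<in>Bd 0 R - Bd 0 \<rho>. (ff b)\<^sup>2) + K0\<^sup>2 * (1 + c0) * sum wt (Bd 0 R - Bd 0 \<rho>)"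
    by (simp add: sum.distrib sum_distrib_left)
  also have "\<dots> \<le> c0\<^sup>2 * (2 / c0 * (ln (R / \<rho>) + 3 / \<rho>) + K0\<^sup>2 / c0 * ee (\<rho> - 2)) + K0\<^sup>2 * (1 + c0) * ee (\<rho> - 2)"
  proof (intro add_mono mult_left_mono ff_energy_upper assms)
    have "sum wt (Bd 0 R - Bd 0 \<rho>) \<le> ee \<rho>" using Bd_subset_Bonds by (intro sum_wt_le_ee) auto
    also have "\<dots> \<le> ee (\<rho> - 2)" by (rule ee_antimono) simp
    finally show "sum wt (Bd 0 R - Bd 0 \<rho>) \<le> ee (\<rho> - 2)" .
  qed (use c0_pos in auto)
  also have "c0\<^sup>2 * (2 / c0 * (ln (R / \<rho>) + 3 / \<rho>) + K0\<^sup>2 / c0 * ee (\<rho> - 2))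
      = 2 * c0 * ln (R / \<rho>) + 6 * c0 / \<rho> + c0 * K0\<^sup>2 * ee (\<rho> - 2)"
    using c0_pos by (simp add: power2_eq_square field_simps)
  finally show ?thesis using err_ge[of \<rho>] assms by linarith
qed

section \<open>Growing and merging balls\<close>

text \<open>Centres are kept in the translation lattice: rounding a merged centre enlarges the merged ball
  by 1, which costs a relative error of order \<open>1 / r0\<close> in the total radius.\<close>

lemma ball_growth:
  fixes J :: "'i set"
  assumes al: "alternating \<alpha>" and X: "finite X" "X \<subseteq> Tri"
    and cz: "\<And>T. T \<in> Tri \<Longrightarrow> T \<notin> X \<Longrightarrow> curl \<alpha> T = 0"
    and int: "\<And>T. curl \<alpha> T \<in> \<int>" and tot: "(\<Sum>T\<in>X. curl \<alpha> T) \<noteq> 0"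
    and r0: "2 \<le> r0"
    and J: "finite J" and P: "\<And>j. j \<in> J \<Longrightarrow> P j \<in> Lam" and r: "\<And>j. j \<in> J \<Longrightarrow> r0 \<le> r j"
    and g: "\<And>T. T \<in> X \<Longrightarrow> g T \<in> J" "\<And>T. T \<in> X \<Longrightarrow> cmod (T - P (g T)) \<le> r (g T)"
  shows "\<exists>q\<in>Lam. \<exists>R1>0. \<forall>R\<ge>R1. (\<Union>j\<in>J. Bd (P j) (r j)) \<subseteq> Bd q R \<and>
    2 * c0 * ln (R / (\<Sum>j\<in>J. r j)) - card J * (err r0 + 2 * c0 / r0)
       \<le> (\<Sum>b\<in>Bd q R - (\<Union>j\<in>J. Bd (P j) (r j)). (\<alpha> b)\<^sup>2)"
  using J P r g
proof (induction "card J" arbitrary: J P r g rule: less_induct)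
  case less
  note fJ = \<open>finite J\<close> and P = less.prems(2) and r = less.prems(3) and g = less.prems(4,5)
  have e0: "err r0 \<ge> 0" "2 * c0 / r0 \<ge> 0" using err_nonneg r0 c0_pos by auto
  have int_ge_1: "1 \<le> \<bar>\<Sum>T\<in>Y. curl \<alpha> T\<bar>" if "(\<Sum>T\<in>Y. curl \<alpha> T) \<noteq> 0" for Y
  proof -
    have "(\<Sum>T\<in>Y. curl \<alpha> T) \<in> \<int>" by (intro Ints_sum int)
    then show ?thesis using that Ints_abs_less_1 by force
  qed
  have rpos: "r j > 0" if "j \<in> J" for j using r[OF that] r0 by linarith
  have "(\<Sum>T\<in>X. curl \<alpha> T) = (\<Sum>j\<in>J. \<Sum>T\<in>{T \<in> X. g T = j}. curl \<alpha> T)"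
    by (rule sum.group[symmetric]) (use X fJ g(1) in auto)
  then have "(\<Sum>j\<in>J. \<Sum>T\<in>{T \<in> X. g T = j}. curl \<alpha> T) \<noteq> 0" using tot by simp
  \<comment> \<open>Some ball must carry nonzero net charge, hence at least 1 in modulus. At each
    stage energy is credited only to the annulus around this ball, which already accounts for one
    unit of charge.\<close>
  then obtain j0 where j0: "j0 \<in> J" "(\<Sum>T\<in>{T \<in> X. g T = j0}. curl \<alpha> T) \<noteq> 0"
    by (rule sum.not_neutral_contains_not_neutral)
  define S where "S = (\<Sum>j\<in>J. r j)"
  have S: "r0 \<le> S"
    using member_le_sum[of j0 J r] rpos r[OF j0(1)] fJ j0(1) unfolding S_def by (force intro: less_imp_le)
  have annulus: "2 * c0 * ln lam - err r0 \<le> (\<Sum>b\<in>Bd (P j0) (lam * r j0) - Bd (P j0) (r j0). (\<alpha> b)\<^sup>2)"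
    if lam: "1 \<le> lam" and sep: "\<And>T. T \<in> X \<Longrightarrow> g T \<noteq> j0 \<Longrightarrow> lam * r j0 < cmod (T - P j0)" for lam
  proof -
    have j: "2 \<le> r j0" "r j0 \<le> lam * r j0" using r[OF j0(1)] r0 mult_right_mono[OF lam, of "r j0"] by auto
    have tr: "(\<Sum>T\<in>Tr (P j0) (r j0). curl \<alpha> T) = (\<Sum>T\<in>{T \<in> X. g T = j0}. curl \<alpha> T)"
    proof (rule sum.mono_neutral_right)
      show "{T \<in> X. g T = j0} \<subseteq> Tr (P j0) (r j0)" using g(2) X by (auto simp: Tr_def)
      show "\<forall>T\<in>Tr (P j0) (r j0) - {T \<in> X. g T = j0}. curl \<alpha> T = 0"
      proof
        fix T assume T: "T \<in> Tr (P j0) (r j0) - {T \<in> X. g T = j0}"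
        then have "T \<in> Tri" "cmod (T - P j0) \<le> r j0" by (auto simp: Tr_def)
        moreover from this(2) have "\<not> lam * r j0 < cmod (T - P j0)" using j(2) by linarith
        ultimately show "curl \<alpha> T = 0" using cz[of T] sep[of T] T by auto
      qed
    qed simp
    have "1\<^sup>2 * (2 * c0 * ln ((lam * r j0) / r j0) - err (r j0)) \<le> (\<Sum>b\<in>Bd (P j0) (lam * r j0) - Bd (P j0) (r j0). (\<alpha> b)\<^sup>2)"
    proof (rule annulus_lower_bound[OF al P[OF j0(1)] j])
      fix T assume "T \<in> Tri" "r j0 < cmod (T - P j0)" "cmod (T - P j0) \<le> lam * r j0"
      then show "curl \<alpha> T = 0" using cz[of T] sep[of T] g(2)[of T] by fastforce
    next
      show "1 \<le> \<bar>\<Sum>T\<in>Tr (P j0) (r j0). curl \<alpha> T\<bar>" unfolding tr by (rule int_ge_1[OF j0(2)])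
    qed simp
    moreover have "err (r j0) \<le> err r0" using r[OF j0(1)] r0 by (intro err_antimono) auto
    ultimately show ?thesis using rpos[OF j0(1)] by simp
  qed
  show ?case
  proof (cases "card J = 1")
    case True
    then have J1: "J = {j0}" using j0(1) by (auto simp: card_Suc_eq)
    show ?thesis
    proof (intro bexI[of _ "P j0"] exI[of _ "r j0"] conjI allI impI)
      show "P j0 \<in> Lam" "0 < r j0" using P j0(1) rpos by auto
      fix R assume R: "r j0 \<le> R"
      show "(\<Union>j\<in>J. Bd (P j) (r j)) \<subseteq> Bd (P j0) R" using R Bd_mono unfolding J1 by simp
      have "2 * c0 * ln (R / r j0) - err r0 \<le> (\<Sum>b\<in>Bd (P j0) (R / r j0 * r j0) - Bd (P j0) (r j0). (\<alpha> b)\<^sup>2)"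
        using R rpos[OF j0(1)] g(1) unfolding J1 by (intro annulus) auto
      then show "2 * c0 * ln (R / (\<Sum>j\<in>J. r j)) - card J * (err r0 + 2 * c0 / r0)
          \<le> (\<Sum>b\<in>Bd (P j0) R - (\<Union>j\<in>J. Bd (P j) (r j)). (\<alpha> b)\<^sup>2)"
        using rpos[OF j0(1)] e0 unfolding J1 by simp
    qed
  next
    case False
    have c2: "card J \<ge> 2" using False j0(1) fJ by (cases "card J") (auto simp: card_eq_0_iff)
    define D where "D = {ik \<in> J \<times> J. fst ik \<noteq> snd ik}"
    \<comment> \<open>The common dilation factor at which two balls touch; the minimising pair
      touches first.\<close>
    define rat where "rat ik = cmod (P (fst ik) - P (snd ik)) / (r (fst ik) + r (snd ik))" for ik
    have fD: "finite D" unfolding D_def using fJ by auto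
    have "D \<noteq> {}"
    proof -
      have "J - {j0} \<noteq> {}" using c2 j0(1) fJ by (metis card_Diff_singleton card.empty diff_is_0_eq not_numeral_le_zero numeral_2_eq_2 not_less_eq_eq One_nat_def)
      then obtain k where "k \<in> J" "k \<noteq> j0" by auto
      then have "(j0, k) \<in> D" using j0(1) by (auto simp: D_def)
      then show ?thesis by auto
    qed
    then have "Min (rat ` D) \<in> rat ` D" using fD by (intro Min_in) auto
    then obtain i k where ik: "(i, k) \<in> D" "rat (i, k) = Min (rat ` D)" by force
    have iJ: "i \<in> J" "k \<in> J" "i \<noteq> k" using ik(1) by (auto simp: D_def)
    have mn: "rat (i, k) \<le> rat (a, b)" if "a \<in> J" "b \<in> J" "a \<noteq> b" for a b
      unfolding ik(2) using that fD by (intro Min_le) (auto simp: D_def)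
    \<comment> \<open>The maximum with 1 treats balls that already overlap: they are merged without
      growth.\<close>
    define lam where "lam = max 1 (rat (i, k))"
    have lam1: "lam \<ge> 1" by (simp add: lam_def)
    have rik: "r i + r k > 0" using rpos iJ by (simp add: add_pos_pos)
    have dik: "cmod (P i - P k) \<le> lam * (r i + r k)"
    proof -
      have "cmod (P i - P k) = rat (i, k) * (r i + r k)" using rik by (simp add: rat_def)
      also have "\<dots> \<le> lam * (r i + r k)" using rik by (intro mult_right_mono) (auto simp: lam_def)
      finally show ?thesis .
    qed
    have sep: "cmod (P a - P b) \<ge> lam * (r a + r b)" if "a \<in> J" "b \<in> J" "a \<noteq> b" "lam > 1" for a b
    proof -
      have "lam = rat (i, k)" using that(4) by (auto simp: lam_def max_def split: if_splits)
      then have "lam \<le> rat (a, b)" using mn that by simp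
      moreover have "r a + r b > 0" using rpos that by (simp add: add_pos_pos)
      ultimately show ?thesis by (simp add: rat_def pos_le_divide_eq)
    qed
    \<comment> \<open>The weighted centre: the ball of radius \<open>lam * (r i + r k)\<close>
      around \<open>W\<close> contains both dilated balls, so merging adds their radii. Rounding
      \<open>W\<close> into \<open>Lam\<close> costs 1.\<close>
    define W where "W = P i + of_real (r k / (r i + r k)) * (P k - P i)"
    obtain p where p: "p \<in> Lam" "cmod (W - p) \<le> 1" using Lam_near by blast
    have Wi: "cmod (P i - p) \<le> lam * r k + 1"
    proof -
      have "cmod (P i - W) = r k / (r i + r k) * cmod (P i - P k)"
      proof -
        have "a - (a + t * (b - a)) = t * (a - b)" for a b t :: complex by (simp add: algebra_simps)
        then have "P i - W = of_real (r k / (r i + r k)) * (P i - P k)" unfolding W_def .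
        then have "cmod (P i - W) = \<bar>r k / (r i + r k)\<bar> * cmod (P i - P k)"
          by (simp only: norm_mult norm_of_real)
        then show ?thesis using rik rpos[OF iJ(2)] by simp
      qed
      also have "\<dots> \<le> r k / (r i + r k) * (lam * (r i + r k))"
        using rik rpos[OF iJ(2)] by (intro mult_left_mono dik) auto
      also have "\<dots> = lam * r k" using rik by simp
      finally show ?thesis using norm_triangle_ineq[of "P i - W" "W - p"] p(2) by simp
    qed
    have Wk: "cmod (P k - p) \<le> lam * r i + 1"
    proof -
      have "P k - W = of_real (r i / (r i + r k)) * (P k - P i)"
      proof -
        have "r i / (r i + r k) = 1 - r k / (r i + r k)" using rik by (simp add: field_simps)
        then have t: "of_real (r i / (r i + r k)) = 1 - complex_of_real (r k / (r i + r k))"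
          by (simp only: of_real_diff of_real_1)
        have "b - (a + t * (b - a)) = (1 - t) * (b - a)" for a b t :: complex by (simp add: algebra_simps)
        then show ?thesis unfolding W_def t .
      qed
      then have "cmod (P k - W) = \<bar>r i / (r i + r k)\<bar> * cmod (P k - P i)"
        by (simp only: norm_mult norm_of_real)
      then have "cmod (P k - W) = r i / (r i + r k) * cmod (P i - P k)"
        using rik rpos[OF iJ(1)] by (simp add: norm_minus_commute)
      also have "\<dots> \<le> r i / (r i + r k) * (lam * (r i + r k))"
        using rik rpos[OF iJ(1)] by (intro mult_left_mono dik) auto
      also have "\<dots> = lam * r i" using rik by simp
      finally show ?thesis using norm_triangle_ineq[of "P k - W" "W - p"] p(2) by simp
    qed
    define J' where "J' = J - {k}"
    define P' where "P' = P(i := p)"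
    define r' where "r' j = (if j = i then lam * (r i + r k) + 1 else lam * r j)" for j
    define h where "h j = (if j = k then i else j)" for j
    have hJ: "h j \<in> J'" if "j \<in> J" for j using that iJ by (auto simp: h_def J'_def)
    have move: "cmod (P j - P' (h j)) + lam * r j \<le> r' (h j)" if "j \<in> J" for j
      using Wi Wk iJ that by (auto simp: h_def P'_def r'_def algebra_simps)
    have rl: "r j \<le> lam * r j" if "j \<in> J" for j using mult_right_mono[OF lam1, of "r j"] rpos[OF that] by simp
    have cJ': "card J' < card J" unfolding J'_def using fJ iJ(2) by (rule card_Diff1_less)
    have sub: "Bd (P j) (lam * r j) \<subseteq> Bd (P' (h j)) (r' (h j))" if "j \<in> J" for j
      using move[OF that] by (rule Bd_translate)
    \<comment> \<open>Growth multiplies the total radius by \<open>lam\<close>, matching the gain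
      \<open>ln lam\<close> on the annulus; the summand 1 is the rounding.\<close>
    have sumr': "(\<Sum>j\<in>J'. r' j) = lam * S + 1"
    proof -
      have "J' = insert i (J - {i, k})" using iJ by (auto simp: J'_def)
      then have "(\<Sum>j\<in>J'. r' j) = r' i + (\<Sum>j\<in>J - {i, k}. r' j)" using fJ by simp
      also have "(\<Sum>j\<in>J - {i, k}. r' j) = (\<Sum>j\<in>J - {i, k}. lam * r j)" by (intro sum.cong) (auto simp: r'_def)
      also have "\<dots> = lam * (S - r i - r k)"
      proof -
        have "J = insert i (insert k (J - {i, k}))" using iJ by auto
        then have "S = r i + (r k + (\<Sum>j\<in>J - {i, k}. r j))"
          unfolding S_def using fJ iJ(3) by (metis (no_types, lifting) Diff_iff finite_Diff finite_insert insertE insertI1 insertI2 sum.insert)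
        then show ?thesis by (simp add: sum_distrib_left)
      qed
      finally show ?thesis by (simp add: r'_def algebra_simps)
    qed
    have "\<exists>q\<in>Lam. \<exists>R1>0. \<forall>R\<ge>R1. (\<Union>j\<in>J'. Bd (P' j) (r' j)) \<subseteq> Bd q R \<and>
      2 * c0 * ln (R / (\<Sum>j\<in>J'. r' j)) - card J' * (err r0 + 2 * c0 / r0)
         \<le> (\<Sum>b\<in>Bd q R - (\<Union>j\<in>J'. Bd (P' j) (r' j)). (\<alpha> b)\<^sup>2)"
    proof (rule less.hyps[where g = "\<lambda>T. h (g T)"])
      show "card J' < card J" by fact
      show "finite J'" using fJ by (simp add: J'_def)
      show "P' j \<in> Lam" if "j \<in> J'" for j using that P p(1) by (auto simp: P'_def J'_def)
      show "r0 \<le> r' j" if "j \<in> J'" for j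
      proof -
        have a: "r0 \<le> lam * r l" if "l \<in> J" for l using r[OF that] rl[OF that] by linarith
        have "0 \<le> lam * r k" using lam1 rpos[OF iJ(2)] by simp
        then have "r0 \<le> lam * (r i + r k) + 1" unfolding distrib_left using a[OF iJ(1)] by linarith
        then show ?thesis using a that by (auto simp: r'_def J'_def)
      qed
      fix T assume T: "T \<in> X"
      show "h (g T) \<in> J'" using hJ g(1)[OF T] .
      have "cmod (T - P' (h (g T))) \<le> cmod (T - P (g T)) + cmod (P (g T) - P' (h (g T)))"
        using norm_triangle_ineq[of "T - P (g T)" "P (g T) - P' (h (g T))"] by simp
      also have "\<dots> \<le> lam * r (g T) + cmod (P (g T) - P' (h (g T)))"
        using g(2)[OF T] rl[OF g(1)[OF T]] by simp
      also have "\<dots> \<le> r' (h (g T))" using move[OF g(1)[OF T]] by simp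
      finally show "cmod (T - P' (h (g T))) \<le> r' (h (g T))" .
    qed
    then obtain q R1 where q: "q \<in> Lam" "R1 > 0" and IH: "\<And>R. R \<ge> R1 \<Longrightarrow> (\<Union>j\<in>J'. Bd (P' j) (r' j)) \<subseteq> Bd q R"
      "\<And>R. R \<ge> R1 \<Longrightarrow> 2 * c0 * ln (R / (\<Sum>j\<in>J'. r' j)) - card J' * (err r0 + 2 * c0 / r0)
         \<le> (\<Sum>b\<in>Bd q R - (\<Union>j\<in>J'. Bd (P' j) (r' j)). (\<alpha> b)\<^sup>2)"
      by blast
    define Old where "Old = (\<Union>j\<in>J. Bd (P j) (r j))"
    define New where "New = (\<Union>j\<in>J'. Bd (P' j) (r' j))"
    define An where "An = Bd (P j0) (lam * r j0) - Bd (P j0) (r j0)"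
    have ON: "Old \<subseteq> New"
      unfolding Old_def New_def using sub Bd_mono[OF rl] hJ by blast
    have AnN: "An \<subseteq> New" unfolding An_def New_def using sub[OF j0(1)] hJ[OF j0(1)] by blast
    \<comment> \<open>If \<open>lam > 1\<close>, the dilated balls are still separated up to
      contact, so the annulus avoids all old balls and its energy is not counted twice.\<close>
    have AnO: "An \<inter> Old = {}"
    proof (rule ccontr)
      assume "An \<inter> Old \<noteq> {}"
      then obtain b j where b: "b \<in> An" "j \<in> J" "b \<in> Bd (P j) (r j)" by (auto simp: Old_def)
      then have ne: "j \<noteq> j0" by (auto simp: An_def)
      have 1: "cmod (md b - P j0) \<le> lam * r j0" "r j0 < cmod (md b - P j0)" "cmod (md b - P j) \<le> r j"
        using b by (auto simp: An_def Bd_def)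
      then have "r j0 < lam * r j0" by linarith
      then have l: "lam > 1" using lam1 by (cases "lam = 1") auto
      have "cmod (P j0 - P j) \<le> lam * r j0 + r j"
        using 1 norm_triangle_ineq[of "P j0 - md b" "md b - P j"] by (simp add: norm_minus_commute)
      moreover have "r j < lam * r j" using l rpos[OF b(2)] by simp
      ultimately show False using sep[OF j0(1) b(2) ne[symmetric] l] by (simp add: algebra_simps)
    qed
    have An_energy: "2 * c0 * ln lam - err r0 \<le> (\<Sum>b\<in>An. (\<alpha> b)\<^sup>2)"
    proof (cases "lam = 1")
      case True
      then show ?thesis using e0 by (simp add: An_def)
    next
      case False
      then have l: "lam > 1" using lam1 by simp
      show ?thesis unfolding An_def
      proof (rule annulus[OF lam1])
        fix T assume T: "T \<in> X" "g T \<noteq> j0"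
        have "lam * (r (g T) + r j0) \<le> cmod (P (g T) - P j0)"
          using sep[OF g(1)[OF T(1)] j0(1) T(2) l] .
        also have "\<dots> \<le> cmod (T - P (g T)) + cmod (T - P j0)"
          using norm_triangle_ineq[of "P (g T) - T" "T - P j0"] by (simp add: norm_minus_commute)
        finally have "lam * r (g T) + lam * r j0 \<le> r (g T) + cmod (T - P j0)"
          using g(2)[OF T(1)] by (simp add: algebra_simps)
        moreover have "r (g T) < lam * r (g T)" using l rpos[OF g(1)[OF T(1)]] by simp
        ultimately show "lam * r j0 < cmod (T - P j0)" by linarith
      qed
    qed
    show ?thesis
    proof (intro bexI[of _ q] exI[of _ R1] conjI allI impI)
      show "q \<in> Lam" "0 < R1" by fact+
      fix R assume R: "R1 \<le> R"
      have NR: "New \<subseteq> Bd q R" using IH(1)[OF R] by (simp add: New_def)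
      then show "(\<Union>j\<in>J. Bd (P j) (r j)) \<subseteq> Bd q R" using ON unfolding Old_def by blast
      have Rpos: "R > 0" using R q by linarith
      have lS: "lam * S > 0" "S > 0" "S \<le> lam * S" using lam1 S r0 mult_right_mono[OF lam1, of S] by auto
      \<comment> \<open>The total radius is at least \<open>r0\<close>, so one rounding changes its
        logarithm by at most \<open>1 / r0\<close>; this is the source of \<open>2 * c0 / r0\<close>
        per merge.\<close>
      have "ln (lam * S + 1) \<le> ln (lam * S) + 1 / (lam * S)"
        using ln_add_1_diff[OF lS(1)] by simp
      also have "1 / (lam * S) \<le> 1 / r0"
        using order_trans[OF S lS(3)] lS(2) lam1 r0 by (intro divide_left_mono mult_pos_pos) auto
      finally have "ln (lam * S + 1) \<le> ln lam + ln S + 1 / r0" using lam1 lS by (simp add: ln_mult)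
      then have "ln (R / S) - 1 / r0 \<le> ln lam + ln (R / (lam * S + 1))"
      proof -
        have "ln (R / M) = ln R - ln M" if "M > 0" for M using that Rpos by (simp add: ln_div)
        from this[of S] this[of "lam * S + 1"] show ?thesis
          using \<open>ln (lam * S + 1) \<le> ln lam + ln S + 1 / r0\<close> lS(1,2) by linarith
      qed
      then have "2 * c0 * (ln (R / S) - 1 / r0) \<le> 2 * c0 * (ln lam + ln (R / (lam * S + 1)))"
        using c0_pos by (intro mult_left_mono) auto
      then have A: "2 * c0 * ln (R / S) - 2 * c0 / r0 \<le> 2 * c0 * ln lam + 2 * c0 * ln (R / (lam * S + 1))"
        by (simp add: algebra_simps)
      have B: "card J = card J' + 1" using card_Suc_Diff1[OF fJ iJ(2)] by (simp add: J'_def)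
      have "(\<Sum>b\<in>An. (\<alpha> b)\<^sup>2) + (\<Sum>b\<in>Bd q R - New. (\<alpha> b)\<^sup>2) = (\<Sum>b\<in>An \<union> (Bd q R - New). (\<alpha> b)\<^sup>2)"
        by (rule sum.union_disjoint[symmetric]) (use AnN in \<open>auto simp: An_def\<close>)
      also have "\<dots> \<le> (\<Sum>b\<in>Bd q R - Old. (\<alpha> b)\<^sup>2)"
        by (rule sum_mono2) (use AnO AnN ON NR in auto)
      finally have low: "2 * c0 * ln lam - err r0 + (2 * c0 * ln (R / (lam * S + 1)) - card J' * (err r0 + 2 * c0 / r0))
          \<le> (\<Sum>b\<in>Bd q R - Old. (\<alpha> b)\<^sup>2)"
        using An_energy IH(2)[OF R] unfolding sumr' New_def by linarith
      show "2 * c0 * ln (R / (\<Sum>j\<in>J. r j)) - card J * (err r0 + 2 * c0 / r0)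
          \<le> (\<Sum>b\<in>Bd q R - (\<Union>j\<in>J. Bd (P j) (r j)). (\<alpha> b)\<^sup>2)"
      proof -
        obtain x where x_def: "x = err r0 + 2 * c0 / r0" by blast
        moreover have "card J * x = card J' * x + x" unfolding B by (simp add: algebra_simps)
        moreover have "err r0 = x - 2 * c0 / r0" by (simp add: x_def)
        ultimately show ?thesis
          using A low
          unfolding S_def[symmetric] Old_def[symmetric] by (simp only: x_def[symmetric])
      qed
    qed
  qed
qed

section \<open>The potential\<close>

locale potential =
  fixes psi :: "real \<Rightarrow> real"
  assumes adm: "admissible_psi psi"
begin

definition mu :: real where "mu = (deriv ^^ 2) psi 0"

lemma mu_pos: "mu > 0"
  using adm by (simp add: admissible_psi_def mu_def)

lemma psi_cont: "continuous_on UNIV psi"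
  using adm by (simp add: admissible_psi_def)

lemma psi_isCont: "isCont psi x"
  using psi_cont by (simp add: continuous_on_eq_continuous_at)

lemma psi_int: "psi (x + of_int k) = psi x"
proof -
  have 1: "psi (x + 1) = psi x" for x using adm by (simp add: admissible_psi_def)
  show ?thesis
  proof (induction k rule: int_induct[where k = 0])
    case (step1 i) then show ?case using 1[of "x + of_int i"] by (simp add: add.assoc)
  next
    case (step2 i) then show ?case using 1[of "x + of_int (i - 1)"] by (simp add: add.assoc)
  qed simp
qed

lemma psi_cong_Ints: "x - y \<in> \<int> \<Longrightarrow> psi x = psi y"
proof -
  assume "x - y \<in> \<int>"
  then obtain k :: int where "x - y = of_int k" by (rule Ints_cases)
  then have "x = y + of_int k" by simp
  then show ?thesis using psi_int by simp
qed

lemma psi_rd: "psi (rd t) = psi t"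
  using psi_cong_Ints[OF rd_diff_Ints[of t]] by simp

lemma psi_lower: "\<bar>x\<bar> \<le> 1/2 \<Longrightarrow> psi x \<ge> mu / 2 * x\<^sup>2"
proof -
  assume "\<bar>x\<bar> \<le> 1/2"
  then have "- 1/2 \<le> x" "x \<le> 1/2" by linarith+
  moreover have "\<forall>x. - 1/2 \<le> x \<and> x \<le> 1/2 \<longrightarrow> psi x \<ge> (1/2) * (deriv ^^ 2) psi 0 * x\<^sup>2"
    using adm unfolding admissible_psi_def by blast
  ultimately show ?thesis unfolding mu_def by simp
qed

lemma psi_nonneg: "psi x \<ge> 0"
proof -
  have "0 \<le> mu / 2 * (rd x)\<^sup>2" using mu_pos by simp
  also have "\<dots> \<le> psi (rd x)" by (rule psi_lower[OF abs_rd_le])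
  finally show ?thesis by (simp add: psi_rd)
qed

lemma psi_0: "psi 0 = 0"
  using adm by (simp add: admissible_psi_def)

lemma not_halfint: "\<bar>x\<bar> \<le> 1/4 \<Longrightarrow> x \<notin> halfints"
proof
  assume x: "\<bar>x\<bar> \<le> 1/4" "x \<in> halfints"
  then obtain k :: int where "x = of_int k + 1/2" by (auto simp: halfints_def)
  then have "real_of_int k \<le> - 1/4" "real_of_int k \<ge> - 3/4" using x by linarith+
  then have "k < 0" "k > - 1" by linarith+
  then show False by simp
qed

lemma deriv_n:
  assumes "k < 4" "\<bar>x\<bar> \<le> 1/4"
  shows "((deriv ^^ k) psi has_real_derivative (deriv ^^ Suc k) psi x) (at x)"
  using adm assms not_halfint unfolding admissible_psi_def by blast

text \<open>Twice integrating a bound on the third derivative over [-1/4, 1/4], a range that avoids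
  the half-integers. The first derivative vanishes at 0 because 0 is a minimum of
  \<open>psi\<close>.\<close>

lemma ex_deriv_bound:
  "\<exists>K>0. \<forall>x. \<bar>x\<bar> \<le> 1/4 \<longrightarrow> \<bar>deriv psi x - mu * x\<bar> \<le> K * x\<^sup>2"
proof -
  let ?I = "{- 1/4..1/4::real}"
  have D: "((deriv ^^ k) psi has_real_derivative (deriv ^^ Suc k) psi x) (at x within S)"
    if "k < 4" "\<bar>x\<bar> \<le> 1/4" for k x S
    using deriv_n[OF that] by (rule DERIV_subset) simp
  have "continuous_on ?I ((deriv ^^ 3) psi)"
    using D[of 3] by (intro DERIV_continuous_on[where D = "(deriv ^^ Suc 3) psi"]) auto
  then have "bounded ((deriv ^^ 3) psi ` ?I)"
    by (intro compact_imp_bounded compact_continuous_image) auto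
  then obtain K where K: "K > 0" "\<And>x. x \<in> ?I \<Longrightarrow> norm ((deriv ^^ 3) psi x) \<le> K"
    unfolding bounded_pos by auto
  have d2: "\<bar>(deriv ^^ 2) psi x - mu\<bar> \<le> K * \<bar>x\<bar>" if "\<bar>x\<bar> \<le> 1/4" for x
  proof -
    have "norm ((deriv ^^ 2) psi x - (deriv ^^ 2) psi 0) \<le> K * norm (x - 0)"
    proof (rule field_differentiable_bound[where S = ?I])
      show "((deriv ^^ 2) psi has_field_derivative (deriv ^^ 3) psi z) (at z within ?I)" if "z \<in> ?I" for z
        using D[of 2 z ?I] that by (auto simp: eval_nat_numeral)
    qed (use that K(2) in auto)
    then show ?thesis by (simp add: mu_def)
  qed
  have d0: "deriv psi 0 = 0"
  proof (rule DERIV_local_min)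
    show "DERIV psi 0 :> deriv psi 0" using deriv_n[of 0 0] by simp
    show "(0::real) < 1" by simp
    show "\<forall>y. \<bar>0 - y\<bar> < 1 \<longrightarrow> psi 0 \<le> psi y" using psi_nonneg psi_0 by simp
  qed
  have "\<bar>deriv psi x - mu * x\<bar> \<le> K * x\<^sup>2" if x: "\<bar>x\<bar> \<le> 1/4" for x
  proof -
    let ?J = "{- \<bar>x\<bar>..\<bar>x\<bar>}"
    have "norm ((deriv psi x - mu * x) - (deriv psi 0 - mu * 0)) \<le> (K * \<bar>x\<bar>) * norm (x - 0)"
    proof (rule field_differentiable_bound[where S = ?J])
      fix z assume z: "z \<in> ?J"
      then have z4: "\<bar>z\<bar> \<le> 1/4" "\<bar>z\<bar> \<le> \<bar>x\<bar>" using x by auto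
      have "((deriv ^^ 1) psi has_real_derivative (deriv ^^ Suc 1) psi z) (at z within ?J)"
        using D[of 1 z ?J] z4 by simp
      then have d: "(deriv psi has_real_derivative (deriv ^^ 2) psi z) (at z within ?J)"
        by (simp add: eval_nat_numeral)
      show "((\<lambda>z. deriv psi z - mu * z) has_field_derivative (deriv ^^ 2) psi z - mu) (at z within ?J)"
        using d by (auto intro!: derivative_eq_intros)
      have "\<bar>(deriv ^^ 2) psi z - mu\<bar> \<le> K * \<bar>z\<bar>" using d2[OF z4(1)] .
      also have "\<dots> \<le> K * \<bar>x\<bar>" using z4 K by (intro mult_left_mono) auto
      finally show "norm ((deriv ^^ 2) psi z - mu) \<le> K * \<bar>x\<bar>" by simp
    qed auto
    then show ?thesis using d0 by (simp add: power2_eq_square abs_mult_self_eq mult.assoc)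
  qed
  then show ?thesis using K(1) by blast
qed

definition Kp :: real where
  "Kp = (SOME K. K > 0 \<and> (\<forall>x. \<bar>x\<bar> \<le> 1/4 \<longrightarrow> \<bar>deriv psi x - mu * x\<bar> \<le> K * x\<^sup>2))"

lemma Kp_spec: "Kp > 0 \<and> (\<forall>x. \<bar>x\<bar> \<le> 1/4 \<longrightarrow> \<bar>deriv psi x - mu * x\<bar> \<le> Kp * x\<^sup>2)"
  unfolding Kp_def by (rule someI_ex) (use ex_deriv_bound in blast)

lemma Kp_pos: "Kp > 0" using Kp_spec by blast

lemma deriv_bound: "\<bar>x\<bar> \<le> 1/4 \<Longrightarrow> \<bar>deriv psi x - mu * x\<bar> \<le> Kp * x\<^sup>2"
  using Kp_spec by blast

lemma psi_increment:
  assumes "\<bar>s\<bar> \<le> 1/4" "\<bar>t\<bar> \<le> 1/4"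
    and B: "\<And>z. min s t \<le> z \<Longrightarrow> z \<le> max s t \<Longrightarrow> \<bar>deriv psi z - k\<bar> \<le> B"
  shows "\<bar>psi t - psi s - k * (t - s)\<bar> \<le> B * \<bar>t - s\<bar>"
proof -
  let ?J = "{min s t..max s t}"
  have "norm ((psi t - k * t) - (psi s - k * s)) \<le> B * norm (t - s)"
  proof (rule field_differentiable_bound[where S = ?J])
    fix z assume z: "z \<in> ?J"
    then have "\<bar>z\<bar> \<le> 1/4" using assms(1,2) by auto
    then have "((deriv ^^ 0) psi has_real_derivative (deriv ^^ Suc 0) psi z) (at z within ?J)"
      by (intro DERIV_subset[OF deriv_n]) auto
    then show "((\<lambda>z. psi z - k * z) has_field_derivative deriv psi z - k) (at z within ?J)"
      by (auto intro!: derivative_eq_intros)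
    show "norm (deriv psi z - k) \<le> B" using B z by auto
  qed auto
  then show ?thesis by (simp add: algebra_simps)
qed

text \<open>The quadratic term agrees with \<open>psi_lower\<close>, so the logarithms produced by
  the two bounds cancel; the cubic term is summable along the predictor.\<close>

lemma psi_upper:
  assumes "\<bar>x\<bar> \<le> 1/4"
  shows "psi x \<le> mu / 2 * x\<^sup>2 + Kp * \<bar>x\<bar> ^ 3"
proof -
  let ?J = "{- \<bar>x\<bar>..\<bar>x\<bar>}"
  have "norm ((psi x - mu / 2 * x\<^sup>2) - (psi 0 - mu / 2 * 0\<^sup>2)) \<le> (Kp * x\<^sup>2) * norm (x - 0)"
  proof (rule field_differentiable_bound[where S = ?J])
    fix z assume z: "z \<in> ?J"
    then have z4: "\<bar>z\<bar> \<le> 1/4" "\<bar>z\<bar> \<le> \<bar>x\<bar>" using assms by auto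
    then have "((deriv ^^ 0) psi has_real_derivative (deriv ^^ Suc 0) psi z) (at z within ?J)"
      by (intro DERIV_subset[OF deriv_n]) auto
    then show "((\<lambda>z. psi z - mu / 2 * z\<^sup>2) has_field_derivative deriv psi z - mu * z) (at z within ?J)"
      by (auto intro!: derivative_eq_intros)
    have "\<bar>deriv psi z - mu * z\<bar> \<le> Kp * z\<^sup>2" by (rule deriv_bound[OF z4(1)])
    also have "\<dots> \<le> Kp * x\<^sup>2" using z4(2) Kp_pos by (intro mult_left_mono) (auto simp: abs_le_square_iff)
    finally show "norm (deriv psi z - mu * z) \<le> Kp * x\<^sup>2" by simp
  qed auto
  then have "psi x - mu / 2 * x\<^sup>2 \<le> Kp * x\<^sup>2 * \<bar>x\<bar>" using psi_0 by simp
  also have "\<dots> = Kp * \<bar>x\<bar> ^ 3" by (simp add: power3_eq_cube power2_eq_square abs_mult_self_eq)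
  finally show ?thesis by simp
qed

section \<open>Lower bounds for the energy of compact perturbations\<close>

definition Sh :: "real \<Rightarrow> real" where
  "Sh \<rho> = (\<Sum>b\<in>Bd 0 \<rho>. psi (ahat b))"

definition errp :: "real \<Rightarrow> real" where
  "errp \<rho> = mu / 2 * err \<rho> + Kp * K0 ^ 3 * ee \<rho>"

text \<open>Beyond this radius the predictor strain is at most 1/8, leaving room for a perturbation
  of size 1/8 inside the range [-1/4, 1/4] where \<open>psi\<close> is expanded; 2 is the least
  inner radius of the annulus bounds.\<close>

definition rho1 :: real where "rho1 = max 2 (8 * K0)"

lemma rho1: "rho1 \<ge> 2" by (simp add: rho1_def)

lemma ahat_small: "b \<in> Bonds \<Longrightarrow> b \<notin> Bd 0 rho1 \<Longrightarrow> \<bar>ahat b\<bar> \<le> 1/8"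
proof -
  assume b: "b \<in> Bonds" "b \<notin> Bd 0 rho1"
  then have "1 + cmod (md b) \<ge> 8 * K0" by (auto simp: Bd_def rho1_def)
  then have "K0 / (1 + cmod (md b)) \<le> 1/8"
    by (subst pos_divide_le_eq) (auto intro: add_pos_nonneg)
  then show ?thesis using decay(2)[OF b(1)] by linarith
qed

lemma ahat_cubed: "b \<in> Bonds \<Longrightarrow> \<bar>ahat b\<bar> ^ 3 \<le> K0 ^ 3 * wt b"
  using power_mono[OF decay(2), of b 3] by (simp add: wt_def power_divide)

lemma Sh_upper:
  assumes "rho1 \<le> \<rho>" "\<rho> \<le> R"
  shows "Sh R \<le> Sh \<rho> + mu * c0 * ln (R / \<rho>) + errp \<rho>"
proof -
  have "Sh R = Sh \<rho> + (\<Sum>b\<in>Bd 0 R - Bd 0 \<rho>. psi (ahat b))"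
    unfolding Sh_def using sum.subset_diff[OF Bd_mono[OF assms(2), of 0], of "\<lambda>b. psi (ahat b)"] by simp
  also have "(\<Sum>b\<in>Bd 0 R - Bd 0 \<rho>. psi (ahat b)) \<le> (\<Sum>b\<in>Bd 0 R - Bd 0 \<rho>. mu / 2 * (ahat b)\<^sup>2 + Kp * (K0 ^ 3 * wt b))"
  proof (rule sum_mono)
    fix b assume "b \<in> Bd 0 R - Bd 0 \<rho>"
    then have b: "b \<in> Bonds" "b \<notin> Bd 0 rho1" using Bd_mono[OF assms(1), of 0] by (auto simp: Bd_def)
    have "psi (ahat b) \<le> mu / 2 * (ahat b)\<^sup>2 + Kp * \<bar>ahat b\<bar> ^ 3"
      using ahat_small[OF b] by (intro psi_upper) simp
    also have "\<dots> \<le> mu / 2 * (ahat b)\<^sup>2 + Kp * (K0 ^ 3 * wt b)"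
      using ahat_cubed[OF b(1)] Kp_pos by (intro add_left_mono mult_left_mono) auto
    finally show "psi (ahat b) \<le> mu / 2 * (ahat b)\<^sup>2 + Kp * (K0 ^ 3 * wt b)" .
  qed
  also have "\<dots> = mu / 2 * (\<Sum>b\<in>Bd 0 R - Bd 0 \<rho>. (ahat b)\<^sup>2) + Kp * K0 ^ 3 * sum wt (Bd 0 R - Bd 0 \<rho>)"
    by (simp add: sum.distrib sum_distrib_left mult.assoc)
  also have "\<dots> \<le> mu / 2 * (2 * c0 * ln (R / \<rho>) + err \<rho>) + Kp * K0 ^ 3 * ee \<rho>"
    using mu_pos Kp_pos K0_pos assms rho1 Bd_subset_Bonds
    by (intro add_mono mult_left_mono ahat_energy_upper sum_wt_le_ee) auto
  finally show ?thesis by (simp add: errp_def algebra_simps)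
qed

section \<open>Strains and charges of perturbed configurations\<close>

abbreviation al :: "(complex \<Rightarrow> real) \<Rightarrow> complex \<times> complex \<Rightarrow> real" where
  "al u \<equiv> strain (\<lambda>x. yhat x + u x)"

lemma Dif_add: "Dif (\<lambda>x. y x + u x) b = Dif y b + Dif u b"
  by (simp add: Dif_def)

lemma psi_al: "psi (al u b) = psi (Dif yhat b + Dif u b)"
  by (simp add: strain_def Dif_add psi_rd)

lemma al_eq_ahat: "Dif u b = 0 \<Longrightarrow> al u b = ahat b"
  by (simp add: strain_def Dif_add)

lemma psi_ahat: "psi (ahat b) = psi (Dif yhat b)"
  by (simp add: strain_def psi_rd)

lemma psi_al_lower: "psi (al u b) \<ge> mu / 2 * (al u b)\<^sup>2"
  unfolding strain_def by (rule psi_lower[OF abs_rd_le])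

lemma Energy0_eq:
  assumes "\<And>b. b \<in> Bonds \<Longrightarrow> b \<notin> B \<Longrightarrow> Dif u b = 0" "finite B" "B \<subseteq> Bonds"
  shows "Energy0 psi u = (\<Sum>b\<in>B. psi (al u b) - psi (ahat b))"
  unfolding Energy0_def psi_al psi_ahat
  by (rule sum.mono_neutral_left) (use assms in auto)

definition charges :: "(complex \<Rightarrow> real) \<Rightarrow> complex set" where
  "charges u = {T \<in> Tri. curl (al u) T \<noteq> 0}"

text \<open>The strain agrees with that of the predictor outside a ball, so the difference has total
  charge 0 and the total is that of \<open>ahat\<close>.\<close>

lemma charges_W0:
  assumes "u \<in> W0"
  shows "finite (charges u)" "(\<Sum>T\<in>charges u. curl (al u) T) = 1"
proof -
  obtain R where R: "R > 0" "\<And>b. b \<in> Bonds \<Longrightarrow> b \<notin> Bd 0 R \<Longrightarrow> Dif u b = 0"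
    using W0_support[OF assms] by blast
  define \<gamma> where "\<gamma> b = al u b - ahat b" for b
  have g0: "\<gamma> b = 0" if "b \<in> Bonds" "b \<notin> Bd 0 R" for b
    using al_eq_ahat R(2)[OF that] by (simp add: \<gamma>_def)
  have cg: "curl \<gamma> T = curl (al u) T - of_bool (T = 0)" for T
    unfolding \<gamma>_def curl_diff curl_ahat ..
  have sub: "charges u \<subseteq> Tr 0 (R + 1)"
  proof
    fix T assume T: "T \<in> charges u"
    show "T \<in> Tr 0 (R + 1)"
    proof (rule ccontr)
      assume n: "T \<notin> Tr 0 (R + 1)"
      then have far: "cmod T > R + 1" using T by (auto simp: Tr_def charges_def)
      have "curl \<gamma> T = 0" unfolding curl_def
      proof (rule sum.neutral, rule ballI)
        fix b assume b: "b \<in> {b \<in> Bonds. Lc b = T}"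
        then have "\<bar>cmod T - cmod (md b)\<bar> \<le> 1/2" using centre_dist(1)[of b 0] by simp
        then have "cmod (md b) > R" using far by linarith
        then show "\<gamma> b = 0" using b by (intro g0) (auto simp: Bd_def)
      qed
      moreover have "T \<noteq> 0" using far R(1) by auto
      ultimately show False using T cg[of T] by (simp add: charges_def)
    qed
  qed
  then show "finite (charges u)" by (rule finite_subset) simp
  have "(\<Sum>T\<in>Tr 0 (R + 1). curl \<gamma> T) = 0"
  proof (rule total_curl_0)
    show "alternating \<gamma>" unfolding \<gamma>_def by (intro alternating_diff alternating_strain)
  qed (use g0 in auto)
  then have "(\<Sum>T\<in>Tr 0 (R + 1). curl (al u) T) = (\<Sum>T\<in>Tr 0 (R + 1). of_bool (T = 0))"
    unfolding cg sum_subtractf by simp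
  also have "\<dots> = 1"
  proof -
    have "0 \<in> Tr 0 (R + 1)" using zero_Tri R(1) by (simp add: Tr_def)
    then show ?thesis by (simp add: of_bool_def)
  qed
  also have "(\<Sum>T\<in>Tr 0 (R + 1). curl (al u) T) = (\<Sum>T\<in>charges u. curl (al u) T)"
  proof (rule sum.mono_neutral_right[OF finite_Tr sub])
    show "\<forall>T\<in>Tr 0 (R + 1) - charges u. curl (al u) T = 0" by (auto simp: charges_def Tr_def)
  qed
  finally show "(\<Sum>T\<in>charges u. curl (al u) T) = 1" .
qed

text \<open>Ball growth bounds the energy outside the given balls from below,
  \<open>Sh_upper\<close> bounds the subtracted predictor energy from above, and the two terms in
  \<open>ln R\<close> cancel as \<open>R\<close> tends to infinity.\<close>

lemma energy_lower_bound:
  fixes J :: "'i set"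
  assumes u: "u \<in> W0" and r0: "2 \<le> r0" and \<rho>: "rho1 \<le> \<rho>"
    and J: "finite J" and P: "\<And>j. j \<in> J \<Longrightarrow> P j \<in> Lam" and r: "\<And>j. j \<in> J \<Longrightarrow> r0 \<le> r j"
    and g: "\<And>T. T \<in> charges u \<Longrightarrow> g T \<in> J" "\<And>T. T \<in> charges u \<Longrightarrow> cmod (T - P (g T)) \<le> r (g T)"
  shows "Energy0 psi u \<ge> (\<Sum>b\<in>(\<Union>j\<in>J. Bd (P j) (r j)). psi (al u b)) - mu * c0 * ln (\<Sum>j\<in>J. r j)
    - mu / 2 * (card J * (err r0 + 2 * c0 / r0)) - Sh \<rho> + mu * c0 * ln \<rho> - errp \<rho>"
proof -
  let ?Old = "\<Union>j\<in>J. Bd (P j) (r j)" and ?S = "\<Sum>j\<in>J. r j"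
  obtain R0 where R0: "R0 > 0" "\<And>b. b \<in> Bonds \<Longrightarrow> b \<notin> Bd 0 R0 \<Longrightarrow> Dif u b = 0"
    using W0_support[OF u] by blast
  have "\<exists>q\<in>Lam. \<exists>R1>0. \<forall>R\<ge>R1. ?Old \<subseteq> Bd q R \<and>
    2 * c0 * ln (R / ?S) - card J * (err r0 + 2 * c0 / r0) \<le> (\<Sum>b\<in>Bd q R - ?Old. (al u b)\<^sup>2)"
  proof (rule ball_growth[OF alternating_strain, where X = "charges u" and g = g])
    show "(\<Sum>T\<in>charges u. curl (al u) T) \<noteq> 0" using charges_W0[OF u] by simp
  qed (use charges_W0[OF u] curl_strain_Ints r0 J P r g in \<open>auto simp: charges_def\<close>)
  then obtain q R1 where q: "q \<in> Lam" "R1 > 0" and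
    sub: "\<And>R. R \<ge> R1 \<Longrightarrow> ?Old \<subseteq> Bd q R" and
    low: "\<And>R. R \<ge> R1 \<Longrightarrow> 2 * c0 * ln (R / ?S) - card J * (err r0 + 2 * c0 / r0) \<le> (\<Sum>b\<in>Bd q R - ?Old. (al u b)\<^sup>2)"
    by blast
  have "J \<noteq> {}"
  proof
    assume "J = {}"
    then have "charges u = {}" using g(1) by auto
    then show False using charges_W0(2)[OF u] by simp
  qed
  moreover have "r j > 0" if "j \<in> J" for j using r[OF that] r0 by linarith
  ultimately have S: "?S > 0" using J by (intro sum_pos) auto
  define C where "C = (\<Sum>b\<in>?Old. psi (al u b)) - mu * c0 * ln ?S
    - mu / 2 * (card J * (err r0 + 2 * c0 / r0)) - Sh \<rho> + mu * c0 * ln \<rho> - errp \<rho>"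
  have ev: "C + mu * c0 * (ln R - ln (R + cmod q)) \<le> Energy0 psi u" if R: "R \<ge> max R1 (max R0 \<rho>)" for R
  proof -
    have Rp: "R \<ge> R1" "R \<ge> R0" "R \<ge> \<rho>" "R > 0" using R q by auto
    \<comment> \<open>The ball produced by growth is centred at an uncontrolled \<open>q\<close>;
      enlarging the ball around 0 by \<open>cmod q\<close> covers it, at a cost that vanishes in the
      limit.\<close>
    define R' where "R' = R + cmod q"
    have R': "R' \<ge> R" "R' > 0" using Rp by (auto simp: R'_def add_pos_nonneg)
    have "Energy0 psi u = (\<Sum>b\<in>Bd 0 R'. psi (al u b) - psi (ahat b))"
    proof (rule Energy0_eq)
      fix b assume "b \<in> Bonds" "b \<notin> Bd 0 R'"
      then show "Dif u b = 0" using R0(2)[of b] Bd_mono[of R0 R' 0] Rp R' by auto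
    qed (auto simp: Bd_subset_Bonds)
    also have "\<dots> = (\<Sum>b\<in>Bd 0 R'. psi (al u b)) - Sh R'" by (simp add: sum_subtractf Sh_def)
    finally have E: "Energy0 psi u = (\<Sum>b\<in>Bd 0 R'. psi (al u b)) - Sh R'" .
    have "(\<Sum>b\<in>?Old. psi (al u b)) + (\<Sum>b\<in>Bd q R - ?Old. psi (al u b)) = (\<Sum>b\<in>Bd q R. psi (al u b))"
      using sum.subset_diff[OF sub[OF Rp(1)], of "\<lambda>b. psi (al u b)"] by (simp add: add.commute)
    also have "\<dots> \<le> (\<Sum>b\<in>Bd 0 R'. psi (al u b))"
      by (intro sum_mono2 Bd_translate) (auto simp: R'_def psi_nonneg)
    finally have 1: "(\<Sum>b\<in>?Old. psi (al u b)) + (\<Sum>b\<in>Bd q R - ?Old. psi (al u b)) \<le> (\<Sum>b\<in>Bd 0 R'. psi (al u b))" .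
    have "mu / 2 * (2 * c0 * ln (R / ?S) - card J * (err r0 + 2 * c0 / r0)) \<le> mu / 2 * (\<Sum>b\<in>Bd q R - ?Old. (al u b)\<^sup>2)"
      using low[OF Rp(1)] mu_pos by (intro mult_left_mono) auto
    also have "\<dots> \<le> (\<Sum>b\<in>Bd q R - ?Old. psi (al u b))"
      unfolding sum_distrib_left by (intro sum_mono psi_al_lower)
    finally have 2: "mu / 2 * (2 * c0 * ln (R / ?S) - card J * (err r0 + 2 * c0 / r0)) \<le> (\<Sum>b\<in>Bd q R - ?Old. psi (al u b))" .
    have 3: "Sh R' \<le> Sh \<rho> + mu * c0 * ln (R' / \<rho>) + errp \<rho>"
      using Sh_upper[OF \<rho>] Rp R' by simp
    have l1: "mu / 2 * (2 * c0 * ln (R / ?S) - card J * (err r0 + 2 * c0 / r0)) =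
       mu * c0 * ln R - mu * c0 * ln ?S - mu / 2 * (card J * (err r0 + 2 * c0 / r0))"
      using Rp(4) S by (simp add: ln_div algebra_simps)
    have l2: "mu * c0 * ln (R' / \<rho>) = mu * c0 * ln R' - mu * c0 * ln \<rho>"
      using R'(2) \<rho> rho1 by (simp add: ln_div algebra_simps)
    have l3: "mu * c0 * (ln R - ln (R + cmod q)) = mu * c0 * ln R - mu * c0 * ln R'"
      by (simp add: R'_def algebra_simps)
    show ?thesis unfolding l3 C_def E using 1 2 3 unfolding l1 l2 by linarith
  qed
  have "((\<lambda>R. ln R - ln (R + cmod q)) \<longlongrightarrow> 0) at_top" by real_asymp
  then have "((\<lambda>R. C + mu * c0 * (ln R - ln (R + cmod q))) \<longlongrightarrow> C + mu * c0 * 0) at_top"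
    by (intro tendsto_intros)
  then have "C + mu * c0 * 0 \<le> Energy0 psi u"
  proof (rule tendsto_upperbound)
    show "\<forall>\<^sub>F R in at_top. C + mu * c0 * (ln R - ln (R + cmod q)) \<le> Energy0 psi u"
      unfolding eventually_at_top_linorder using ev by blast
  qed simp
  then show ?thesis by (simp add: C_def)
qed

end

section \<open>Logarithmic cut-off functions and density of compact perturbations\<close>

text \<open>The point \<open>xi0\<close> is not in \<open>Lat\<close>, so the normalisation at \<open>xi0\<close> holds throughout \<open>LatFun\<close>.\<close>

lemma W12_iff: "v \<in> W12 \<longleftrightarrow> v \<in> LatFun \<and> (\<lambda>b. (Dif v b)\<^sup>2) summable_on Bonds"
proof -
  have "xi0 \<notin> Lat"
  proof
    assume "xi0 \<in> Lat"
    then obtain m n where "xi0 = pt m n" using Lat_pt by blast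
    then have "Im xi0 = Im (pt m n)" by simp
    then have "sqrt 3 * (2 - 1 - 3 * of_int n) = 0" by (simp add: xi0_def pt_def a2_def field_simps)
    then have "real_of_int (3 * n) = 1" by simp
    then have "3 * n = 1" by linarith
    then show False by presburger
  qed
  then show ?thesis by (auto simp: W12_def LatFun_def)
qed

lemma W0_iff: "v \<in> W0 \<longleftrightarrow> v \<in> W12 \<and> bounded {b \<in> Bonds. Dif v b \<noteq> 0}"
proof -
  have "(\<lambda>b. (Dif v b)\<^sup>2) summable_on Bonds" if v: "v \<in> W0"
  proof (rule finite_nonzero_values_imp_summable_on)
    obtain R where "\<And>b. b \<in> Bonds \<Longrightarrow> b \<notin> Bd 0 R \<Longrightarrow> Dif v b = 0"
      using W0_support[OF v] by blast
    then have "{b \<in> Bonds. (Dif v b)\<^sup>2 \<noteq> 0} \<subseteq> Bd 0 R" by auto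
    then show "finite {b \<in> Bonds. (Dif v b)\<^sup>2 \<noteq> 0}" by (rule finite_subset) simp
  qed
  then show ?thesis by (auto simp: W0_def W12_def)
qed

lemma W12_summable: "v \<in> W12 \<Longrightarrow> (\<lambda>b. (Dif v b)\<^sup>2) summable_on Bonds"
  by (simp add: W12_def)

lemma Dif_diff: "Dif (\<lambda>x. v x - w x) b = Dif v b - Dif w b"
  by (simp add: Dif_def)

lemma W12_diff_summable:
  assumes "v \<in> W12" "w \<in> W12"
  shows "(\<lambda>b. (Dif (\<lambda>x. v x - w x) b)\<^sup>2) summable_on Bonds"
proof (rule summable_on_comparison_test)
  show "(\<lambda>b. 2 * (Dif v b)\<^sup>2 + 2 * (Dif w b)\<^sup>2) summable_on Bonds"
    by (intro summable_on_add summable_on_cmult_right W12_summable assms)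
  fix b
  have "(x - y)\<^sup>2 \<le> 2 * x\<^sup>2 + 2 * y\<^sup>2" for x y :: real
    using zero_le_power2[of "x + y"] by (simp add: power2_eq_square algebra_simps)
  from this[of "Dif v b" "Dif w b"]
  show "(Dif (\<lambda>x. v x - w x) b)\<^sup>2 \<le> 2 * (Dif v b)\<^sup>2 + 2 * (Dif w b)\<^sup>2" unfolding Dif_diff .
qed auto

section \<open>Transfer of cut-offs from triangle centres to lattice points\<close>

definition tau :: "complex \<Rightarrow> complex \<Rightarrow> complex" where "tau x e = Lc (x, x + e)"

lemma tau_rotate: "H (tau x (e * a2)) - H (tau x e) = grd H (x, x + e * a2)"
  by (simp only: grd_def tau_def Lc_rv_rotate)

definition sgr :: "(complex \<Rightarrow> real) \<Rightarrow> complex \<Rightarrow> real" where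
  "sgr H x = (\<Sum>e\<in>Units. (grd H (x, x + e))\<^sup>2)"

lemma sgr_nonneg: "sgr H x \<ge> 0" unfolding sgr_def by (intro sum_nonneg) auto

text \<open>Any triangle at \<open>x\<close> is reached from the reference one by at most five
  rotations, each crossing one spoke.\<close>

lemma tau_vary:
  assumes "e \<in> Units"
  shows "\<bar>H (tau x e) - H (tau x 1)\<bar> \<le> 5 * sqrt (sgr H x)"
proof -
  define s where "s = sqrt (sgr H x)"
  have d: "\<bar>grd H (x, x + f)\<bar> \<le> s" if "f \<in> Units" for f
  proof -
    have "(grd H (x, x + f))\<^sup>2 \<le> sgr H x"
      unfolding sgr_def using that finite_Units member_le_sum[of f Units "\<lambda>e. (grd H (x, x + e))\<^sup>2"] by simp
    then show ?thesis unfolding s_def by (metis real_sqrt_abs real_sqrt_le_iff)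
  qed
  have st: "\<bar>H (tau x (f * a2)) - H (tau x f)\<bar> \<le> s" if "f \<in> Units" for f
    unfolding tau_rotate using d Units_mult(2)[OF that] by blast
  have 1: "1 * a2 = a2" "a2 * a2 = a2 - 1" "(a2 - 1) * a2 = - 1" "(- 1) * a2 = - a2" "(- a2) * a2 = 1 - a2"
    using a2_sq by (simp_all add: algebra_simps)
  have "\<bar>H (tau x a2) - H (tau x 1)\<bar> \<le> s" "\<bar>H (tau x (a2 - 1)) - H (tau x a2)\<bar> \<le> s"
    "\<bar>H (tau x (- 1)) - H (tau x (a2 - 1))\<bar> \<le> s" "\<bar>H (tau x (- a2)) - H (tau x (- 1))\<bar> \<le> s"
    "\<bar>H (tau x (1 - a2)) - H (tau x (- a2))\<bar> \<le> s"
    using st[of 1] st[of a2] st[of "a2 - 1"] st[of "- 1"] st[of "- a2"] unfolding 1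
    by (simp_all add: Units_def)
  moreover have "s \<ge> 0" using sgr_nonneg by (simp add: s_def)
  moreover have "e = 1 \<or> e = a2 \<or> e = a2 - 1 \<or> e = - 1 \<or> e = - a2 \<or> e = 1 - a2"
    using assms by (auto simp: Units_def)
  ultimately show ?thesis unfolding s_def[symmetric] by (elim disjE; simp only: diff_self abs_zero; linarith)
qed

text \<open>The triangle to the left of \<open>b\<close> touches both endpoints, so the two
  reference values are compared through it.\<close>

lemma Dif_tau_sq:
  assumes b: "b \<in> Bonds"
  shows "(Dif (\<lambda>x. H (tau x 1)) b)\<^sup>2 \<le> 50 * (sgr H (fst b) + sgr H (snd b))"
proof -
  define e where "e = snd b - fst b"
  have e: "e \<in> Units" using b by (simp add: e_def Bonds_iff)
  have t: "tau (snd b) (e * (a2 - 1)) = tau (fst b) e"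
    using Lc_nxt[of b] by (simp add: tau_def nxt_def e_def)
  have "\<bar>H (tau (snd b) 1) - H (tau (fst b) 1)\<bar> \<le> 5 * sqrt (sgr H (fst b)) + 5 * sqrt (sgr H (snd b))"
    using tau_vary[OF e, of H "fst b"] tau_vary[OF Units_mult(1)[OF e], of H "snd b"] unfolding t by linarith
  then have "(Dif (\<lambda>x. H (tau x 1)) b)\<^sup>2 \<le> (5 * sqrt (sgr H (fst b)) + 5 * sqrt (sgr H (snd b)))\<^sup>2"
    unfolding Dif_def by (metis abs_ge_zero power2_abs power_mono)
  also have "\<dots> \<le> 50 * ((sqrt (sgr H (fst b)))\<^sup>2 + (sqrt (sgr H (snd b)))\<^sup>2)"
  proof -
    have "(5 * x + 5 * y)\<^sup>2 \<le> 50 * (x\<^sup>2 + y\<^sup>2)" for x y :: real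
      using zero_le_power2[of "x - y"] by (simp add: power2_eq_square algebra_simps)
    then show ?thesis .
  qed
  finally show ?thesis using sgr_nonneg by simp
qed

lemma sum_fst_le:
  assumes B: "finite B" "B \<subseteq> Bonds" and p0: "\<And>x. \<phi> x \<ge> (0::real)"
  shows "(\<Sum>b\<in>B. \<phi> (fst b)) \<le> 6 * (\<Sum>x\<in>fst ` B. \<phi> x)"
proof -
  have "(\<Sum>b\<in>B. \<phi> (fst b)) = (\<Sum>x\<in>fst ` B. \<Sum>b\<in>{b \<in> B. fst b = x}. \<phi> (fst b))"
    by (rule sum.group[symmetric]) (use B in auto)
  also have "\<dots> \<le> (\<Sum>x\<in>fst ` B. 6 * \<phi> x)"
  proof (rule sum_mono)
    fix x
    have "{b \<in> B. fst b = x} \<subseteq> (\<lambda>e. (x, x + e)) ` Units"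
    proof
      fix b assume "b \<in> {b \<in> B. fst b = x}"
      then have "b = (x, x + (snd b - fst b))" "snd b - fst b \<in> Units" using B(2) by (auto simp: Bonds_iff prod_eq_iff)
      then show "b \<in> (\<lambda>e. (x, x + e)) ` Units" by blast
    qed
    then have "card {b \<in> B. fst b = x} \<le> card Units"
      using card_mono[of "(\<lambda>e. (x, x + e)) ` Units"] card_image_le[OF finite_Units] finite_Units
      by (meson finite_imageI order_trans)
    also have "card Units \<le> 6" unfolding Units_def by (intro card_insert_le_m1[THEN order_trans]) (auto intro!: card_insert_le_m1)
    finally have "real (card {b \<in> B. fst b = x}) * \<phi> x \<le> 6 * \<phi> x" using p0 by (intro mult_right_mono) auto
    then show "(\<Sum>b\<in>{b \<in> B. fst b = x}. \<phi> (fst b)) \<le> 6 * \<phi> x" by simp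
  qed
  finally show ?thesis by (simp add: sum_distrib_left)
qed

text \<open>The field \<open>H (tau x 1)\<close> on lattice points inherits a small gradient from
  \<open>H\<close>. The constant is 50 per endpoint, times six bonds at each vertex, times two
  endpoints.\<close>

lemma sum_Dif_tau:
  assumes B: "finite B" "B \<subseteq> Bonds" and Q: "\<And>F. finite F \<Longrightarrow> F \<subseteq> Bonds \<Longrightarrow> (\<Sum>b\<in>F. (grd H b)\<^sup>2) \<le> Q"
  shows "(\<Sum>b\<in>B. (Dif (\<lambda>x. H (tau x 1)) b)\<^sup>2) \<le> 600 * Q"
proof -
  have one: "(\<Sum>b\<in>B'. sgr H (fst b)) \<le> 6 * Q" if B': "finite B'" "B' \<subseteq> Bonds" for B'
  proof -
    let ?F = "(\<lambda>(x, e). (x, x + e)) ` (fst ` B' \<times> Units)"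
    have "(\<Sum>b\<in>B'. sgr H (fst b)) \<le> 6 * (\<Sum>x\<in>fst ` B'. sgr H x)"
      by (rule sum_fst_le[OF B' sgr_nonneg])
    also have "(\<Sum>x\<in>fst ` B'. sgr H x) = (\<Sum>(x, e)\<in>fst ` B' \<times> Units. (grd H (x, x + e))\<^sup>2)"
      unfolding sgr_def by (rule sum.cartesian_product)
    also have "\<dots> = (\<Sum>b\<in>?F. (grd H b)\<^sup>2)"
      by (subst sum.reindex) (auto simp: inj_on_def case_prod_beta)
    also have "\<dots> \<le> Q"
      using B' finite_Units by (intro Q) (auto simp: Bonds_iff)
    finally show ?thesis by simp
  qed
  have "(\<Sum>b\<in>B. (Dif (\<lambda>x. H (tau x 1)) b)\<^sup>2) \<le> (\<Sum>b\<in>B. 50 * (sgr H (fst b) + sgr H (snd b)))"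
    using B by (intro sum_mono Dif_tau_sq) auto
  also have "\<dots> = 50 * (\<Sum>b\<in>B. sgr H (fst b)) + 50 * (\<Sum>b\<in>B. sgr H (snd b))"
    by (simp add: sum.distrib sum_distrib_left distrib_left)
  also have "(\<Sum>b\<in>B. sgr H (snd b)) = (\<Sum>b\<in>rv ` B. sgr H (fst b))"
    by (subst sum.reindex) (auto simp: inj_on_def)
  also have "50 * (\<Sum>b\<in>B. sgr H (fst b)) + 50 * (\<Sum>b\<in>rv ` B. sgr H (fst b)) \<le> 50 * (6 * Q) + 50 * (6 * Q)"
  proof (intro add_mono mult_left_mono one)
    show "rv ` B \<subseteq> Bonds" using B(2) rv_Bonds by blast
  qed (use B in auto)
  finally show ?thesis by simp
qed

text \<open>The plane has zero capacity at infinity: a truncated logarithm of height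
  \<open>l\<close> has energy of order \<open>l\<close>, so after division by \<open>l\<close> the
  energy is of order \<open>1 / l\<close>.\<close>

lemma cutoff_exists:
  assumes "\<delta> > 0"
  shows "\<exists>\<eta> R'. (\<forall>x. 0 \<le> \<eta> x \<and> \<eta> x \<le> 1) \<and> (\<forall>x. cmod x \<le> R \<longrightarrow> \<eta> x = 1) \<and> (\<forall>x. cmod x \<ge> R' \<longrightarrow> \<eta> x = (0::real)) \<and>
     (\<forall>B. finite B \<longrightarrow> B \<subseteq> Bonds \<longrightarrow> (\<Sum>b\<in>B. (Dif \<eta> b)\<^sup>2) \<le> \<delta>)"
proof -
  define r1 where "r1 = \<bar>R\<bar> + 1"
  define K where "K = K0\<^sup>2 / c0 * ee 0"
  have "((\<lambda>l. 600 * ((2 / c0 * l + K) / l\<^sup>2)) \<longlongrightarrow> 0) at_top"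
    using c0_pos by real_asymp
  then have "\<forall>\<^sub>F l in at_top. 600 * ((2 / c0 * l + K) / l\<^sup>2) < \<delta>"
    using assms by (rule order_tendstoD)
  then obtain l where l: "l > 0" "600 * ((2 / c0 * l + K) / l\<^sup>2) < \<delta>"
    using eventually_conj[OF _ eventually_gt_at_top[of 0]] eventually_happens[of _ at_top] by (metis (no_types, lifting) trivial_limit_at_top_linorder)
  define r2 where "r2 = r1 * exp l"
  have r: "1 \<le> r1" "r1 \<le> r2" using l(1) by (auto simp: r1_def r2_def mult_le_cancel_left1)
  have ll: "ln r2 - ln r1 = l" using r by (simp add: r2_def ln_mult)
  define H where "H T = Hc 0 r1 r2 T / l" for T
  have Q: "(\<Sum>b\<in>F. (grd H b)\<^sup>2) \<le> (2 / c0 * l + K) / l\<^sup>2" if F: "finite F" "F \<subseteq> Bonds" for F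
  proof -
    obtain R0 where R0: "F \<subseteq> Bd 0 R0" using finite_bonds_subset_Bd[OF F] by blast
    have g: "grd H b = grd (Hc 0 r1 r2) b / l" for b by (simp add: grd_def H_def diff_divide_distrib)
    have "(\<Sum>b\<in>F. (grd H b)\<^sup>2) \<le> (\<Sum>b\<in>Bd 0 R0. (grd H b)\<^sup>2)" using R0 by (intro sum_mono2) auto
    also have "\<dots> = (\<Sum>b\<in>Bd 0 R0. (grd (Hc 0 r1 r2) b)\<^sup>2) / l\<^sup>2"
      unfolding g by (simp add: power_divide sum_divide_distrib)
    also have "\<dots> \<le> (2 / c0 * l + K) / l\<^sup>2"
    proof (rule divide_right_mono)
      have "(\<Sum>b\<in>Bd 0 R0. (grd (Hc 0 r1 r2) b)\<^sup>2) \<le> 2 / c0 * l + K0\<^sup>2 / c0 * ee (r1 - 1)"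
        using grd_Hc_energy_0[OF r] ll by simp
      also have "\<dots> \<le> 2 / c0 * l + K"
        unfolding K_def using r c0_pos by (intro add_left_mono mult_left_mono ee_antimono) auto
      finally show "(\<Sum>b\<in>Bd 0 R0. (grd (Hc 0 r1 r2) b)\<^sup>2) \<le> 2 / c0 * l + K" .
    qed simp
    finally show ?thesis .
  qed
  have tx: "\<bar>cmod (tau x 1) - cmod x\<bar> \<le> 1" for x
  proof -
    have "tau x 1 - x = z0" by (simp add: tau_def Lc_def)
    moreover have "cmod z0 \<le> 1" using cmod_le[of z0] real_le_lsqrt[of 2 3] by simp
    ultimately show ?thesis using norm_triangle_ineq3[of "tau x 1" x] by simp
  qed
  show ?thesis
  proof (intro exI[of _ "\<lambda>x. H (tau x 1)"] exI[of _ "r2 + 1"] conjI allI impI)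
    fix x
    have "0 \<le> Hc 0 r1 r2 (tau x 1)" "Hc 0 r1 r2 (tau x 1) \<le> l" using ll l(1) by (auto simp: Hc_def)
    then show "0 \<le> H (tau x 1)" "H (tau x 1) \<le> 1" using l(1) by (auto simp: H_def)
    show "H (tau x 1) = 1" if "cmod x \<le> R"
    proof -
      have "cmod (tau x 1 - 0) \<le> r1" using tx[of x] that by (simp add: r1_def)
      then show ?thesis using r ll l(1) by (simp add: H_def Hc_inside)
    qed
    show "H (tau x 1) = 0" if "r2 + 1 \<le> cmod x"
    proof -
      have "r2 \<le> cmod (tau x 1 - 0)" using tx[of x] that by simp
      then show ?thesis using r by (simp add: H_def Hc_outside)
    qed
  next
    fix B :: "(complex \<times> complex) set" assume "finite B" "B \<subseteq> Bonds"
    then have "(\<Sum>b\<in>B. (Dif (\<lambda>x. H (tau x 1)) b)\<^sup>2) \<le> 600 * ((2 / c0 * l + K) / l\<^sup>2)"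
      using Q by (rule sum_Dif_tau)
    then show "(\<Sum>b\<in>B. (Dif (\<lambda>x. H (tau x 1)) b)\<^sup>2) \<le> \<delta>" using l(2) by linarith
  qed
qed

text \<open>A function in \<open>W12\<close> may be unbounded, so it is first truncated at a height
  \<open>M\<close> that leaves it unchanged on the finitely many bonds carrying most of its energy;
  the cut-off is then chosen so flat that \<open>M\<^sup>2\<close> times its energy is
  small.\<close>

lemma W0_dense_eps:
  assumes v: "v \<in> W12" and e: "\<epsilon> > 0"
  shows "\<exists>w\<in>W0. infsum (\<lambda>b. (Dif (\<lambda>x. w x - v x) b)\<^sup>2) Bonds \<le> \<epsilon>"
proof -
  \<comment> \<open>The tail of \<open>v\<close> enters with coefficient 8 and the cut-off with
    coefficient 2.\<close>
  define e1 where "e1 = \<epsilon> / 10"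
  have e1: "e1 > 0" using e by (simp add: e1_def)
  obtain F where F: "finite F" "F \<subseteq> Bonds" "dist (\<Sum>b\<in>F. (Dif v b)\<^sup>2) (infsum (\<lambda>b. (Dif v b)\<^sup>2) Bonds) \<le> e1"
    using infsum_finite_approximation[OF W12_summable[OF v] e1] by blast
  have tail: "(\<Sum>b\<in>A. (Dif v b)\<^sup>2) \<le> e1" if A: "finite A" "A \<subseteq> Bonds - F" for A
  proof -
    have "(\<Sum>b\<in>F. (Dif v b)\<^sup>2) + (\<Sum>b\<in>A. (Dif v b)\<^sup>2) = (\<Sum>b\<in>F \<union> A. (Dif v b)\<^sup>2)"
      by (rule sum.union_disjoint[symmetric]) (use A F in auto)
    also have "\<dots> \<le> infsum (\<lambda>b. (Dif v b)\<^sup>2) Bonds"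
      using A F by (intro finite_sum_le_infsum W12_summable v) auto
    finally show ?thesis using F(3) by (simp add: dist_real_def abs_le_iff)
  qed
  obtain R where R: "R > 0" "F \<subseteq> Bd 0 R" using finite_bonds_subset_Bd[OF F(1,2)] by blast
  define M where "M = (\<Sum>b\<in>F. \<bar>v (fst b)\<bar> + \<bar>v (snd b)\<bar>)"
  have M0: "M \<ge> 0" unfolding M_def by (intro sum_nonneg) auto
  have MF: "\<bar>v (fst b)\<bar> \<le> M" "\<bar>v (snd b)\<bar> \<le> M" if "b \<in> F" for b
    using member_le_sum[of b F "\<lambda>b. \<bar>v (fst b)\<bar> + \<bar>v (snd b)\<bar>"] that F(1) unfolding M_def by auto
  define vM where "vM x = max (- M) (min M (v x))" for x
  have vM1: "\<bar>vM x\<bar> \<le> M" for x using M0 by (auto simp: vM_def)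
  have vM2: "\<bar>Dif vM b\<bar> \<le> \<bar>Dif v b\<bar>" for b by (auto simp: vM_def Dif_def)
  have vM3: "vM x = v x" if "\<bar>v x\<bar> \<le> M" for x using that by (auto simp: vM_def)
  define \<delta> where "\<delta> = e1 / (M\<^sup>2 + 1)"
  have d: "\<delta> > 0" "M\<^sup>2 * \<delta> \<le> e1" using e1 by (auto simp: \<delta>_def field_simps add_pos_nonneg)
  obtain \<eta> R' where eta: "\<And>x. 0 \<le> \<eta> x \<and> \<eta> x \<le> 1" "\<And>x. cmod x \<le> R + 1 \<Longrightarrow> \<eta> x = 1"
    "\<And>x. cmod x \<ge> R' \<Longrightarrow> \<eta> x = 0"
    "\<And>B. finite B \<Longrightarrow> B \<subseteq> Bonds \<Longrightarrow> (\<Sum>b\<in>B. (Dif \<eta> b)\<^sup>2) \<le> \<delta>"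
    using cutoff_exists[OF d(1), of "R + 1"] by blast
  define w where "w x = vM x * \<eta> x" for x
  have wF: "Dif w b = Dif v b" if "b \<in> F" for b
  proof -
    have b: "b \<in> Bonds" "cmod (md b) \<le> R" using that R(2) by (auto simp: Bd_def)
    have "cmod (fst b) \<le> R + 1" "cmod (snd b) \<le> R + 1"
      using fst_md[OF b(1)] fst_md[OF rv_Bonds[OF b(1)]] b(2) norm_triangle_ineq[of "md b" "fst b - md b"]
        norm_triangle_ineq[of "md b" "snd b - md b"] by simp_all
    then show ?thesis using MF[OF that] eta(2) vM3 by (simp add: Dif_def w_def)
  qed
  have wB: "(Dif (\<lambda>x. w x - v x) b)\<^sup>2 \<le> 8 * (Dif v b)\<^sup>2 + 2 * M\<^sup>2 * (Dif \<eta> b)\<^sup>2" for b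
  proof -
    have "Dif w b = \<eta> (snd b) * Dif vM b + vM (fst b) * Dif \<eta> b"
      by (simp add: Dif_def w_def algebra_simps)
    then have "\<bar>Dif w b\<bar> \<le> \<bar>\<eta> (snd b)\<bar> * \<bar>Dif vM b\<bar> + \<bar>vM (fst b)\<bar> * \<bar>Dif \<eta> b\<bar>"
      by (metis abs_mult abs_triangle_ineq)
    also have "\<dots> \<le> 1 * \<bar>Dif v b\<bar> + M * \<bar>Dif \<eta> b\<bar>"
      using eta(1)[of "snd b"] vM1 vM2[of b] M0 by (intro add_mono mult_mono) auto
    finally have "\<bar>Dif w b - Dif v b\<bar> \<le> 2 * \<bar>Dif v b\<bar> + M * \<bar>Dif \<eta> b\<bar>" by linarith
    then have "(Dif w b - Dif v b)\<^sup>2 \<le> (2 * \<bar>Dif v b\<bar> + M * \<bar>Dif \<eta> b\<bar>)\<^sup>2"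
      by (metis abs_ge_zero power2_abs power_mono)
    also have "\<dots> \<le> 2 * (2 * \<bar>Dif v b\<bar>)\<^sup>2 + 2 * (M * \<bar>Dif \<eta> b\<bar>)\<^sup>2"
      using zero_le_power2[of "2 * \<bar>Dif v b\<bar> - M * \<bar>Dif \<eta> b\<bar>"] by (simp add: power2_eq_square algebra_simps)
    also have "\<dots> = 8 * (Dif v b)\<^sup>2 + 2 * M\<^sup>2 * (Dif \<eta> b)\<^sup>2" by (simp add: power_mult_distrib)
    finally show ?thesis unfolding Dif_diff .
  qed
  have bnd: "(\<Sum>b\<in>A. (Dif (\<lambda>x. w x - v x) b)\<^sup>2) \<le> \<epsilon>" if A: "finite A" "A \<subseteq> Bonds" for A
  proof -
    have "(\<Sum>b\<in>A. (Dif (\<lambda>x. w x - v x) b)\<^sup>2) = (\<Sum>b\<in>A - F. (Dif (\<lambda>x. w x - v x) b)\<^sup>2)"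
      by (rule sum.mono_neutral_right) (use A wF in \<open>auto simp: Dif_diff\<close>)
    also have "\<dots> \<le> (\<Sum>b\<in>A - F. 8 * (Dif v b)\<^sup>2 + 2 * M\<^sup>2 * (Dif \<eta> b)\<^sup>2)" by (intro sum_mono wB)
    also have "\<dots> = 8 * (\<Sum>b\<in>A - F. (Dif v b)\<^sup>2) + 2 * M\<^sup>2 * (\<Sum>b\<in>A - F. (Dif \<eta> b)\<^sup>2)"
      by (simp add: sum.distrib sum_distrib_left)
    also have "\<dots> \<le> 8 * e1 + 2 * M\<^sup>2 * \<delta>"
      using A by (intro add_mono mult_left_mono tail eta(4)) auto
    also have "\<dots> \<le> \<epsilon>" using d(2) by (simp add: e1_def)
    finally show ?thesis .
  qed
  have sw: "(\<lambda>b. (Dif (\<lambda>x. w x - v x) b)\<^sup>2) summable_on Bonds"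
    by (rule nonneg_bdd_above_summable_on) (auto intro!: bdd_aboveI2[where M = \<epsilon>] bnd)
  have "infsum (\<lambda>b. (Dif (\<lambda>x. w x - v x) b)\<^sup>2) Bonds \<le> \<epsilon>"
    by (rule infsum_le_finite_sums[OF sw bnd])
  moreover have "w \<in> W0"
  proof -
    have "w x = 0" if "x \<notin> Lat" for x
      using v that M0 by (auto simp: w_def vM_def W12_def LatFun_def)
    then have wL: "w \<in> LatFun" by (simp add: LatFun_def)
    have sub: "{b \<in> Bonds. Dif w b \<noteq> 0} \<subseteq> Bd 0 (\<bar>R'\<bar> + 1)"
    proof
      fix b assume b: "b \<in> {b \<in> Bonds. Dif w b \<noteq> 0}"
      show "b \<in> Bd 0 (\<bar>R'\<bar> + 1)"
      proof (rule ccontr)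
        assume "b \<notin> Bd 0 (\<bar>R'\<bar> + 1)"
        then have "cmod (md b) > \<bar>R'\<bar> + 1" using b by (auto simp: Bd_def)
        moreover have bb: "b \<in> Bonds" using b by simp
        ultimately have "cmod (fst b) \<ge> R'" "cmod (snd b) \<ge> R'"
          using fst_md[OF bb] fst_md[OF rv_Bonds[OF bb]] norm_triangle_ineq2[of "md b" "md b - fst b"]
            norm_triangle_ineq2[of "md b" "md b - snd b"] by (simp_all add: norm_minus_commute)
        then have "Dif w b = 0" using eta(3) by (simp add: Dif_def w_def)
        then show False using b by simp
      qed
    qed
    then have fin: "finite {b \<in> Bonds. Dif w b \<noteq> 0}" by (rule finite_subset) simp
    then have "(\<lambda>b. (Dif w b)\<^sup>2) summable_on Bonds" by (intro finite_nonzero_values_imp_summable_on) simp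
    then show ?thesis unfolding W0_iff W12_iff using wL fin finite_imp_bounded by blast
  qed
  ultimately show ?thesis by blast
qed

lemma W0_dense:
  assumes "v \<in> W12"
  obtains vs where "\<And>n. vs n \<in> W0" "(\<lambda>n. Dnorm (\<lambda>x. vs n x - v x)) \<longlonglongrightarrow> 0"
proof -
  have "\<forall>n. \<exists>w\<in>W0. infsum (\<lambda>b. (Dif (\<lambda>x. w x - v x) b)\<^sup>2) Bonds \<le> 1 / real (Suc n)"
    using W0_dense_eps[OF assms] by simp
  then obtain vs where vs: "\<And>n. vs n \<in> W0" "\<And>n. infsum (\<lambda>b. (Dif (\<lambda>x. vs n x - v x) b)\<^sup>2) Bonds \<le> 1 / real (Suc n)"
    by metis
  have "(\<lambda>n. Dnorm (\<lambda>x. vs n x - v x)) \<longlonglongrightarrow> 0"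
  proof (rule tendsto_sandwich[where f = "\<lambda>_. 0" and h = "\<lambda>n. sqrt (1 / real (Suc n))"])
    show "(\<lambda>n. sqrt (1 / real (Suc n))) \<longlonglongrightarrow> 0"
      by real_asymp
    show "\<forall>\<^sub>F n in sequentially. Dnorm (\<lambda>x. vs n x - v x) \<le> sqrt (1 / real (Suc n))"
      using vs(2) by (intro always_eventually allI) (simp only: Dnorm_def real_sqrt_le_iff)
    show "\<forall>\<^sub>F n in sequentially. 0 \<le> Dnorm (\<lambda>x. vs n x - v x)"
      by (intro always_eventually allI) (simp add: Dnorm_def infsum_nonneg)
  qed simp
  then show thesis using vs(1) that by blast
qed

section \<open>The energy on the closure\<close>

text \<open>Truncated only outside, so that its gradient is exactly \<open>ff\<close> within the
  ball; at the origin both use the convention \<open>ln 0 = 0\<close>.\<close>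

definition Hd :: "real \<Rightarrow> complex \<Rightarrow> real" where
  "Hd r T = max 0 (ln r - ln (cmod T))"

lemma Hd_inside:
  assumes "1 \<le> r" "cmod T \<le> r"
  shows "Hd r T = ln r - ln (cmod T)"
proof (cases "T = 0")
  case True
  then show ?thesis using assms by (simp add: Hd_def)
next
  case False
  then have "ln (cmod T) \<le> ln r" using assms by (intro ln_mono) auto
  then show ?thesis by (simp add: Hd_def)
qed

lemma Hd_outside: "0 < r \<Longrightarrow> r < cmod T \<Longrightarrow> Hd r T = 0"
proof -
  assume "0 < r" "r < cmod T"
  then have "ln r \<le> ln (cmod T)" by (intro ln_mono) auto
  then show ?thesis by (simp add: Hd_def)
qed

lemma grd_Hd_ff:
  assumes "b \<in> Bonds" "1 \<le> r" "cmod (md b) \<le> r - 1"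
  shows "grd (Hd r) b = ff b"
proof -
  have "\<bar>cmod (Lc b) - cmod (md b)\<bar> \<le> 1/2" "\<bar>cmod (Lc (rv b)) - cmod (md b)\<bar> \<le> 1/2"
    using centre_dist[OF assms(1), of 0] by simp_all
  then have "cmod (Lc b) \<le> r" "cmod (Lc (rv b)) \<le> r" using assms(3) by linarith+
  then show ?thesis using assms(2) by (simp add: grd_def Hd_inside ff_def)
qed

lemma grd_Hd_le: "\<bar>grd (Hd r) b\<bar> \<le> \<bar>ff b\<bar>"
proof -
  have "\<bar>max 0 x - max 0 y\<bar> \<le> \<bar>x - y\<bar>" for x y :: real by (auto simp: max_def)
  from this[of "ln r - ln (cmod (Lc b))" "ln r - ln (cmod (Lc (rv b)))"]
  show ?thesis unfolding grd_def Hd_def ff_def by linarith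
qed

text \<open>Stokes for the untruncated logarithm: \<open>ff\<close> differs from the gradient of the
  truncation only in a boundary shell. For \<open>Dif u\<close>, which has no charges, the pairing
  is thus a pure shell term.\<close>

lemma ff_pairing:
  assumes al: "alternating \<beta>" and R: "R \<ge> 3"
  shows "\<bar>(\<Sum>b\<in>Bd 0 R. ff b * \<beta> b) - 2 * (\<Sum>T\<in>Tr 0 (R - 1). Hd (R - 1) T * curl \<beta> T)\<bar>
    \<le> 2 * (\<Sum>b\<in>Bd 0 R - Bd 0 (R - 2). \<bar>ff b\<bar> * \<bar>\<beta> b\<bar>)"
proof -
  let ?g = "grd (Hd (R - 1))"
  have "(\<Sum>b\<in>Bd 0 R. ?g b * \<beta> b) = 2 * (\<Sum>T\<in>Tr 0 (R - 1). Hd (R - 1) T * curl \<beta> T)"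
    by (rule stokes_Bd[OF al]) (use R in \<open>auto intro!: Hd_outside\<close>)
  then have "(\<Sum>b\<in>Bd 0 R. ff b * \<beta> b) - 2 * (\<Sum>T\<in>Tr 0 (R - 1). Hd (R - 1) T * curl \<beta> T)
     = (\<Sum>b\<in>Bd 0 R. (ff b - ?g b) * \<beta> b)" by (simp add: left_diff_distrib sum_subtractf)
  also have "\<dots> = (\<Sum>b\<in>Bd 0 R - Bd 0 (R - 2). (ff b - ?g b) * \<beta> b)"
  proof (rule sum.mono_neutral_right)
    show "\<forall>b\<in>Bd 0 R - (Bd 0 R - Bd 0 (R - 2)). (ff b - ?g b) * \<beta> b = 0"
    proof
      fix b assume "b \<in> Bd 0 R - (Bd 0 R - Bd 0 (R - 2))"
      then have "?g b = ff b" using R by (intro grd_Hd_ff) (auto simp: Bd_def)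
      then show "(ff b - ?g b) * \<beta> b = 0" by simp
    qed
  qed auto
  also have "\<bar>\<dots>\<bar> \<le> (\<Sum>b\<in>Bd 0 R - Bd 0 (R - 2). \<bar>(ff b - ?g b) * \<beta> b\<bar>)" by (rule sum_abs)
  also have "\<dots> \<le> (\<Sum>b\<in>Bd 0 R - Bd 0 (R - 2). 2 * (\<bar>ff b\<bar> * \<bar>\<beta> b\<bar>))"
  proof (rule sum_mono)
    fix b
    have "\<bar>ff b - ?g b\<bar> \<le> 2 * \<bar>ff b\<bar>" using grd_Hd_le[of "R - 1" b] by linarith
    then have "\<bar>ff b - ?g b\<bar> * \<bar>\<beta> b\<bar> \<le> 2 * \<bar>ff b\<bar> * \<bar>\<beta> b\<bar>" by (rule mult_right_mono) simp
    then show "\<bar>(ff b - ?g b) * \<beta> b\<bar> \<le> 2 * (\<bar>ff b\<bar> * \<bar>\<beta> b\<bar>)" by (simp add: abs_mult mult.assoc)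
  qed
  finally show ?thesis by (simp add: sum_distrib_left)
qed

lemma sum_Bd_tendsto:
  fixes f :: "complex \<times> complex \<Rightarrow> real"
  assumes "f summable_on Bonds"
  shows "((\<lambda>R. \<Sum>b\<in>Bd 0 R. f b) \<longlongrightarrow> infsum f Bonds) at_top"
proof -
  have "(sum f \<longlongrightarrow> infsum f Bonds) (finite_subsets_at_top Bonds)"
    using has_sum_infsum[OF assms] by (simp add: has_sum_def)
  moreover have "filterlim (Bd 0) (finite_subsets_at_top Bonds) at_top"
    unfolding filterlim_finite_subsets_at_top
  proof (intro allI impI)
    fix X assume "finite X \<and> X \<subseteq> Bonds"
    then obtain R0 where "X \<subseteq> Bd 0 R0" using finite_bonds_subset_Bd by blast
    then have "\<forall>R\<ge>R0. finite (Bd 0 R) \<and> X \<subseteq> Bd 0 R \<and> Bd 0 R \<subseteq> Bonds"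
      using Bd_mono Bd_subset_Bonds finite_Bd by blast
    then show "\<forall>\<^sub>F R in at_top. finite (Bd 0 R) \<and> X \<subseteq> Bd 0 R \<and> Bd 0 R \<subseteq> Bonds"
      unfolding eventually_at_top_linorder by blast
  qed
  ultimately show ?thesis by (rule filterlim_compose)
qed

text \<open>Second-order decay, not summable by itself, but square summable by comparison with
  \<open>wt\<close>; it can therefore be paired with \<open>Dif v\<close>.\<close>

definition dl :: "complex \<times> complex \<Rightarrow> real" where "dl b = 1 / (1 + cmod (md b))\<^sup>2"

lemma dl_pos: "dl b > 0"
  unfolding dl_def by (intro divide_pos_pos zero_less_power) (auto intro: add_pos_nonneg)

lemma dl_sq: "(dl b)\<^sup>2 \<le> wt b"
proof -
  have s: "1 + cmod (md b) \<ge> 1" by simp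
  then have "(1 + cmod (md b)) ^ 3 \<le> ((1 + cmod (md b))\<^sup>2)\<^sup>2"
    unfolding power_mult[symmetric] by (intro power_increasing) auto
  moreover have "(1 + cmod (md b)) ^ 3 > 0" using s by (intro zero_less_power) linarith
  ultimately show ?thesis unfolding dl_def wt_def power_divide power_one
    by (intro divide_left_mono mult_pos_pos) auto
qed

lemma ahat_sq_dl: "b \<in> Bonds \<Longrightarrow> (ahat b)\<^sup>2 \<le> K0\<^sup>2 * dl b"
proof -
  assume "b \<in> Bonds"
  then have "\<bar>ahat b\<bar>\<^sup>2 \<le> (K0 / (1 + cmod (md b)))\<^sup>2" by (intro power_mono decay(2)) auto
  then show ?thesis by (simp add: dl_def power_divide)
qed

lemma ahat_ff_dl: "b \<in> Bonds \<Longrightarrow> \<bar>ahat b - c0 * ff b\<bar> \<le> K0 * dl b"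
  using decay(3)[of b] by (simp add: dl_def)

text \<open>Young's inequality weighted by \<open>D\<close>. With \<open>D\<close> the norm of the
  difference field \<open>d\<close>, the sum of \<open>d\<^sup>2 / D\<close> is at most
  \<open>D\<close>, so all terms vanish together with \<open>D\<close>.\<close>

lemma young_split:
  fixes a t d l D W :: real
  assumes "0 \<le> d" "t \<le> a + d" "0 < D" "l\<^sup>2 \<le> W"
  shows "(a + t + l) * d \<le> d\<^sup>2 + d\<^sup>2 / D + D * (2 * a\<^sup>2 + W)"
proof -
  define x where "x = 2 * a + l"
  have "(a + t + l) * d \<le> (x + d) * d" using assms by (intro mult_right_mono) (auto simp: x_def)
  also have "\<dots> = d * x + d\<^sup>2" by (simp add: power2_eq_square algebra_simps)
  finally have 1: "(a + t + l) * d \<le> d * x + d\<^sup>2" .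
  have "0 \<le> (d - D * x / 2)\<^sup>2 / D" using assms(3) by simp
  also have "\<dots> = d\<^sup>2 / D - d * x + D * (x\<^sup>2 / 4)"
    using assms(3) by (simp add: power2_eq_square field_simps)
  finally have 2: "d * x \<le> d\<^sup>2 / D + D * (x\<^sup>2 / 4)" by linarith
  have "x\<^sup>2 \<le> 8 * a\<^sup>2 + 2 * l\<^sup>2"
    using zero_le_power2[of "2 * a - l"] unfolding x_def by (simp add: power2_eq_square algebra_simps)
  moreover have "0 \<le> W" using assms(4) zero_le_power2[of l] by linarith
  ultimately have "x\<^sup>2 / 4 \<le> 2 * a\<^sup>2 + W" using assms(4) by linarith
  then have "D * (x\<^sup>2 / 4) \<le> D * (2 * a\<^sup>2 + W)" using assms(3) by (intro mult_left_mono) auto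
  then show ?thesis using 1 2 by linarith
qed

section \<open>The energy as an absolutely convergent sum\<close>

context potential
begin

text \<open>The energy difference with its linear part removed to leading order. The subtracted
  terms sum to zero on \<open>W0\<close> since \<open>ff\<close> is divergence-free, and what
  remains is absolutely summable on all of \<open>W12\<close>.\<close>

definition G :: "complex \<times> complex \<Rightarrow> real \<Rightarrow> real" where
  "G b t = psi (ahat b + t) - psi (ahat b) - mu * c0 * ff b * t"

definition EE :: "(complex \<Rightarrow> real) \<Rightarrow> real" where
  "EE v = infsum (\<lambda>b. G b (Dif v b)) Bonds"

definition Cg :: real where "Cg = 2 * Kp * K0\<^sup>2 + mu * K0 + Kp + mu"

lemma Cg_pos: "Cg > 0"
  unfolding Cg_def using Kp_pos K0_pos mu_pos by (intro add_pos_pos) auto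

lemma psi_ahat_add: "psi (ahat b + t) = psi (Dif yhat b + t)"
proof (rule psi_cong_Ints)
  have "- (Dif yhat b - rd (Dif yhat b)) \<in> \<int>" by (intro Ints_minus rd_diff_Ints)
  then show "(ahat b + t) - (Dif yhat b + t) \<in> \<int>" by (simp add: strain_def)
qed

text \<open>The slope of \<open>G b\<close> is \<open>deriv psi z - mu * c0 * ff b\<close>, which
  splits into the Taylor error of \<open>deriv psi\<close>, \<open>mu\<close> times the
  perturbation, and \<open>mu * (ahat b - c0 * ff b)\<close>; the last is of order
  \<open>dl\<close>. \<open>Cg\<close> collects these constants.\<close>

lemma G_lipschitz:
  assumes b: "b \<in> Bonds" "\<bar>ahat b\<bar> \<le> 1/8" and st: "\<bar>s\<bar> \<le> 1/8" "\<bar>t\<bar> \<le> 1/8"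
  shows "\<bar>G b t - G b s\<bar> \<le> Cg * (\<bar>s\<bar> + \<bar>t\<bar> + dl b) * \<bar>t - s\<bar>"
proof -
  define k where "k = mu * c0 * ff b"
  define m where "m = \<bar>s\<bar> + \<bar>t\<bar>"
  have "\<bar>psi (ahat b + t) - psi (ahat b + s) - k * ((ahat b + t) - (ahat b + s))\<bar>
    \<le> (Cg * (m + dl b)) * \<bar>(ahat b + t) - (ahat b + s)\<bar>"
  proof (rule psi_increment)
    fix z assume z: "min (ahat b + s) (ahat b + t) \<le> z" "z \<le> max (ahat b + s) (ahat b + t)"
    define x where "x = z - ahat b"
    have x: "\<bar>x\<bar> \<le> m" "m \<le> 1/4" "0 \<le> m" using z st by (auto simp: x_def m_def min_def max_def split: if_splits)
    have z4: "\<bar>z\<bar> \<le> 1/4" using z st b(2) by (auto simp: min_def max_def split: if_splits)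
    have "x\<^sup>2 \<le> m * m" using x(1) power_mono[of "\<bar>x\<bar>" m 2] by (simp add: power2_eq_square)
    also have "\<dots> \<le> m * (1/4)" using x by (intro mult_left_mono) auto
    finally have x2: "2 * x\<^sup>2 \<le> m" using x(3) by linarith
    have "z\<^sup>2 \<le> 2 * (ahat b)\<^sup>2 + 2 * x\<^sup>2"
    proof -
      have "z = ahat b + x" by (simp add: x_def)
      then show ?thesis using zero_le_power2[of "ahat b - x"] by (simp add: power2_eq_square algebra_simps)
    qed
    also have "\<dots> \<le> 2 * K0\<^sup>2 * dl b + m" using ahat_sq_dl[OF b(1)] x2 by linarith
    finally have "Kp * z\<^sup>2 \<le> Kp * (2 * K0\<^sup>2 * dl b + m)" using Kp_pos by (intro mult_left_mono) auto
    then have 1: "\<bar>deriv psi z - mu * z\<bar> \<le> Kp * (2 * K0\<^sup>2 * dl b + m)" using deriv_bound[OF z4] by linarith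
    have "mu * z - k = mu * x + mu * (ahat b - c0 * ff b)" by (simp add: x_def k_def algebra_simps)
    then have "\<bar>mu * z - k\<bar> \<le> mu * \<bar>x\<bar> + mu * \<bar>ahat b - c0 * ff b\<bar>"
      using abs_triangle_ineq[of "mu * x" "mu * (ahat b - c0 * ff b)"] mu_pos by (simp add: abs_mult)
    also have "\<dots> \<le> mu * m + mu * (K0 * dl b)"
      using x(1) ahat_ff_dl[OF b(1)] mu_pos by (intro add_mono mult_left_mono) auto
    finally have "\<bar>deriv psi z - k\<bar> \<le> Kp * (2 * K0\<^sup>2 * dl b + m) + (mu * m + mu * (K0 * dl b))"
      using 1 by linarith
    also have "\<dots> = (Kp + mu) * m + (2 * Kp * K0\<^sup>2 + mu * K0) * dl b" by (simp add: algebra_simps)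
    also have "\<dots> \<le> Cg * m + Cg * dl b"
    proof (intro add_mono mult_right_mono)
      have "0 < Kp * K0\<^sup>2" "0 < mu * K0" using Kp_pos mu_pos K0_pos by simp_all
      then show "Kp + mu \<le> Cg" "2 * Kp * K0\<^sup>2 + mu * K0 \<le> Cg"
        using Kp_pos mu_pos unfolding Cg_def by linarith+
    qed (use x(3) dl_pos[of b] in auto)
    finally show "\<bar>deriv psi z - k\<bar> \<le> Cg * (m + dl b)" by (simp add: algebra_simps)
  next
    show "\<bar>ahat b + s\<bar> \<le> 1/4" "\<bar>ahat b + t\<bar> \<le> 1/4" using b(2) st by linarith+
  qed
  moreover have "psi (ahat b + t) - psi (ahat b + s) - k * ((ahat b + t) - (ahat b + s)) = G b t - G b s"
    by (simp add: G_def k_def algebra_simps)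
  ultimately show ?thesis by (simp add: m_def)
qed

lemma G_0 [simp]: "G b 0 = 0" by (simp add: G_def)

text \<open>Off a finite set everything stays in the smooth range of \<open>psi\<close>. The
  threshold 1/16, half of 1/8, leaves room for functions within 1/16 of \<open>v\<close> in
  norm.\<close>

lemma W12_exceptional:
  assumes "v \<in> W12"
  defines "F \<equiv> Bd 0 rho1 \<union> {b \<in> Bonds. (Dif v b)\<^sup>2 \<ge> 1/256}"
  shows "finite F" "F \<subseteq> Bonds" "\<And>b. b \<in> Bonds - F \<Longrightarrow> \<bar>ahat b\<bar> \<le> 1/8 \<and> \<bar>Dif v b\<bar> \<le> 1/16"
proof -
  show "finite F" unfolding F_def
    using summable_on_imp_finite_ge[OF W12_summable[OF assms(1)], of "1/256"] by simp
  show "F \<subseteq> Bonds" unfolding F_def using Bd_subset_Bonds by auto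
  fix b assume b: "b \<in> Bonds - F"
  then have "(Dif v b)\<^sup>2 \<le> (1/16)\<^sup>2" by (auto simp: F_def power2_eq_square)
  then have "\<bar>Dif v b\<bar> \<le> 1/16" by (metis abs_le_square_iff abs_of_nonneg zero_le_divide_1_iff zero_le_numeral)
  then show "\<bar>ahat b\<bar> \<le> 1/8 \<and> \<bar>Dif v b\<bar> \<le> 1/16" using ahat_small b by (auto simp: F_def)
qed

lemma G_summable:
  assumes v: "v \<in> W12"
  shows "(\<lambda>b. G b (Dif v b)) summable_on Bonds"
proof -
  define F where "F = Bd 0 rho1 \<union> {b \<in> Bonds. (Dif v b)\<^sup>2 \<ge> 1/256}"
  note F = W12_exceptional[OF v, folded F_def]
  have s: "(\<lambda>b. Cg * (2 * (Dif v b)\<^sup>2 + wt b)) summable_on (Bonds - F)"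
    by (rule summable_on_subset_banach[of _ Bonds])
       (intro summable_on_cmult_right summable_on_add W12_summable v wt_summable, auto)
  have "(\<lambda>b. norm (G b (Dif v b))) summable_on (Bonds - F)"
  proof (rule summable_on_comparison_test[OF s])
    fix b assume b: "b \<in> Bonds - F"
    let ?a = "\<bar>Dif v b\<bar>"
    have "\<bar>G b (Dif v b) - G b 0\<bar> \<le> Cg * (\<bar>0\<bar> + ?a + dl b) * \<bar>Dif v b - 0\<bar>"
      using F(3)[OF b] b by (intro G_lipschitz) auto
    also have "\<dots> = Cg * (?a * ?a + dl b * ?a)" by (simp add: algebra_simps)
    also have "\<dots> \<le> Cg * (2 * ?a\<^sup>2 + wt b)"
    proof (rule mult_left_mono)
      have "2 * (dl b * ?a) \<le> (dl b)\<^sup>2 + ?a\<^sup>2"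
        using zero_le_power2[of "dl b - ?a"] by (simp add: power2_eq_square algebra_simps)
      moreover have "dl b * ?a \<ge> 0" using dl_pos[of b] by simp
      ultimately show "?a * ?a + dl b * ?a \<le> 2 * ?a\<^sup>2 + wt b"
        using dl_sq[of b] unfolding power2_eq_square[of ?a] by linarith
    qed (use Cg_pos in simp)
    finally show "norm (G b (Dif v b)) \<le> Cg * (2 * (Dif v b)\<^sup>2 + wt b)" by simp
  qed simp
  then have "(\<lambda>b. G b (Dif v b)) summable_on (Bonds - F)" by (rule abs_summable_summable)
  moreover have "(\<lambda>b. G b (Dif v b)) summable_on F" using F(1) by simp
  ultimately have "(\<lambda>b. G b (Dif v b)) summable_on (F \<union> (Bonds - F))" by (intro summable_on_Un_disjoint) auto
  moreover have "F \<union> (Bonds - F) = Bonds" using F(2) by auto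
  ultimately show ?thesis by simp
qed

text \<open>The pairing of \<open>ff\<close> with a compactly supported gradient vanishes: there is
  no charge, and no contribution from a shell beyond the support.\<close>

lemma EE_W0:
  assumes u: "u \<in> W0"
  shows "EE u = Energy0 psi u"
proof -
  obtain R0 where R0: "R0 > 0" "\<And>b. b \<in> Bonds \<Longrightarrow> b \<notin> Bd 0 R0 \<Longrightarrow> Dif u b = 0"
    using W0_support[OF u] by blast
  define R where "R = R0 + 3"
  have R: "R \<ge> 3" "\<And>b. b \<in> Bonds \<Longrightarrow> b \<notin> Bd 0 (R - 2) \<Longrightarrow> Dif u b = 0"
    using R0 Bd_mono[of R0 "R - 2" 0] by (auto simp: R_def)
  have R': "Dif u b = 0" if "b \<in> Bonds" "b \<notin> Bd 0 R" for b
    using R(2)[OF that(1)] that(2) Bd_mono[of "R - 2" R 0] by auto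
  have z: "(\<Sum>b\<in>Bd 0 R. ff b * Dif u b) = 0"
  proof -
    have "(\<Sum>b\<in>Bd 0 R - Bd 0 (R - 2). \<bar>ff b\<bar> * \<bar>Dif u b\<bar>) = 0"
    proof (rule sum.neutral, rule ballI)
      fix b assume "b \<in> Bd 0 R - Bd 0 (R - 2)"
      then have "Dif u b = 0" by (intro R(2)) (auto simp: Bd_def)
      then show "\<bar>ff b\<bar> * \<bar>Dif u b\<bar> = 0" by simp
    qed
    then show ?thesis using ff_pairing[OF alternating_Dif R(1), of u] by (simp add: curl_Dif)
  qed
  have "EE u = infsum (\<lambda>b. G b (Dif u b)) (Bd 0 R)"
    unfolding EE_def by (rule infsum_cong_neutral) (use R' Bd_subset_Bonds[of 0 R] in auto)
  also have "\<dots> = (\<Sum>b\<in>Bd 0 R. psi (al u b) - psi (ahat b) - mu * c0 * (ff b * Dif u b))"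
    by (simp add: G_def psi_ahat_add psi_al mult.assoc)
  also have "\<dots> = (\<Sum>b\<in>Bd 0 R. psi (al u b) - psi (ahat b)) - mu * c0 * (\<Sum>b\<in>Bd 0 R. ff b * Dif u b)"
    by (simp add: sum_subtractf sum_distrib_left)
  also have "\<dots> = Energy0 psi u"
    unfolding z using R' by (subst Energy0_eq[of "Bd 0 R"]) (auto simp: Bd_subset_Bonds)
  finally show ?thesis .
qed

lemma Dif_le_Dnorm:
  assumes "(\<lambda>b. (Dif w b)\<^sup>2) summable_on Bonds" "b \<in> Bonds"
  shows "\<bar>Dif w b\<bar> \<le> Dnorm w"
proof -
  have "(\<Sum>b\<in>{b}. (Dif w b)\<^sup>2) \<le> infsum (\<lambda>b. (Dif w b)\<^sup>2) Bonds"
    using assms by (intro finite_sum_le_infsum) auto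
  then show ?thesis unfolding Dnorm_def by (simp add: real_le_rsqrt)
qed

lemma isCont_G: "isCont (G b) t"
proof -
  have "isCont (\<lambda>t. psi (ahat b + t)) t"
    using isCont_o2[of t "\<lambda>t. ahat b + t" psi] psi_isCont by simp
  then show ?thesis unfolding G_def by (intro continuous_intros)
qed

text \<open>On the finite exceptional set, where \<open>psi\<close> may fail to be smooth, mere
  continuity suffices; elsewhere \<open>G_lipschitz\<close> and the weighted Young inequality give a
  bound that is uniform over finite sums.\<close>

lemma EE_continuous:
  assumes v: "v \<in> W12" and w: "\<And>n. w n \<in> W12" and lim: "(\<lambda>n. Dnorm (\<lambda>x. w n x - v x)) \<longlonglongrightarrow> 0"
  shows "(\<lambda>n. EE (w n)) \<longlonglongrightarrow> EE v"
proof -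
  define D where "D n = Dnorm (\<lambda>x. w n x - v x)" for n
  define d where "d n b = Dif (w n) b - Dif v b" for n b
  define F where "F = Bd 0 rho1 \<union> {b \<in> Bonds. (Dif v b)\<^sup>2 \<ge> 1/256}"
  note F = W12_exceptional[OF v, folded F_def]
  define M where "M = infsum (\<lambda>b. 2 * (Dif v b)\<^sup>2 + wt b) Bonds"
  have ds: "(\<lambda>b. (d n b)\<^sup>2) summable_on Bonds" for n
    using W12_diff_summable[OF w v, of n] by (simp add: d_def Dif_diff)
  have dD: "\<bar>d n b\<bar> \<le> D n" if "b \<in> Bonds" for n b
    using Dif_le_Dnorm[OF W12_diff_summable[OF w v, of n] that] by (simp add: d_def D_def Dif_diff)
  have D0: "D n \<ge> 0" for n by (simp add: D_def Dnorm_def infsum_nonneg)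
  have Dsq: "(\<Sum>b\<in>A. (d n b)\<^sup>2) \<le> (D n)\<^sup>2" if "finite A" "A \<subseteq> Bonds" for A n
  proof -
    have "(D n)\<^sup>2 = infsum (\<lambda>b. (d n b)\<^sup>2) Bonds"
      unfolding D_def Dnorm_def by (simp add: d_def Dif_diff infsum_nonneg)
    then show ?thesis using that finite_sum_le_infsum[OF ds[of n], of A] by simp
  qed
  have Ms: "(\<lambda>b. 2 * (Dif v b)\<^sup>2 + wt b) summable_on Bonds"
    by (intro summable_on_add summable_on_cmult_right W12_summable v wt_summable)
  have MA: "(\<Sum>b\<in>A. 2 * (Dif v b)\<^sup>2 + wt b) \<le> M" if "finite A" "A \<subseteq> Bonds" for A
    unfolding M_def using that by (intro finite_sum_le_infsum Ms) (auto simp: less_imp_le[OF wt_pos])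
  have limD: "D \<longlonglongrightarrow> 0" using lim by (simp add: D_def[abs_def])
  have tF: "(\<lambda>n. \<Sum>b\<in>F. G b (Dif (w n) b)) \<longlonglongrightarrow> (\<Sum>b\<in>F. G b (Dif v b))"
  proof (rule tendsto_sum)
    fix b assume "b \<in> F"
    then have b: "b \<in> Bonds" using F(2) by auto
    have "(\<lambda>n. d n b) \<longlonglongrightarrow> 0"
      by (rule Lim_null_comparison[OF _ limD]) (use dD[OF b] in auto)
    then have "(\<lambda>n. d n b + Dif v b) \<longlonglongrightarrow> 0 + Dif v b" by (intro tendsto_add tendsto_const)
    then have "(\<lambda>n. Dif (w n) b) \<longlonglongrightarrow> Dif v b" by (simp add: d_def)
    then show "(\<lambda>n. G b (Dif (w n) b)) \<longlonglongrightarrow> G b (Dif v b)"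
      by (rule isCont_tendsto_compose[OF isCont_G])
  qed
  have sub: "Bonds - F \<subseteq> Bonds" by auto
  have Gs: "(\<lambda>b. G b (Dif z b)) summable_on (Bonds - F)" if "z \<in> W12" for z
    using summable_on_subset_banach[OF G_summable[OF that] sub] .
  have split: "EE z = (\<Sum>b\<in>F. G b (Dif z b)) + infsum (\<lambda>b. G b (Dif z b)) (Bonds - F)" if "z \<in> W12" for z
  proof -
    have "Bonds = F \<union> (Bonds - F)" using F(2) by auto
    then have "EE z = infsum (\<lambda>b. G b (Dif z b)) (F \<union> (Bonds - F))" by (simp add: EE_def)
    also have "\<dots> = infsum (\<lambda>b. G b (Dif z b)) F + infsum (\<lambda>b. G b (Dif z b)) (Bonds - F)"
      by (rule infsum_Un_disjoint) (use F(1) Gs[OF that] in auto)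
    finally show ?thesis using F(1) by simp
  qed
  have key: "(\<Sum>b\<in>A. \<bar>G b (Dif (w n) b) - G b (Dif v b)\<bar>) \<le> Cg * ((D n)\<^sup>2 + D n + D n * M)"
    if A: "finite A" "A \<subseteq> Bonds - F" and Dn: "D n \<le> 1/16" for A n
  proof (cases "D n = 0")
    case True
    have "(\<Sum>b\<in>A. \<bar>G b (Dif (w n) b) - G b (Dif v b)\<bar>) = 0"
    proof (rule sum.neutral, rule ballI)
      fix b assume "b \<in> A"
      then have "d n b = 0" using dD[of b n] A True by auto
      then show "\<bar>G b (Dif (w n) b) - G b (Dif v b)\<bar> = 0" by (simp add: d_def)
    qed
    then show ?thesis using True by simp
  next
    case False
    then have Dp: "D n > 0" using D0[of n] by simp
    have "(\<Sum>b\<in>A. \<bar>G b (Dif (w n) b) - G b (Dif v b)\<bar>)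
      \<le> (\<Sum>b\<in>A. Cg * ((d n b)\<^sup>2 + (d n b)\<^sup>2 / D n + D n * (2 * (Dif v b)\<^sup>2 + wt b)))"
    proof (rule sum_mono)
      fix b assume "b \<in> A"
      then have b: "b \<in> Bonds - F" "b \<in> Bonds" using A by auto
      let ?a = "\<bar>Dif v b\<bar>" and ?t = "\<bar>Dif (w n) b\<bar>" and ?d = "\<bar>d n b\<bar>"
      have t: "?t \<le> ?a + ?d" by (simp add: d_def)
      have "\<bar>G b (Dif (w n) b) - G b (Dif v b)\<bar> \<le> Cg * (?a + ?t + dl b) * \<bar>Dif (w n) b - Dif v b\<bar>"
        using F(3)[OF b(1)] dD[OF b(2), of n] Dn t b(2) by (intro G_lipschitz) auto
      also have "\<dots> = Cg * ((?a + ?t + dl b) * ?d)" by (simp add: d_def)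
      also have "\<dots> \<le> Cg * ((d n b)\<^sup>2 + (d n b)\<^sup>2 / D n + D n * (2 * (Dif v b)\<^sup>2 + wt b))"
      proof (rule mult_left_mono)
        show "(?a + ?t + dl b) * ?d \<le> (d n b)\<^sup>2 + (d n b)\<^sup>2 / D n + D n * (2 * (Dif v b)\<^sup>2 + wt b)"
          using young_split[OF abs_ge_zero t Dp dl_sq[of b]] by simp
      qed (use Cg_pos in simp)
      finally show "\<bar>G b (Dif (w n) b) - G b (Dif v b)\<bar> \<le> Cg * ((d n b)\<^sup>2 + (d n b)\<^sup>2 / D n + D n * (2 * (Dif v b)\<^sup>2 + wt b))" .
    qed
    also have "\<dots> = Cg * ((\<Sum>b\<in>A. (d n b)\<^sup>2) + (\<Sum>b\<in>A. (d n b)\<^sup>2) / D n + D n * (\<Sum>b\<in>A. 2 * (Dif v b)\<^sup>2 + wt b))"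
      by (simp only: sum_distrib_left[symmetric] sum.distrib sum_divide_distrib[symmetric])
    also have "\<dots> \<le> Cg * ((D n)\<^sup>2 + (D n)\<^sup>2 / D n + D n * M)"
      using Cg_pos Dp A by (intro mult_left_mono add_mono divide_right_mono Dsq MA) auto
    also have "(D n)\<^sup>2 / D n = D n" using Dp by (simp add: power2_eq_square)
    finally show ?thesis .
  qed
  have rest: "(\<lambda>n. infsum (\<lambda>b. G b (Dif (w n) b)) (Bonds - F)) \<longlonglongrightarrow> infsum (\<lambda>b. G b (Dif v b)) (Bonds - F)"
  proof (rule LIM_zero_cancel, rule Lim_null_comparison)
    have "(\<lambda>n. Cg * ((D n)\<^sup>2 + D n + D n * M)) \<longlonglongrightarrow> Cg * (0\<^sup>2 + 0 + 0 * M)"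
      by (intro tendsto_intros limD)
    then show "(\<lambda>n. Cg * ((D n)\<^sup>2 + D n + D n * M)) \<longlonglongrightarrow> 0" by simp
    have "\<forall>\<^sub>F n in sequentially. D n < 1/16" using limD by (rule order_tendstoD) simp
    then show "\<forall>\<^sub>F n in sequentially. norm (infsum (\<lambda>b. G b (Dif (w n) b)) (Bonds - F) - infsum (\<lambda>b. G b (Dif v b)) (Bonds - F))
       \<le> Cg * ((D n)\<^sup>2 + D n + D n * M)"
    proof (rule eventually_mono)
      fix n assume "D n < 1/16"
      then have k: "(\<Sum>b\<in>A. \<bar>G b (Dif (w n) b) - G b (Dif v b)\<bar>) \<le> Cg * ((D n)\<^sup>2 + D n + D n * M)"
        if "finite A" "A \<subseteq> Bonds - F" for A using key[OF that, of n] by simp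
      have neg: "(\<lambda>b. - G b (Dif v b)) summable_on (Bonds - F)"
        using Gs[OF v] by (simp add: summable_on_uminus)
      let ?g = "\<lambda>b. G b (Dif (w n) b) - G b (Dif v b)"
      have s: "?g summable_on (Bonds - F)"
        using summable_on_add[OF Gs[OF w, of n] neg] by simp
      then have sa: "(\<lambda>b. norm (?g b)) summable_on (Bonds - F)"
        by (rule summable_on_iff_abs_summable_on_real[THEN iffD1])
      have "infsum (\<lambda>b. G b (Dif (w n) b)) (Bonds - F) - infsum (\<lambda>b. G b (Dif v b)) (Bonds - F) = infsum ?g (Bonds - F)"
        using infsum_add[OF Gs[OF w, of n] neg] by (simp add: infsum_uminus)
      also have "norm \<dots> \<le> infsum (\<lambda>b. norm (?g b)) (Bonds - F)" by (rule norm_infsum_bound[OF sa])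
      also have "\<dots> \<le> Cg * ((D n)\<^sup>2 + D n + D n * M)"
        by (rule infsum_le_finite_sums[OF sa]) (use k in simp)
      finally show "norm (infsum (\<lambda>b. G b (Dif (w n) b)) (Bonds - F) - infsum (\<lambda>b. G b (Dif v b)) (Bonds - F))
         \<le> Cg * ((D n)\<^sup>2 + D n + D n * M)" .
    qed
  qed
  show ?thesis unfolding split[OF v] split[OF w] by (intro tendsto_add tF rest)
qed

text \<open>Density provides an approximating sequence, without which the defining property of the
  limit would hold vacuously and not determine a value.\<close>

lemma Energy_eq_EE:
  assumes v: "v \<in> W12"
  shows "Energy psi v = EE v"
  unfolding Energy_def
proof (rule the_equality)
  have W: "u \<in> W12" if "u \<in> W0" for u using that by (simp add: W0_iff)
  show *: "\<forall>vs. (\<forall>n. vs n \<in> W0) \<and> (\<lambda>n. Dnorm (\<lambda>x. vs n x - v x)) \<longlonglongrightarrow> 0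
      \<longrightarrow> (\<lambda>n. Energy0 psi (vs n)) \<longlonglongrightarrow> EE v"
  proof (intro allI impI)
    fix vs :: "nat \<Rightarrow> complex \<Rightarrow> real" assume vs: "(\<forall>n. vs n \<in> W0) \<and> (\<lambda>n. Dnorm (\<lambda>x. vs n x - v x)) \<longlonglongrightarrow> 0"
    then have "(\<lambda>n. EE (vs n)) \<longlonglongrightarrow> EE v" using W by (intro EE_continuous v) auto
    then show "(\<lambda>n. Energy0 psi (vs n)) \<longlonglongrightarrow> EE v" using vs by (simp add: EE_W0)
  qed
  fix L assume L: "\<forall>vs. (\<forall>n. vs n \<in> W0) \<and> (\<lambda>n. Dnorm (\<lambda>x. vs n x - v x)) \<longlonglongrightarrow> 0
      \<longrightarrow> (\<lambda>n. Energy0 psi (vs n)) \<longlonglongrightarrow> L"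
  obtain vs where vs: "\<And>n. vs n \<in> W0" "(\<lambda>n. Dnorm (\<lambda>x. vs n x - v x)) \<longlonglongrightarrow> 0"
    using W0_dense[OF v] by blast
  then have "(\<lambda>n. Energy0 psi (vs n)) \<longlonglongrightarrow> L" "(\<lambda>n. Energy0 psi (vs n)) \<longlonglongrightarrow> EE v"
    using L * by blast+
  then show "L = EE v" by (rule LIMSEQ_unique)
qed

end

section \<open>Clusters of charges\<close>

text \<open>Take the largest number of points that stay within some bounded distance of the centre
  for infinitely many indices. Along these indices any larger ball eventually contains no further
  point.\<close>

lemma gap_subsequence:
  fixes Y :: "nat \<Rightarrow> complex set" and p :: "nat \<Rightarrow> complex"
  assumes fin: "\<And>n. finite (Y n)" and card: "\<And>n. card (Y n) \<le> k"
  shows "\<exists>\<sigma> \<rho>. strict_mono (\<sigma> :: nat \<Rightarrow> nat) \<and> \<rho> \<ge> 0 \<and>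
    (\<forall>K. \<forall>\<^sub>F n in sequentially. \<forall>T\<in>Y (\<sigma> n). cmod (T - p (\<sigma> n)) \<le> K \<longrightarrow> cmod (T - p (\<sigma> n)) \<le> \<rho>)"
proof -
  define B where "B n K = {T \<in> Y n. cmod (T - p n) \<le> K}" for n and K :: real
  have fB: "finite (B n K)" for n K using fin by (simp add: B_def)
  define S where "S = {j. \<exists>K\<ge>0. infinite {n. j \<le> card (B n K)}}"
  have cB: "card (B n K) \<le> k" for n K
    using card_mono[OF fin, of "B n K" n] card[of n] by (auto simp: B_def)
  have "S \<subseteq> {..k}"
  proof
    fix j assume "j \<in> S"
    then obtain K where "infinite {n. j \<le> card (B n K)}" by (auto simp: S_def)
    then have "{n. j \<le> card (B n K)} \<noteq> {}" by (metis finite.emptyI)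
    then show "j \<in> {..k}" using cB by (auto intro: order_trans)
  qed
  then have fS: "finite S" by (rule finite_subset) simp
  have "0 \<in> S" by (auto simp: S_def intro: exI[of _ 0])
  then have "Max S \<in> S" using fS by (intro Max_in) auto
  then obtain \<rho> where \<rho>: "\<rho> \<ge> 0" "infinite {n. Max S \<le> card (B n \<rho>)}" by (auto simp: S_def)
  obtain \<sigma> :: "nat \<Rightarrow> nat" where \<sigma>: "strict_mono \<sigma>" "\<And>n. \<sigma> n \<in> {n. Max S \<le> card (B n \<rho>)}"
    using infinite_enumerate[OF \<rho>(2)] by blast
  have "\<forall>\<^sub>F n in sequentially. \<forall>T\<in>Y (\<sigma> n). cmod (T - p (\<sigma> n)) \<le> K \<longrightarrow> cmod (T - p (\<sigma> n)) \<le> \<rho>" for K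
  proof (cases "K \<le> \<rho>")
    case True
    then show ?thesis by (intro always_eventually) auto
  next
    case False
    have "Suc (Max S) \<notin> S" using Max_ge[OF fS, of "Suc (Max S)"] by auto
    then have f: "finite {n. Suc (Max S) \<le> card (B n K)}" using False \<rho>(1) by (auto simp: S_def)
    have "finite (\<sigma> -` {n. Suc (Max S) \<le> card (B n K)})"
      using f strict_mono_imp_inj_on[OF \<sigma>(1)] by (intro finite_vimageI) auto
    then have "\<forall>\<^sub>F n in sequentially. \<sigma> n \<notin> {n. Suc (Max S) \<le> card (B n K)}"
      unfolding eventually_cofinite[symmetric] cofinite_eq_sequentially[symmetric]
      by (simp add: eventually_cofinite vimage_def)
    then show ?thesis
    proof (rule eventually_mono)
      fix n assume "\<sigma> n \<notin> {n. Suc (Max S) \<le> card (B n K)}"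
      then have "card (B (\<sigma> n) K) \<le> card (B (\<sigma> n) \<rho>)" using \<sigma>(2)[of n] by auto
      moreover have "B (\<sigma> n) \<rho> \<subseteq> B (\<sigma> n) K" using False by (auto simp: B_def)
      ultimately have "B (\<sigma> n) \<rho> = B (\<sigma> n) K" using fB by (metis card_seteq)
      then show "\<forall>T\<in>Y (\<sigma> n). cmod (T - p (\<sigma> n)) \<le> K \<longrightarrow> cmod (T - p (\<sigma> n)) \<le> \<rho>"
        by (auto simp: B_def)
    qed
  qed
  then show ?thesis using \<sigma>(1) \<rho>(1) by blast
qed

text \<open>Induction on the number of points: if the cluster around a chosen point does not have
  positive charge infinitely often, deleting it keeps the total at least 1 and lowers the
  cardinality.\<close>

lemma positive_cluster:
  fixes Y :: "nat \<Rightarrow> complex set" and d :: "nat \<Rightarrow> complex \<Rightarrow> real"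
  assumes "\<And>n. finite (Y n)" "\<And>n. card (Y n) \<le> k" "\<And>n T. d n T \<in> \<int>" "\<And>n. (\<Sum>T\<in>Y n. d n T) \<ge> 1"
  shows "\<exists>\<sigma> p \<rho>. strict_mono (\<sigma> :: nat \<Rightarrow> nat) \<and> \<rho> \<ge> 0 \<and> (\<forall>n. p n \<in> Y (\<sigma> n)) \<and>
    (\<forall>\<^sub>F n in sequentially. (\<Sum>T\<in>{T \<in> Y (\<sigma> n). cmod (T - p n) \<le> \<rho>}. d (\<sigma> n) T) \<ge> 1) \<and>
    (\<forall>K. \<forall>\<^sub>F n in sequentially. \<forall>T\<in>Y (\<sigma> n). cmod (T - p n) \<le> K \<longrightarrow> cmod (T - p n) \<le> \<rho>)"
  using assms
proof (induction k arbitrary: Y d)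
  case 0
  have "finite (Y 0)" "card (Y 0) = 0" using 0(1)[of 0] 0(2)[of 0] by auto
  then have "Y 0 = {}" by (metis card_0_eq)
  then show ?case using 0(4)[of 0] by simp
next
  case (Suc k)
  have ne: "Y n \<noteq> {}" for n using Suc.prems(4)[of n] by auto
  define p1 where "p1 n = (SOME T. T \<in> Y n)" for n
  have p1: "p1 n \<in> Y n" for n unfolding p1_def using ne[of n] by (auto intro: someI)
  obtain \<sigma>1 \<rho>1 where s1: "strict_mono (\<sigma>1 :: nat \<Rightarrow> nat)" "\<rho>1 \<ge> 0"
    and gap1: "\<And>K. \<forall>\<^sub>F n in sequentially. \<forall>T\<in>Y (\<sigma>1 n). cmod (T - p1 (\<sigma>1 n)) \<le> K \<longrightarrow> cmod (T - p1 (\<sigma>1 n)) \<le> \<rho>1"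
    using gap_subsequence[of Y "Suc k" p1, OF Suc.prems(1,2)] by blast
  define C where "C n = {T \<in> Y (\<sigma>1 n). cmod (T - p1 (\<sigma>1 n)) \<le> \<rho>1}" for n
  define q where "q n = (\<Sum>T\<in>C n. d (\<sigma>1 n) T)" for n
  show ?case
  proof (cases "infinite {n. q n \<ge> 1}")
    case True
    obtain \<tau> :: "nat \<Rightarrow> nat" where t: "strict_mono \<tau>" "\<And>n. \<tau> n \<in> {n. q n \<ge> 1}"
      using infinite_enumerate[OF True] by blast
    show ?thesis
    proof (intro exI[of _ "\<sigma>1 \<circ> \<tau>"] exI[of _ "\<lambda>n. p1 (\<sigma>1 (\<tau> n))"] exI[of _ \<rho>1] conjI allI)
      show "strict_mono (\<sigma>1 \<circ> \<tau>)" by (rule strict_mono_o[OF s1(1) t(1)])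
      show "\<rho>1 \<ge> 0" by fact
      show "p1 (\<sigma>1 (\<tau> n)) \<in> Y ((\<sigma>1 \<circ> \<tau>) n)" for n using p1 by simp
      show "\<forall>\<^sub>F n in sequentially. 1 \<le> (\<Sum>T | T \<in> Y ((\<sigma>1 \<circ> \<tau>) n) \<and> cmod (T - p1 (\<sigma>1 (\<tau> n))) \<le> \<rho>1. d ((\<sigma>1 \<circ> \<tau>) n) T)"
        using t(2) by (intro always_eventually) (simp add: q_def C_def)
      show "\<forall>\<^sub>F n in sequentially. \<forall>T\<in>Y ((\<sigma>1 \<circ> \<tau>) n). cmod (T - p1 (\<sigma>1 (\<tau> n))) \<le> K \<longrightarrow> cmod (T - p1 (\<sigma>1 (\<tau> n))) \<le> \<rho>1" for K
        using eventually_subseq[OF t(1) gap1[of K]] by simp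
    qed
  next
    case False
    then obtain n0 where n0: "\<And>n. n \<ge> n0 \<Longrightarrow> \<not> q n \<ge> 1"
      unfolding infinite_nat_iff_unbounded_le by auto
    define \<sigma>2 where "\<sigma>2 n = \<sigma>1 (n + n0)" for n
    have s2: "strict_mono \<sigma>2" using s1(1) by (auto simp: \<sigma>2_def strict_mono_def)
    define Y' where "Y' n = Y (\<sigma>2 n) - C (n + n0)" for n
    have Cs: "C (n + n0) \<subseteq> Y (\<sigma>2 n)" for n by (auto simp: C_def \<sigma>2_def)
    have p1C: "p1 (\<sigma>2 n) \<in> C (n + n0)" for n using p1 s1(2) by (auto simp: C_def \<sigma>2_def)
    have q0: "q (n + n0) \<le> 0" for n
    proof -
      have "q (n + n0) \<in> \<int>" unfolding q_def by (intro Ints_sum Suc.prems(3))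
      then obtain z :: int where z: "q (n + n0) = of_int z" by (rule Ints_cases)
      moreover have "\<not> q (n + n0) \<ge> 1" using n0[of "n + n0"] by simp
      ultimately show ?thesis by simp
    qed
    have "\<exists>\<sigma> p \<rho>. strict_mono (\<sigma> :: nat \<Rightarrow> nat) \<and> \<rho> \<ge> 0 \<and> (\<forall>n. p n \<in> Y' (\<sigma> n)) \<and>
      (\<forall>\<^sub>F n in sequentially. (\<Sum>T\<in>{T \<in> Y' (\<sigma> n). cmod (T - p n) \<le> \<rho>}. d (\<sigma>2 (\<sigma> n)) T) \<ge> 1) \<and>
      (\<forall>K. \<forall>\<^sub>F n in sequentially. \<forall>T\<in>Y' (\<sigma> n). cmod (T - p n) \<le> K \<longrightarrow> cmod (T - p n) \<le> \<rho>)"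
    proof (rule Suc.IH)
      fix n
      show "finite (Y' n)" using Suc.prems(1) by (simp add: Y'_def)
      have "Y' n \<subset> Y (\<sigma>2 n)" using p1C[of n] Cs[of n] by (auto simp: Y'_def)
      then have "card (Y' n) < card (Y (\<sigma>2 n))" using Suc.prems(1) by (intro psubset_card_mono)
      then show "card (Y' n) \<le> k" using Suc.prems(2)[of "\<sigma>2 n"] by simp
      show "d (\<sigma>2 n) T \<in> \<int>" for T by (rule Suc.prems(3))
      have "(\<Sum>T\<in>Y' n. d (\<sigma>2 n) T) = (\<Sum>T\<in>Y (\<sigma>2 n). d (\<sigma>2 n) T) - q (n + n0)"
        unfolding Y'_def q_def using sum_diff[OF Suc.prems(1) Cs] by (simp add: \<sigma>2_def)
      then show "(\<Sum>T\<in>Y' n. d (\<sigma>2 n) T) \<ge> 1" using q0[of n] Suc.prems(4)[of "\<sigma>2 n"] by linarith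
    qed
    then obtain \<sigma>3 p \<rho> where s3: "strict_mono (\<sigma>3 :: nat \<Rightarrow> nat)" "\<rho> \<ge> 0" and p: "\<And>n. p n \<in> Y' (\<sigma>3 n)"
      and big: "\<forall>\<^sub>F n in sequentially. (\<Sum>T\<in>{T \<in> Y' (\<sigma>3 n). cmod (T - p n) \<le> \<rho>}. d (\<sigma>2 (\<sigma>3 n)) T) \<ge> 1"
      and gap: "\<And>K. \<forall>\<^sub>F n in sequentially. \<forall>T\<in>Y' (\<sigma>3 n). cmod (T - p n) \<le> K \<longrightarrow> cmod (T - p n) \<le> \<rho>"
      by blast
    \<comment> \<open>The deleted cluster is separated by unbounded gaps from every remaining point,
      so it does not disturb the cluster found among them.\<close>
    have far: "\<forall>\<^sub>F n in sequentially. \<forall>T\<in>C (\<sigma>3 n + n0). cmod (T - p n) > K" for K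
    proof -
      have m: "strict_mono (\<lambda>n. \<sigma>3 n + n0)" using s3(1) by (auto simp: strict_mono_def)
      have "\<forall>\<^sub>F n in sequentially. \<forall>T\<in>Y (\<sigma>1 (\<sigma>3 n + n0)). cmod (T - p1 (\<sigma>1 (\<sigma>3 n + n0))) \<le> K + \<rho>1
         \<longrightarrow> cmod (T - p1 (\<sigma>1 (\<sigma>3 n + n0))) \<le> \<rho>1"
        using eventually_subseq[OF m gap1[of "K + \<rho>1"]] .
      then show ?thesis
      proof (rule eventually_mono, intro ballI)
        fix n T
        assume g: "\<forall>T\<in>Y (\<sigma>1 (\<sigma>3 n + n0)). cmod (T - p1 (\<sigma>1 (\<sigma>3 n + n0))) \<le> K + \<rho>1
         \<longrightarrow> cmod (T - p1 (\<sigma>1 (\<sigma>3 n + n0))) \<le> \<rho>1" and T: "T \<in> C (\<sigma>3 n + n0)"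
        let ?c = "p1 (\<sigma>1 (\<sigma>3 n + n0))"
        have "p n \<in> Y (\<sigma>1 (\<sigma>3 n + n0))" "p n \<notin> C (\<sigma>3 n + n0)" using p[of n] by (auto simp: Y'_def \<sigma>2_def)
        then have "cmod (p n - ?c) > K + \<rho>1" using g by (force simp: C_def)
        moreover have "cmod (T - ?c) \<le> \<rho>1" using T by (simp add: C_def)
        ultimately show "cmod (T - p n) > K"
          using norm_triangle_ineq[of "p n - T" "T - ?c"] by (simp add: norm_minus_commute)
      qed
    qed
    have Ysplit: "Y ((\<sigma>2 \<circ> \<sigma>3) n) = Y' (\<sigma>3 n) \<union> C (\<sigma>3 n + n0)" for n
      using Cs[of "\<sigma>3 n"] by (auto simp: Y'_def)
    show ?thesis
    proof (intro exI[of _ "\<sigma>2 \<circ> \<sigma>3"] exI[of _ p] exI[of _ \<rho>] conjI allI)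
      show "strict_mono (\<sigma>2 \<circ> \<sigma>3)" by (rule strict_mono_o[OF s2 s3(1)])
      show "\<rho> \<ge> 0" by fact
      show "p n \<in> Y ((\<sigma>2 \<circ> \<sigma>3) n)" for n using p[of n] by (auto simp: Y'_def)
      show "\<forall>\<^sub>F n in sequentially. (\<Sum>T\<in>{T \<in> Y ((\<sigma>2 \<circ> \<sigma>3) n). cmod (T - p n) \<le> \<rho>}. d ((\<sigma>2 \<circ> \<sigma>3) n) T) \<ge> 1"
        using eventually_conj[OF big far[of \<rho>]]
      proof (rule eventually_mono)
        fix n assume A: "1 \<le> (\<Sum>T\<in>{T \<in> Y' (\<sigma>3 n). cmod (T - p n) \<le> \<rho>}. d (\<sigma>2 (\<sigma>3 n)) T) \<and>
           (\<forall>T\<in>C (\<sigma>3 n + n0). cmod (T - p n) > \<rho>)"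
        then have "{T \<in> Y ((\<sigma>2 \<circ> \<sigma>3) n). cmod (T - p n) \<le> \<rho>} = {T \<in> Y' (\<sigma>3 n). cmod (T - p n) \<le> \<rho>}"
          unfolding Ysplit by force
        then show "(\<Sum>T\<in>{T \<in> Y ((\<sigma>2 \<circ> \<sigma>3) n). cmod (T - p n) \<le> \<rho>}. d ((\<sigma>2 \<circ> \<sigma>3) n) T) \<ge> 1" using A by simp
      qed
      show "\<forall>\<^sub>F n in sequentially. \<forall>T\<in>Y ((\<sigma>2 \<circ> \<sigma>3) n). cmod (T - p n) \<le> K \<longrightarrow> cmod (T - p n) \<le> \<rho>" for K
        using eventually_conj[OF gap[of K] far[of K]]
        by (rule eventually_mono) (unfold Ysplit, force)
    qed
  qed
qed

lemma Ints_limit: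
  fixes x :: "nat \<Rightarrow> real"
  assumes "x \<longlonglongrightarrow> l" "\<And>n. x n \<in> \<int>"
  shows "l \<in> \<int>" "\<forall>\<^sub>F n in sequentially. x n = l"
proof -
  have "closed (\<int> :: real set)" by (rule closed_Ints)
  then show l: "l \<in> \<int>" using assms by (meson closed_sequentially)
  have "\<forall>\<^sub>F n in sequentially. dist (x n) l < 1" using assms(1) by (rule tendstoD) simp
  then show "\<forall>\<^sub>F n in sequentially. x n = l"
  proof (rule eventually_mono)
    fix n assume "dist (x n) l < 1"
    then have "x n - l = 0" using assms(2) l by (intro Ints_abs_less_1 Ints_diff) (auto simp: dist_real_def)
    then show "x n = l" by simp
  qed
qed

lemma curl_tr:
  assumes "p \<in> Lam"
  shows "curl (\<lambda>b. \<beta> (tr p b)) T = curl \<beta> (T + p)"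
  unfolding curl_def
proof (rule sum.reindex_bij_witness[where i = "tr (- p)" and j = "tr p"])
  show "tr (- p) (tr p b) = b" "tr p (tr (- p) b) = b" for b by simp_all
  show "tr p b \<in> {b \<in> Bonds. Lc b = T + p}" if "b \<in> {b \<in> Bonds. Lc b = T}" for b
    using that tr_Bonds[OF assms] by simp
  show "tr (- p) b \<in> {b \<in> Bonds. Lc b = T}" if "b \<in> {b \<in> Bonds. Lc b = T + p}" for b
    using that tr_Bonds[OF Lam_minus[OF assms]] by simp
qed simp

text \<open>Cauchy-Schwarz over three edges. A nonzero integer charge thus costs strain energy at
  least 1/3 in its own triangle: the fixed core energy.\<close>

lemma fibre_energy:
  assumes "T \<in> Tri"
  shows "(curl \<alpha> T)\<^sup>2 \<le> 3 * (\<Sum>b\<in>{b \<in> Bonds. Lc b = T}. (\<alpha> b)\<^sup>2)"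
proof -
  obtain b where b: "b \<in> Bonds" "T = Lc b" using assms by (auto simp: Tri_def)
  have "(x + y + z)\<^sup>2 \<le> 3 * (x\<^sup>2 + y\<^sup>2 + z\<^sup>2)" for x y z :: real
    using zero_le_power2[of "x - y"] zero_le_power2[of "y - z"] zero_le_power2[of "x - z"]
    by (simp add: power2_eq_square algebra_simps)
  then show ?thesis
    using curl_eq[OF b(1), of \<alpha>] curl_eq[OF b(1), of "\<lambda>b. (\<alpha> b)\<^sup>2"] unfolding b(2) by (simp add: curl_def)
qed

definition prj :: "complex \<Rightarrow> complex" where "prj z = (SOME p. p \<in> Lam \<and> cmod (z - p) \<le> 1)"

lemma prj: "prj z \<in> Lam" "cmod (z - prj z) \<le> 1"
proof -
  have "\<exists>p. p \<in> Lam \<and> cmod (z - p) \<le> 1" using Lam_near[of z] by blast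
  from someI_ex[OF this] show "prj z \<in> Lam" "cmod (z - prj z) \<le> 1" unfolding prj_def by auto
qed

context potential
begin

text \<open>N charges have core energy at least \<open>mu * N / 6\<close>, as different triangles
  have disjoint oriented edges. For \<open>r0\<close> large the growth losses are at most
  \<open>mu * N / 12\<close>, so the remaining linear term beats
  \<open>mu * c0 * ln N\<close>.\<close>

lemma charge_count_bound:
  "\<exists>(N0::nat) C. \<forall>u\<in>W0. Energy0 psi u \<ge> C \<and> (Energy0 psi u \<le> 1 \<longrightarrow> card (charges u) \<le> N0)"
proof -
  have "((\<lambda>r. err r + 2 * c0 / r) \<longlongrightarrow> 0 + 0) at_top"
    by (intro tendsto_add err_tendsto) real_asymp
  then have "\<forall>\<^sub>F r in at_top. err r + 2 * c0 / r < 1/6" by (intro order_tendstoD) auto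
  then have "\<forall>\<^sub>F r in at_top. err r + 2 * c0 / r < 1/6 \<and> r \<ge> 2"
    by (intro eventually_conj eventually_ge_at_top)
  then obtain r0 where r0: "err r0 + 2 * c0 / r0 < 1/6" "r0 \<ge> 2"
    by (metis (no_types, lifting) eventually_happens trivial_limit_at_top_linorder)
  define C2 where "C2 = Sh rho1 - mu * c0 * ln rho1 + errp rho1 + mu * c0 * ln r0"
  have low: "mu / 12 * real (card (charges u)) - mu * c0 * ln (real (card (charges u))) - C2 \<le> Energy0 psi u"
    "card (charges u) \<ge> 1" if u: "u \<in> W0" for u
  proof -
    let ?X = "charges u" and ?U = "\<Union>T\<in>charges u. Bd (prj T) r0"
    note X = charges_W0[OF u]
    have "?X \<noteq> {}" using X(2) by auto
    then show N1: "card ?X \<ge> 1" using X(1) by (simp add: Suc_leI card_gt_0_iff)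
    have pr: "cmod (T - prj T) \<le> r0" for T using prj(2)[of T] r0(2) by linarith
    have E: "(\<Sum>b\<in>?U. psi (al u b)) - mu * c0 * ln (\<Sum>T\<in>?X. r0) - mu / 2 * (card ?X * (err r0 + 2 * c0 / r0))
        - Sh rho1 + mu * c0 * ln rho1 - errp rho1 \<le> Energy0 psi u"
      by (rule energy_lower_bound[OF u r0(2) order_refl X(1), where g = "\<lambda>T. T"])
         (use prj(1) pr in auto)
    have "mu / 2 * (card ?X / 3) \<le> (\<Sum>b\<in>?U. psi (al u b))"
    proof -
      have "card ?X / 3 = (\<Sum>T\<in>?X. 1/3)" by simp
      also have "\<dots> \<le> (\<Sum>T\<in>?X. \<Sum>b\<in>{b \<in> Bonds. Lc b = T}. (al u b)\<^sup>2)"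
      proof (rule sum_mono)
        fix T assume T: "T \<in> ?X"
        then have "T \<in> Tri" "curl (al u) T \<noteq> 0" by (auto simp: charges_def)
        then have "\<bar>curl (al u) T\<bar> \<ge> 1" using Ints_abs_less_1[OF curl_strain_Ints] by force
        then have "(curl (al u) T)\<^sup>2 \<ge> 1" using power_mono[of 1 "\<bar>curl (al u) T\<bar>" 2] by simp
        then show "1/3 \<le> (\<Sum>b\<in>{b \<in> Bonds. Lc b = T}. (al u b)\<^sup>2)"
          using fibre_energy[OF \<open>T \<in> Tri\<close>, of "al u"] by linarith
      qed
      also have "\<dots> = (\<Sum>b\<in>(\<Union>T\<in>?X. {b \<in> Bonds. Lc b = T}). (al u b)\<^sup>2)"
        by (rule sum.UNION_disjoint[symmetric]) (use X(1) finite_fibre in auto)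
      also have "\<dots> \<le> (\<Sum>b\<in>?U. (al u b)\<^sup>2)"
      proof (rule sum_mono2)
        show "finite ?U" using X(1) by simp
        show "(\<Union>T\<in>?X. {b \<in> Bonds. Lc b = T}) \<subseteq> ?U"
        proof
          fix b assume "b \<in> (\<Union>T\<in>?X. {b \<in> Bonds. Lc b = T})"
          then have b: "b \<in> Bonds" "Lc b \<in> ?X" by auto
          have "cmod (md b - prj (Lc b)) \<le> r0"
            using Lc_md[OF b(1)] prj(2)[of "Lc b"] r0(2)
              norm_triangle_ineq[of "md b - Lc b" "Lc b - prj (Lc b)"] by (simp add: norm_minus_commute)
          then show "b \<in> ?U" using b by (auto simp: Bd_def)
        qed
      qed simp
      finally have "mu / 2 * (card ?X / 3) \<le> mu / 2 * (\<Sum>b\<in>?U. (al u b)\<^sup>2)"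
        using mu_pos by (intro mult_left_mono) auto
      also have "\<dots> \<le> (\<Sum>b\<in>?U. psi (al u b))"
        unfolding sum_distrib_left by (intro sum_mono psi_al_lower)
      finally show ?thesis .
    qed
    have "mu / 2 * (card ?X * (err r0 + 2 * c0 / r0)) \<le> mu / 2 * (card ?X * (1/6))"
      using r0 mu_pos by (intro mult_left_mono) auto
    have "mu * c0 * ln (\<Sum>T\<in>?X. r0) = mu * c0 * ln (real (card ?X)) + mu * c0 * ln r0"
      using N1 r0 by (simp add: ln_mult algebra_simps)
    show "mu / 12 * real (card ?X) - mu * c0 * ln (real (card ?X)) - C2 \<le> Energy0 psi u"
    proof -
      have "mu / 2 * (card ?X / 3) = 2 * (mu / 12 * real (card ?X))"
        "mu / 2 * (card ?X * (1/6)) = mu / 12 * real (card ?X)" by simp_all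
      then show ?thesis
        using E \<open>mu / 2 * (card ?X / 3) \<le> _\<close> \<open>mu / 2 * (card ?X * (err r0 + 2 * c0 / r0)) \<le> _\<close>
          \<open>mu * c0 * ln (\<Sum>T\<in>?X. r0) = _\<close> unfolding C2_def by linarith
    qed
  qed
  have "filterlim (\<lambda>x::real. mu / 12 * x - mu * c0 * ln x) at_top at_top"
  proof -
    have *: "filterlim (\<lambda>x::real. A * x - B * ln x) at_top at_top" if "A > 0" "B > 0" for A B :: real
      using that by real_asymp
    show ?thesis by (rule *) (use mu_pos c0_pos in auto)
  qed
  then have "\<forall>\<^sub>F x in at_top. mu / 12 * x - mu * c0 * ln x \<ge> C2 + 2" by (simp add: filterlim_at_top)
  then obtain x0 where x0: "\<And>x. x \<ge> x0 \<Longrightarrow> mu / 12 * x - mu * c0 * ln x \<ge> C2 + 2"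
    unfolding eventually_at_top_linorder by blast
  obtain N0 :: nat where N0: "real N0 \<ge> max 1 x0" using real_arch_simple by blast
  define C where "C = min 2 (- mu * c0 * ln (real N0) - C2)"
  have "Energy0 psi u \<ge> C \<and> (Energy0 psi u \<le> 1 \<longrightarrow> card (charges u) \<le> N0)" if u: "u \<in> W0" for u
  proof (cases "card (charges u) \<ge> N0")
    case True
    then have "real (card (charges u)) \<ge> x0" using N0 by linarith
    from x0[OF this] have "Energy0 psi u \<ge> 2" using low(1)[OF u] by linarith
    then show ?thesis by (simp add: C_def)
  next
    case False
    have "mu * c0 * ln (real (card (charges u))) \<le> mu * c0 * ln (real N0)"
      using False low(2)[OF u] mu_pos c0_pos by (intro mult_left_mono ln_mono) auto
    moreover have "0 \<le> mu / 12 * real (card (charges u))" using mu_pos by simp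
    ultimately have "Energy0 psi u \<ge> - mu * c0 * ln (real N0) - C2" using low(1)[OF u] by simp
    then show ?thesis using False by (simp add: C_def)
  qed
  then show ?thesis by blast
qed

text \<open>The radius \<open>sqrt \<rho>\<close> for distant charges tends to infinity, so
  \<open>err\<close> vanishes, yet is small against \<open>\<rho>\<close>, so that \<open>N\<close>
  such balls hardly enlarge the total radius.\<close>

definition e6 :: "nat \<Rightarrow> real \<Rightarrow> real" where
  "e6 N \<rho> = mu * c0 * ln (1 + N / sqrt \<rho>) + mu / 2 * (real (N + 1) * (err (sqrt \<rho>) + 2 * c0 / sqrt \<rho>)) + errp \<rho>"

lemma e6_tendsto: "(e6 N \<longlongrightarrow> 0) at_top"
proof -
  have s: "filterlim (sqrt :: real \<Rightarrow> real) at_top at_top" by (rule sqrt_at_top)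
  have 1: "((\<lambda>\<rho>. err (sqrt \<rho>)) \<longlongrightarrow> 0) at_top" by (rule filterlim_compose[OF err_tendsto s])
  have 2: "((\<lambda>\<rho>. ln (1 + real N / sqrt \<rho>)) \<longlongrightarrow> 0) at_top" by real_asymp
  have 3: "((\<lambda>\<rho>. 2 * c0 / sqrt \<rho>) \<longlongrightarrow> 0) at_top" by real_asymp
  have "((\<lambda>\<rho>. mu * c0 * ln (1 + N / sqrt \<rho>) + mu / 2 * ((N + 1) * (err (sqrt \<rho>) + 2 * c0 / sqrt \<rho>))
      + (mu / 2 * err \<rho> + Kp * K0 ^ 3 * ee \<rho>))
     \<longlongrightarrow> mu * c0 * 0 + mu / 2 * (real (N + 1) * (0 + 0)) + (mu / 2 * 0 + Kp * K0 ^ 3 * 0)) at_top"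
    by (intro tendsto_intros 1 2 3 err_tendsto ee_tendsto)
  then show ?thesis by (simp add: e6_def[abs_def] errp_def add.commute[of 1])
qed

text \<open>Ball growth starts from the large ball around \<open>p\<close> and one small ball for
  each charge outside it. The centre \<open>p\<close> is arbitrary, while \<open>Sh\<close> stays
  centred at the origin; this makes recentring possible.\<close>

lemma local_lower_bound:
  assumes u: "u \<in> W0" and N: "card (charges u) \<le> N" and p: "p \<in> Lam" and \<rho>: "rho1 \<le> \<rho>" "4 \<le> \<rho>"
  shows "(\<Sum>b\<in>Bd p \<rho>. psi (al u b)) - Sh \<rho> - e6 N \<rho> \<le> Energy0 psi u"
proof -
  define Y where "Y = {T \<in> charges u. cmod (T - p) > \<rho>}"
  \<comment> \<open>\<open>None\<close> indexes the large ball, \<open>Some T\<close> the small ball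
    around an outside charge.\<close>
  define J where "J = insert None (Some ` Y)"
  define P where "P j = (case j of None \<Rightarrow> p | Some T \<Rightarrow> prj T)" for j
  define r where "r j = (case j of None \<Rightarrow> \<rho> | Some (T::complex) \<Rightarrow> sqrt \<rho>)" for j
  define g where "g T = (if cmod (T - p) \<le> \<rho> then None else Some T)" for T
  have s: "2 \<le> sqrt \<rho>" using \<rho>(2) by (intro real_le_rsqrt) auto
  have "sqrt \<rho> * 1 \<le> sqrt \<rho> * sqrt \<rho>" using s \<rho>(2) by (intro mult_left_mono) auto
  then have s2: "sqrt \<rho> \<le> \<rho>" using \<rho>(2) by simp
  have fY: "finite Y" using charges_W0(1)[OF u] by (simp add: Y_def)
  have cY: "card Y \<le> N" using N card_mono[OF charges_W0(1)[OF u], of Y] by (auto simp: Y_def)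
  have cJ: "card J = card Y + 1" unfolding J_def using fY by (simp add: card_image)
  have sr: "(\<Sum>j\<in>J. r j) = \<rho> + card Y * sqrt \<rho>"
    unfolding J_def using fY by (simp add: sum.reindex r_def)
  have E: "(\<Sum>b\<in>(\<Union>j\<in>J. Bd (P j) (r j)). psi (al u b)) - mu * c0 * ln (\<Sum>j\<in>J. r j)
    - mu / 2 * (card J * (err (sqrt \<rho>) + 2 * c0 / sqrt \<rho>)) - Sh \<rho> + mu * c0 * ln \<rho> - errp \<rho> \<le> Energy0 psi u"
  proof (rule energy_lower_bound[OF u s \<rho>(1), where g = g])
    show "finite J" using fY by (simp add: J_def)
    show "P j \<in> Lam" if "j \<in> J" for j using p prj(1) by (auto simp: P_def split: option.splits)
    show "sqrt \<rho> \<le> r j" if "j \<in> J" for j using s2 by (auto simp: r_def split: option.splits)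
    show "g T \<in> J" if "T \<in> charges u" for T using that by (auto simp: g_def J_def Y_def)
    show "cmod (T - P (g T)) \<le> r (g T)" if "T \<in> charges u" for T
      using prj(2)[of T] s by (auto simp: g_def P_def r_def)
  qed
  have sub: "(\<Sum>b\<in>Bd p \<rho>. psi (al u b)) \<le> (\<Sum>b\<in>(\<Union>j\<in>J. Bd (P j) (r j)). psi (al u b))"
    using fY by (intro sum_mono2) (auto simp: J_def P_def r_def psi_nonneg)
  have "(\<Sum>j\<in>J. r j) \<le> \<rho> * (1 + N / sqrt \<rho>)"
  proof -
    have "real (card Y) * sqrt \<rho> \<le> N * sqrt \<rho>" using cY \<rho> by (intro mult_right_mono) auto
    moreover have "\<rho> * (1 + N / sqrt \<rho>) = \<rho> + N * sqrt \<rho>"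
    proof -
      have "\<rho> / sqrt \<rho> = sqrt \<rho>" using \<rho>(2) by (simp add: real_div_sqrt)
      then show ?thesis by (simp add: algebra_simps) (metis mult.commute times_divide_eq_right)
    qed
    ultimately show ?thesis using sr by simp
  qed
  moreover have "(\<Sum>j\<in>J. r j) > 0" unfolding sr using \<rho> by (intro add_pos_nonneg) auto
  ultimately have "ln (\<Sum>j\<in>J. r j) \<le> ln (\<rho> * (1 + N / sqrt \<rho>))" by (intro ln_mono) auto
  also have "\<dots> = ln \<rho> + ln (1 + N / sqrt \<rho>)"
  proof -
    have "0 < 1 + N / sqrt \<rho>" using s by (intro add_pos_nonneg divide_nonneg_nonneg) linarith+
    then show ?thesis using \<rho>(2) by (intro ln_mult_pos) auto
  qed
  finally have "mu * c0 * ln (\<Sum>j\<in>J. r j) \<le> mu * c0 * (ln \<rho> + ln (1 + N / sqrt \<rho>))"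
    using mu_pos c0_pos by (intro mult_left_mono) auto
  then have l: "mu * c0 * ln (\<Sum>j\<in>J. r j) \<le> mu * c0 * ln \<rho> + mu * c0 * ln (1 + N / sqrt \<rho>)"
    by (simp add: algebra_simps)
  have "mu / 2 * (card J * (err (sqrt \<rho>) + 2 * c0 / sqrt \<rho>)) \<le> mu / 2 * ((N + 1) * (err (sqrt \<rho>) + 2 * c0 / sqrt \<rho>))"
  proof (intro mult_left_mono mult_right_mono)
    show "real (card J) \<le> real (N + 1)" using cJ cY by simp
    show "0 \<le> err (sqrt \<rho>) + 2 * c0 / sqrt \<rho>" using err_nonneg[of "sqrt \<rho>"] \<rho>(2) c0_pos by simp
  qed (use mu_pos in simp)
  then show ?thesis using E sub l unfolding e6_def by linarith
qed

end

section \<open>Existence of a minimiser\<close>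

lemma shell_ff_tendsto: "((\<lambda>R. \<Sum>b\<in>Bd 0 R - Bd 0 (R - 2). (ff b)\<^sup>2) \<longlongrightarrow> 0) at_top"
proof (rule tendsto_sandwich)
  show "\<forall>\<^sub>F R in at_top. 0 \<le> (\<Sum>b\<in>Bd 0 R - Bd 0 (R - 2). (ff b)\<^sup>2)"
    by (intro always_eventually allI sum_nonneg) auto
  have "(\<Sum>b\<in>Bd 0 R - Bd 0 (R - 2). (ff b)\<^sup>2) \<le> 2 / c0 * (ln (R / (R - 2)) + 3 / (R - 2)) + K0\<^sup>2 / c0 * ee (R - 2 - 2)"
    if "R \<ge> 4" for R using that by (intro ff_energy_upper) auto
  then show "\<forall>\<^sub>F R in at_top. (\<Sum>b\<in>Bd 0 R - Bd 0 (R - 2). (ff b)\<^sup>2)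
      \<le> 2 / c0 * (ln (R / (R - 2)) + 3 / (R - 2)) + K0\<^sup>2 / c0 * ee (R - 2 - 2)"
    unfolding eventually_at_top_linorder by blast
  have 1: "((\<lambda>R::real. ln (R / (R - 2)) + 3 / (R - 2)) \<longlongrightarrow> 0) at_top" by real_asymp
  have "filterlim (\<lambda>R::real. R - 2 - 2) at_top at_top" by real_asymp
  then have 2: "((\<lambda>R. ee (R - 2 - 2)) \<longlongrightarrow> 0) at_top" by (rule filterlim_compose[OF ee_tendsto])
  have "((\<lambda>R. 2 / c0 * (ln (R / (R - 2)) + 3 / (R - 2)) + K0\<^sup>2 / c0 * ee (R - 2 - 2)) \<longlongrightarrow> 2 / c0 * 0 + K0\<^sup>2 / c0 * 0) at_top"
    by (intro tendsto_add tendsto_mult_left 1 2)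
  then show "((\<lambda>R. 2 / c0 * (ln (R / (R - 2)) + 3 / (R - 2)) + K0\<^sup>2 / c0 * ee (R - 2 - 2)) \<longlongrightarrow> 0) at_top" by simp
qed simp

section \<open>The pointwise limit of recentred strains\<close>

context potential
begin

text \<open>A charge of at least 2 forces energy \<open>4 * mu * c0 * ln s\<close> in the ball of
  radius \<open>s\<close>, whereas the hypothesis allows only \<open>mu * c0 * ln s\<close> up to
  bounded terms; the excess of three logarithms is unbounded.\<close>

lemma limit_charge:
  assumes al: "alternating \<alpha>" and half: "\<And>b. b \<in> Bonds \<Longrightarrow> \<bar>\<alpha> b\<bar> \<le> 1/2" and int: "\<And>T. curl \<alpha> T \<in> \<int>"
    and supp: "\<And>T. curl \<alpha> T \<noteq> 0 \<Longrightarrow> cmod T \<le> \<rho>2" and \<rho>2: "0 \<le> \<rho>2"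
    and pos: "1 \<le> (\<Sum>T\<in>Tr 0 \<rho>2. curl \<alpha> T)"
    and en: "\<And>\<rho>. rho1 \<le> \<rho> \<Longrightarrow> 4 \<le> \<rho> \<Longrightarrow> (\<Sum>b\<in>Bd 0 \<rho>. psi (\<alpha> b)) \<le> Sh \<rho> + m + e6 N \<rho>"
  shows "(\<Sum>T\<in>Tr 0 \<rho>2. curl \<alpha> T) = 1"
proof (rule ccontr)
  assume n1: "(\<Sum>T\<in>Tr 0 \<rho>2. curl \<alpha> T) \<noteq> 1"
  have "(\<Sum>T\<in>Tr 0 \<rho>2. curl \<alpha> T) \<in> \<int>" by (intro Ints_sum int)
  then obtain z :: int where z: "(\<Sum>T\<in>Tr 0 \<rho>2. curl \<alpha> T) = of_int z" by (rule Ints_cases)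
  then have "z \<ge> 2" using pos n1 by linarith
  define r where "r = max \<rho>2 2"
  have "(\<Sum>T\<in>Tr 0 r. curl \<alpha> T) = (\<Sum>T\<in>Tr 0 \<rho>2. curl \<alpha> T)"
  proof (rule sum.mono_neutral_right[OF finite_Tr])
    show "\<forall>T\<in>Tr 0 r - Tr 0 \<rho>2. curl \<alpha> T = 0"
    proof
      fix T assume "T \<in> Tr 0 r - Tr 0 \<rho>2"
      then have "\<not> cmod T \<le> \<rho>2" by (auto simp: Tr_def)
      then show "curl \<alpha> T = 0" using supp by blast
    qed
  qed (auto simp: Tr_def r_def)
  then have q: "2 \<le> \<bar>\<Sum>T\<in>Tr 0 r. curl \<alpha> T\<bar>" using z \<open>z \<ge> 2\<close> by simp
  define C where "C = Sh rho1 - mu * c0 * ln rho1 + errp rho1 + m + 4 * mu * c0 * ln r + 2 * mu * err r"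
  have ineq: "3 * (mu * c0 * ln s) - e6 N s \<le> C" if s: "s \<ge> max r (max rho1 4)" for s
  proof -
    have s': "r \<le> s" "rho1 \<le> s" "4 \<le> s" "r \<ge> 2" using s by (auto simp: r_def)
    have "2\<^sup>2 * (2 * c0 * ln (s / r) - err r) \<le> (\<Sum>b\<in>Bd 0 s - Bd 0 r. (\<alpha> b)\<^sup>2)"
    proof (rule annulus_lower_bound[OF al Lam_0 s'(4,1) _ _ q])
      fix T assume "r < cmod (T - 0)"
      then have "\<not> cmod T \<le> \<rho>2" by (auto simp: r_def)
      then show "curl \<alpha> T = 0" using supp by blast
    qed simp
    also have "\<dots> \<le> (\<Sum>b\<in>Bd 0 s. (\<alpha> b)\<^sup>2)" by (intro sum_mono2) auto
    finally have "mu / 2 * (2\<^sup>2 * (2 * c0 * ln (s / r) - err r)) \<le> mu / 2 * (\<Sum>b\<in>Bd 0 s. (\<alpha> b)\<^sup>2)"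
      using mu_pos by (intro mult_left_mono) auto
    also have "\<dots> \<le> (\<Sum>b\<in>Bd 0 s. psi (\<alpha> b))"
      unfolding sum_distrib_left by (intro sum_mono psi_lower half) (auto simp: Bd_def)
    also have "\<dots> \<le> Sh s + m + e6 N s" by (rule en[OF s'(2,3)])
    also have "\<dots> \<le> Sh rho1 + mu * c0 * ln (s / rho1) + errp rho1 + m + e6 N s"
      using Sh_upper[OF order_refl s'(2)] by linarith
    finally have 1: "mu / 2 * (2\<^sup>2 * (2 * c0 * ln (s / r) - err r)) \<le> Sh rho1 + mu * c0 * ln (s / rho1) + errp rho1 + m + e6 N s" .
    have 2: "mu / 2 * (2\<^sup>2 * (2 * c0 * ln (s / r) - err r)) = 4 * (mu * c0 * ln s) - 4 * mu * c0 * ln r - 2 * mu * err r"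
      using s' by (simp add: ln_div algebra_simps)
    have 3: "mu * c0 * ln (s / rho1) = mu * c0 * ln s - mu * c0 * ln rho1"
      using s' rho1 by (simp add: ln_div algebra_simps)
    show ?thesis using 1 unfolding 2 3 C_def by linarith
  qed
  have "\<forall>\<^sub>F s in at_top. e6 N s < 1" using e6_tendsto by (rule order_tendstoD) simp
  moreover have "\<forall>\<^sub>F s in at_top. ln s > (C + 1) / (3 * (mu * c0))"
    using filterlim_at_top_dense[THEN iffD1, OF ln_at_top] by blast
  moreover have "\<forall>\<^sub>F s in at_top. s \<ge> max r (max rho1 4)" by (rule eventually_ge_at_top)
  ultimately have "\<forall>\<^sub>F s::real in at_top. False"
  proof eventually_elim
    case (elim s)
    have p: "3 * (mu * c0) > 0" using mu_pos c0_pos by simp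
    then have "C + 1 < ln s * (3 * (mu * c0))" using elim(2) by (simp only: pos_divide_less_eq)
    also have "\<dots> = 3 * (mu * c0 * ln s)" by simp
    finally show ?case using ineq[OF elim(3)] elim(1) by linarith
  qed
  then show False by simp
qed

lemma psi_excess:
  assumes b: "b \<in> Bonds" and a: "\<bar>a\<bar> \<le> 1/2"
  shows "mu / 2 * (a\<^sup>2 - (ahat b)\<^sup>2) \<le> psi a - psi (ahat b)
     + ((if b \<in> Bd 0 rho1 then psi (ahat b) else 0) + Kp * K0 ^ 3 * wt b)"
proof (cases "b \<in> Bd 0 rho1")
  case True
  have "0 \<le> Kp * K0 ^ 3 * wt b" using Kp_pos K0_pos wt_pos[of b] by simp
  moreover have "mu / 2 * (a\<^sup>2 - (ahat b)\<^sup>2) \<le> mu / 2 * a\<^sup>2" using mu_pos by (intro mult_left_mono) auto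
  ultimately show ?thesis using True psi_lower[OF a] by simp
next
  case False
  have "psi (ahat b) \<le> mu / 2 * (ahat b)\<^sup>2 + Kp * \<bar>ahat b\<bar> ^ 3"
    using ahat_small[OF b False] by (intro psi_upper) simp
  also have "\<dots> \<le> mu / 2 * (ahat b)\<^sup>2 + Kp * (K0 ^ 3 * wt b)"
    using ahat_cubed[OF b] Kp_pos by (intro add_left_mono mult_left_mono) auto
  finally have "psi (ahat b) \<le> mu / 2 * (ahat b)\<^sup>2 + Kp * K0 ^ 3 * wt b" by (simp add: mult.assoc)
  then show ?thesis using False psi_lower[OF a] unfolding right_diff_distrib by simp
qed

text \<open>In \<open>\<alpha>\<^sup>2 - ahat\<^sup>2\<close> the cross term of
  \<open>\<beta>\<close> with the predictor is not small termwise. Its main part is a pairing with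
  \<open>ff\<close>, which Stokes reduces to finitely many charges and a shell; the rest is absorbed
  by Young's inequality.\<close>

lemma limit_square_summable:
  assumes al: "alternating \<alpha>" and half: "\<And>b. b \<in> Bonds \<Longrightarrow> \<bar>\<alpha> b\<bar> \<le> 1/2"
    and supp: "\<And>T. curl \<alpha> T \<noteq> 0 \<Longrightarrow> cmod T \<le> \<rho>2" and \<rho>2: "0 \<le> \<rho>2"
    and one: "(\<Sum>T\<in>Tr 0 \<rho>2. curl \<alpha> T) = 1"
    and en: "\<And>\<rho>. rho1 \<le> \<rho> \<Longrightarrow> 4 \<le> \<rho> \<Longrightarrow> (\<Sum>b\<in>Bd 0 \<rho>. psi (\<alpha> b)) \<le> Sh \<rho> + m + e6 N \<rho>"
  shows "(\<lambda>b. (\<alpha> b - ahat b)\<^sup>2) summable_on Bonds"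
proof -
  define \<beta> where "\<beta> b = \<alpha> b - ahat b" for b
  have ab: "alternating \<beta>" unfolding \<beta>_def by (intro alternating_diff al alternating_strain)
  have cb: "curl \<beta> T = curl \<alpha> T - of_bool (T = 0)" for T unfolding \<beta>_def curl_diff curl_ahat ..
  have z2: "0 \<in> Tr 0 \<rho>2" using zero_Tri \<rho>2 by (simp add: Tr_def)
  have cb0: "curl \<beta> T = 0" if "T \<notin> Tr 0 \<rho>2" for T
  proof (cases "T \<in> Tri")
    case True
    then have "\<not> cmod T \<le> \<rho>2" using that by (auto simp: Tr_def)
    then have "curl \<alpha> T = 0" "T \<noteq> 0" using supp \<rho>2 by auto
    then show ?thesis using cb by simp
  qed (rule curl_not_Tri)
  have tot: "(\<Sum>T\<in>Tr 0 \<rho>2. curl \<beta> T) = 0"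
    unfolding cb sum_subtractf one using z2 by (simp add: of_bool_def)
  define P where "P = (\<Sum>T\<in>Tr 0 \<rho>2. ln (cmod T) * curl \<beta> T)"
  \<comment> \<open>Total charge 0 removes the growing factor \<open>ln (R - 1)\<close>; only the
    constant \<open>P\<close> survives.\<close>
  have HP: "(\<Sum>T\<in>Tr 0 (R - 1). Hd (R - 1) T * curl \<beta> T) = - P" if R: "R \<ge> \<rho>2 + 2" for R
  proof -
    have "(\<Sum>T\<in>Tr 0 (R - 1). Hd (R - 1) T * curl \<beta> T) = (\<Sum>T\<in>Tr 0 \<rho>2. Hd (R - 1) T * curl \<beta> T)"
    proof (rule sum.mono_neutral_right)
      show "Tr 0 \<rho>2 \<subseteq> Tr 0 (R - 1)" using R by (auto simp: Tr_def)
      show "\<forall>T\<in>Tr 0 (R - 1) - Tr 0 \<rho>2. Hd (R - 1) T * curl \<beta> T = 0" using cb0 by simp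
    qed simp
    also have "\<dots> = (\<Sum>T\<in>Tr 0 \<rho>2. ln (R - 1) * curl \<beta> T - ln (cmod T) * curl \<beta> T)"
    proof (rule sum.cong[OF refl])
      fix T assume "T \<in> Tr 0 \<rho>2"
      then have "Hd (R - 1) T = ln (R - 1) - ln (cmod T)"
        using R \<rho>2 by (intro Hd_inside) (auto simp: Tr_def)
      then show "Hd (R - 1) T * curl \<beta> T = ln (R - 1) * curl \<beta> T - ln (cmod T) * curl \<beta> T"
        by (simp add: left_diff_distrib)
    qed
    also have "\<dots> = ln (R - 1) * (\<Sum>T\<in>Tr 0 \<rho>2. curl \<beta> T) - P"
      by (simp add: sum_subtractf sum_distrib_left P_def)
    finally show ?thesis using tot by simp
  qed
  define W where "W = infsum wt Bonds"
  have Wb: "(\<Sum>b\<in>Bd 0 R. wt b) \<le> W" for R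
    unfolding W_def by (rule finite_sum_le_infsum[OF wt_summable]) (auto simp: Bd_subset_Bonds less_imp_le[OF wt_pos])
  define CC where "CC = 2 / mu * (m + 1 + (Sh rho1 + Kp * K0 ^ 3 * W)) + 4 * c0 * \<bar>P\<bar> + 16 * c0\<^sup>2 + 4 * K0\<^sup>2 * W"
  have "\<forall>\<^sub>F R in at_top. (\<Sum>b\<in>Bd 0 R - Bd 0 (R - 2). (ff b)\<^sup>2) < 1"
    using shell_ff_tendsto by (rule order_tendstoD) simp
  moreover have "\<forall>\<^sub>F R in at_top. e6 N R < 1" using e6_tendsto by (rule order_tendstoD) simp
  moreover have "\<forall>\<^sub>F R in at_top. R \<ge> max (\<rho>2 + 2) (max rho1 4)" by (rule eventually_ge_at_top)
  ultimately have "\<forall>\<^sub>F R in at_top. (\<Sum>b\<in>Bd 0 R. (\<beta> b)\<^sup>2) \<le> 2 * CC"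
  proof eventually_elim
    case (elim R)
    have R: "R \<ge> \<rho>2 + 2" "R \<ge> rho1" "R \<ge> 4" using elim(3) by auto
    let ?S = "Bd 0 R - Bd 0 (R - 2)"
    \<comment> \<open>One quarter of \<open>\<beta>\<^sup>2\<close> is spent on the product with
      \<open>ahat b - c0 * ff b\<close>.\<close>
    have per: "3/4 * (\<beta> b)\<^sup>2 \<le> 2 / mu * (psi (\<alpha> b) - psi (ahat b)
       + ((if b \<in> Bd 0 rho1 then psi (ahat b) else 0) + Kp * K0 ^ 3 * wt b)) - 2 * c0 * (ff b * \<beta> b) + 4 * K0\<^sup>2 * wt b"
      if "b \<in> Bd 0 R" for b
    proof -
      have b: "b \<in> Bonds" using that by (auto simp: Bd_def)
      let ?k = "psi (\<alpha> b) - psi (ahat b) + ((if b \<in> Bd 0 rho1 then psi (ahat b) else 0) + Kp * K0 ^ 3 * wt b)"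
      define y where "y = ahat b - c0 * ff b"
      have "2 / mu * (mu / 2 * ((\<alpha> b)\<^sup>2 - (ahat b)\<^sup>2)) \<le> 2 / mu * ?k"
        using psi_excess[OF b half[OF b]] mu_pos by (intro mult_left_mono) auto
      moreover have "2 / mu * (mu / 2 * x) = x" for x using mu_pos by simp
      ultimately have 1: "(\<alpha> b)\<^sup>2 - (ahat b)\<^sup>2 \<le> 2 / mu * ?k" by (simp only:)
      have 2: "(\<alpha> b)\<^sup>2 - (ahat b)\<^sup>2 = (\<beta> b)\<^sup>2 + 2 * c0 * (ff b * \<beta> b) + 2 * y * \<beta> b"
        by (simp add: \<beta>_def y_def power2_eq_square algebra_simps)
      have 3: "- (2 * y * \<beta> b) \<le> 1/4 * (\<beta> b)\<^sup>2 + 4 * y\<^sup>2"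
        using zero_le_power2[of "\<beta> b / 2 + 2 * y"] by (simp add: power2_eq_square algebra_simps)
      have "y\<^sup>2 \<le> (K0 * dl b)\<^sup>2" using ahat_ff_dl[OF b] power_mono[of "\<bar>y\<bar>" "K0 * dl b" 2] by (simp add: y_def)
      also have "\<dots> \<le> K0\<^sup>2 * wt b" unfolding power_mult_distrib by (intro mult_left_mono dl_sq) auto
      finally have 4: "4 * y\<^sup>2 \<le> 4 * K0\<^sup>2 * wt b" by simp
      show ?thesis using 1 2 3 4 by linarith
    qed
    have "3/4 * (\<Sum>b\<in>Bd 0 R. (\<beta> b)\<^sup>2) \<le> (\<Sum>b\<in>Bd 0 R. 2 / mu * (psi (\<alpha> b) - psi (ahat b)
       + ((if b \<in> Bd 0 rho1 then psi (ahat b) else 0) + Kp * K0 ^ 3 * wt b)) - 2 * c0 * (ff b * \<beta> b) + 4 * K0\<^sup>2 * wt b)"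
      unfolding sum_distrib_left by (rule sum_mono) (rule per)
    also have "\<dots> = 2 / mu * (\<Sum>b\<in>Bd 0 R. psi (\<alpha> b) - psi (ahat b)
       + ((if b \<in> Bd 0 rho1 then psi (ahat b) else 0) + Kp * K0 ^ 3 * wt b))
       - 2 * c0 * (\<Sum>b\<in>Bd 0 R. ff b * \<beta> b) + 4 * K0\<^sup>2 * (\<Sum>b\<in>Bd 0 R. wt b)"
      by (simp only: sum.distrib sum_subtractf sum_distrib_left[symmetric])
    also have "(\<Sum>b\<in>Bd 0 R. psi (\<alpha> b) - psi (ahat b) + ((if b \<in> Bd 0 rho1 then psi (ahat b) else 0) + Kp * K0 ^ 3 * wt b))
       = (\<Sum>b\<in>Bd 0 R. psi (\<alpha> b)) - Sh R + (Sh rho1 + Kp * K0 ^ 3 * (\<Sum>b\<in>Bd 0 R. wt b))"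
    proof -
      have "(\<Sum>b\<in>Bd 0 R. if b \<in> Bd 0 rho1 then psi (ahat b) else 0) = (\<Sum>b\<in>Bd 0 R \<inter> Bd 0 rho1. psi (ahat b))"
        by (rule sum.inter_restrict[symmetric]) simp
      also have "Bd 0 R \<inter> Bd 0 rho1 = Bd 0 rho1" using Bd_mono[OF R(2), of 0] by auto
      finally show ?thesis by (simp add: sum.distrib sum_subtractf sum_distrib_left Sh_def)
    qed
    finally have A: "3/4 * (\<Sum>b\<in>Bd 0 R. (\<beta> b)\<^sup>2) \<le> 2 / mu * ((\<Sum>b\<in>Bd 0 R. psi (\<alpha> b)) - Sh R + (Sh rho1 + Kp * K0 ^ 3 * (\<Sum>b\<in>Bd 0 R. wt b)))
       - 2 * c0 * (\<Sum>b\<in>Bd 0 R. ff b * \<beta> b) + 4 * K0\<^sup>2 * (\<Sum>b\<in>Bd 0 R. wt b)" .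
    have B: "2 / mu * ((\<Sum>b\<in>Bd 0 R. psi (\<alpha> b)) - Sh R + (Sh rho1 + Kp * K0 ^ 3 * (\<Sum>b\<in>Bd 0 R. wt b)))
       \<le> 2 / mu * (m + 1 + (Sh rho1 + Kp * K0 ^ 3 * W))"
    proof (rule mult_left_mono)
      have "Kp * K0 ^ 3 * (\<Sum>b\<in>Bd 0 R. wt b) \<le> Kp * K0 ^ 3 * W"
        using Kp_pos K0_pos by (intro mult_left_mono Wb) auto
      then show "(\<Sum>b\<in>Bd 0 R. psi (\<alpha> b)) - Sh R + (Sh rho1 + Kp * K0 ^ 3 * (\<Sum>b\<in>Bd 0 R. wt b)) \<le> m + 1 + (Sh rho1 + Kp * K0 ^ 3 * W)"
        using en[OF R(2,3)] elim(2) by linarith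
    qed (use mu_pos in simp)
    have C: "4 * K0\<^sup>2 * (\<Sum>b\<in>Bd 0 R. wt b) \<le> 4 * K0\<^sup>2 * W" by (intro mult_left_mono Wb) auto
    define X where "X = (\<Sum>b\<in>?S. \<bar>ff b\<bar> * \<bar>\<beta> b\<bar>)"
    have "\<bar>(\<Sum>b\<in>Bd 0 R. ff b * \<beta> b) - 2 * (- P)\<bar> \<le> 2 * X"
      unfolding X_def HP[OF R(1), symmetric] using R by (intro ff_pairing ab) auto
    then have "- (\<Sum>b\<in>Bd 0 R. ff b * \<beta> b) \<le> 2 * \<bar>P\<bar> + 2 * X" by linarith
    then have "2 * c0 * (- (\<Sum>b\<in>Bd 0 R. ff b * \<beta> b)) \<le> 2 * c0 * (2 * \<bar>P\<bar> + 2 * X)"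
      using c0_pos by (intro mult_left_mono) auto
    then have D: "- (2 * c0 * (\<Sum>b\<in>Bd 0 R. ff b * \<beta> b)) \<le> 4 * c0 * \<bar>P\<bar> + 4 * c0 * X"
      by (simp add: algebra_simps)
    \<comment> \<open>The shell term takes another quarter of the sum, leaving one half and hence
      the bound \<open>2 * CC\<close>.\<close>
    have "4 * c0 * X \<le> (\<Sum>b\<in>?S. 1/4 * (\<beta> b)\<^sup>2 + 16 * c0\<^sup>2 * (ff b)\<^sup>2)"
      unfolding X_def sum_distrib_left
    proof (rule sum_mono)
      fix b
      have "4 * c0 * (x * y) \<le> 1/4 * y\<^sup>2 + 16 * c0\<^sup>2 * x\<^sup>2" for x y :: real
        using zero_le_power2[of "y / 2 - 4 * c0 * x"] by (simp add: power2_eq_square algebra_simps)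
      from this[of "\<bar>ff b\<bar>" "\<bar>\<beta> b\<bar>"] show "4 * c0 * (\<bar>ff b\<bar> * \<bar>\<beta> b\<bar>) \<le> 1/4 * (\<beta> b)\<^sup>2 + 16 * c0\<^sup>2 * (ff b)\<^sup>2" by simp
    qed
    also have "\<dots> = 1/4 * (\<Sum>b\<in>?S. (\<beta> b)\<^sup>2) + 16 * c0\<^sup>2 * (\<Sum>b\<in>?S. (ff b)\<^sup>2)"
      by (simp only: sum.distrib sum_distrib_left)
    also have "\<dots> \<le> 1/4 * (\<Sum>b\<in>Bd 0 R. (\<beta> b)\<^sup>2) + 16 * c0\<^sup>2 * 1"
      using elim(1) by (intro add_mono mult_left_mono sum_mono2) auto
    finally have E: "4 * c0 * X \<le> 1/4 * (\<Sum>b\<in>Bd 0 R. (\<beta> b)\<^sup>2) + 16 * c0\<^sup>2" by simp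
    have "3/4 * (\<Sum>b\<in>Bd 0 R. (\<beta> b)\<^sup>2) \<le> CC + 1/4 * (\<Sum>b\<in>Bd 0 R. (\<beta> b)\<^sup>2)"
      using A B C D E unfolding CC_def by linarith
    then show ?case by linarith
  qed
  then obtain Rs where Rs: "\<And>R. R \<ge> Rs \<Longrightarrow> (\<Sum>b\<in>Bd 0 R. (\<beta> b)\<^sup>2) \<le> 2 * CC"
    unfolding eventually_at_top_linorder by blast
  have "(\<lambda>b. (\<beta> b)\<^sup>2) summable_on Bonds"
  proof (rule nonneg_bdd_above_summable_on)
    show "bdd_above (sum (\<lambda>b. (\<beta> b)\<^sup>2) ` {F. F \<subseteq> Bonds \<and> finite F})"
    proof (rule bdd_aboveI2)
      fix F assume "F \<in> {F. F \<subseteq> Bonds \<and> finite F}"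
      then obtain R where R: "F \<subseteq> Bd 0 R" using finite_bonds_subset_Bd[of F] by blast
      have "(\<Sum>b\<in>F. (\<beta> b)\<^sup>2) \<le> (\<Sum>b\<in>Bd 0 (max R Rs). (\<beta> b)\<^sup>2)"
        using R Bd_mono[of R "max R Rs" 0] by (intro sum_mono2) auto
      also have "\<dots> \<le> 2 * CC" by (rule Rs) simp
      finally show "(\<Sum>b\<in>F. (\<beta> b)\<^sup>2) \<le> 2 * CC" .
    qed
  qed simp
  then show ?thesis by (simp add: \<beta>_def)
qed

text \<open>Subtracting the integer string \<open>s\<close> from \<open>\<beta>\<close> removes the
  charges, so a displacement exists. It has the same values of \<open>psi\<close> as
  \<open>\<alpha>\<close>, and its energy is compared with \<open>m\<close> on growing balls, the
  linear term being a vanishing shell contribution.\<close>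

lemma limit_displacement:
  assumes al: "alternating \<alpha>" and half: "\<And>b. b \<in> Bonds \<Longrightarrow> \<bar>\<alpha> b\<bar> \<le> 1/2" and int: "\<And>T. curl \<alpha> T \<in> \<int>"
    and supp: "\<And>T. curl \<alpha> T \<noteq> 0 \<Longrightarrow> cmod T \<le> \<rho>2" and \<rho>2: "0 \<le> \<rho>2"
    and pos: "1 \<le> (\<Sum>T\<in>Tr 0 \<rho>2. curl \<alpha> T)"
    and en: "\<And>\<rho>. rho1 \<le> \<rho> \<Longrightarrow> 4 \<le> \<rho> \<Longrightarrow> (\<Sum>b\<in>Bd 0 \<rho>. psi (\<alpha> b)) \<le> Sh \<rho> + m + e6 N \<rho>"
  shows "\<exists>u\<in>W12. EE u \<le> m"
proof -
  have one: "(\<Sum>T\<in>Tr 0 \<rho>2. curl \<alpha> T) = 1" by (rule limit_charge[OF al half int supp \<rho>2 pos en])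
  define \<beta> where "\<beta> b = \<alpha> b - ahat b" for b
  have bs: "(\<lambda>b. (\<beta> b)\<^sup>2) summable_on Bonds"
    using limit_square_summable[OF al half supp \<rho>2 one en] by (simp add: \<beta>_def)
  have c0': "curl \<alpha> T = 0" if "T \<notin> Tr 0 \<rho>2" for T
    using that supp[of T] curl_not_Tri[of T \<alpha>] by (auto simp: Tr_def)
  obtain s where s: "alternating s" "\<And>b. s b \<in> \<int>" "finite {b \<in> Bonds. s b \<noteq> 0}"
    "\<And>T. curl s T = curl \<alpha> T - of_bool (T = 0)"
    using integer_field_with_curl[of "Tr 0 \<rho>2" "curl \<alpha>", OF finite_Tr _ int c0' one]
    by (auto simp: Tr_def)
  have "curl (\<lambda>b. \<beta> b - s b) T = 0" for T
    unfolding curl_diff s(4) unfolding \<beta>_def curl_diff curl_ahat by simp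
  moreover have "alternating (\<lambda>b. \<beta> b - s b)"
    unfolding \<beta>_def by (intro alternating_diff al alternating_strain s(1))
  ultimately obtain u where u: "u \<in> LatFun" "\<And>b. b \<in> Bonds \<Longrightarrow> Dif u b = \<beta> b - s b"
    using irrotational_imp_potential[of "\<lambda>b. \<beta> b - s b"] by blast
  have ss: "(\<lambda>b. (s b)\<^sup>2) summable_on Bonds"
    using s(3) by (intro finite_nonzero_values_imp_summable_on) simp
  have us: "(\<lambda>b. (Dif u b)\<^sup>2) summable_on Bonds"
  proof (rule summable_on_comparison_test)
    show "(\<lambda>b. 2 * (\<beta> b)\<^sup>2 + 2 * (s b)\<^sup>2) summable_on Bonds"
      by (intro summable_on_add summable_on_cmult_right bs ss)
    fix b assume b: "b \<in> Bonds"
    have "(x - y)\<^sup>2 \<le> 2 * x\<^sup>2 + 2 * y\<^sup>2" for x y :: real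
      using zero_le_power2[of "x + y"] by (simp add: power2_eq_square algebra_simps)
    then show "(Dif u b)\<^sup>2 \<le> 2 * (\<beta> b)\<^sup>2 + 2 * (s b)\<^sup>2" unfolding u(2)[OF b] .
  qed simp
  have uW: "u \<in> W12" using u(1) us by (simp add: W12_iff)
  have psi_eq: "psi (ahat b + Dif u b) = psi (\<alpha> b)" if "b \<in> Bonds" for b
  proof (rule psi_cong_Ints)
    have "- s b \<in> \<int>" using s(2) by simp
    then show "ahat b + Dif u b - \<alpha> b \<in> \<int>" using u(2)[OF that] by (simp add: \<beta>_def)
  qed
  let ?sh = "\<lambda>f R. \<Sum>b\<in>Bd 0 R - Bd 0 (R - 2). (f b)\<^sup>2"
  have bound: "(\<Sum>b\<in>Bd 0 R. G b (Dif u b)) \<le> m + e6 N R + mu * c0 * (?sh ff R + ?sh (Dif u) R)"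
    if R: "R \<ge> max rho1 4" for R
  proof -
    have R': "R \<ge> rho1" "R \<ge> 4" using R by auto
    have "(\<Sum>b\<in>Bd 0 R. G b (Dif u b)) = (\<Sum>b\<in>Bd 0 R. psi (\<alpha> b) - psi (ahat b) - mu * c0 * (ff b * Dif u b))"
      by (intro sum.cong refl) (simp add: G_def psi_eq Bd_def mult.assoc)
    also have "\<dots> = (\<Sum>b\<in>Bd 0 R. psi (\<alpha> b)) - Sh R - mu * c0 * (\<Sum>b\<in>Bd 0 R. ff b * Dif u b)"
      by (simp add: sum_subtractf sum_distrib_left Sh_def)
    finally have 1: "(\<Sum>b\<in>Bd 0 R. G b (Dif u b)) = (\<Sum>b\<in>Bd 0 R. psi (\<alpha> b)) - Sh R - mu * c0 * (\<Sum>b\<in>Bd 0 R. ff b * Dif u b)" .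
    have "\<bar>\<Sum>b\<in>Bd 0 R. ff b * Dif u b\<bar> \<le> 2 * (\<Sum>b\<in>Bd 0 R - Bd 0 (R - 2). \<bar>ff b\<bar> * \<bar>Dif u b\<bar>)"
      using ff_pairing[OF alternating_Dif, of R u] R' by (simp add: curl_Dif)
    also have "\<dots> \<le> (\<Sum>b\<in>Bd 0 R - Bd 0 (R - 2). (ff b)\<^sup>2 + (Dif u b)\<^sup>2)"
      unfolding sum_distrib_left
    proof (rule sum_mono)
      fix b
      have "2 * (x * y) \<le> x\<^sup>2 + y\<^sup>2" for x y :: real
        using zero_le_power2[of "x - y"] by (simp add: power2_eq_square algebra_simps)
      from this[of "\<bar>ff b\<bar>" "\<bar>Dif u b\<bar>"] show "2 * (\<bar>ff b\<bar> * \<bar>Dif u b\<bar>) \<le> (ff b)\<^sup>2 + (Dif u b)\<^sup>2" by simp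
    qed
    also have "\<dots> = ?sh ff R + ?sh (Dif u) R" by (simp add: sum.distrib)
    finally have "- (\<Sum>b\<in>Bd 0 R. ff b * Dif u b) \<le> ?sh ff R + ?sh (Dif u) R" by linarith
    then have "mu * c0 * (- (\<Sum>b\<in>Bd 0 R. ff b * Dif u b)) \<le> mu * c0 * (?sh ff R + ?sh (Dif u) R)"
      using mu_pos c0_pos by (intro mult_left_mono) auto
    then show ?thesis using 1 en[OF R'] by simp
  qed
  have shu: "(?sh (Dif u) \<longlongrightarrow> 0) at_top"
  proof -
    have t1: "((\<lambda>R. \<Sum>b\<in>Bd 0 R. (Dif u b)\<^sup>2) \<longlongrightarrow> infsum (\<lambda>b. (Dif u b)\<^sup>2) Bonds) at_top" by (rule sum_Bd_tendsto[OF us])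
    have "filterlim (\<lambda>R::real. R - 2) at_top at_top" by real_asymp
    then have t2: "((\<lambda>R. \<Sum>b\<in>Bd 0 (R - 2). (Dif u b)\<^sup>2) \<longlongrightarrow> infsum (\<lambda>b. (Dif u b)\<^sup>2) Bonds) at_top"
      by (rule filterlim_compose[OF t1])
    have e: "?sh (Dif u) R = (\<Sum>b\<in>Bd 0 R. (Dif u b)\<^sup>2) - (\<Sum>b\<in>Bd 0 (R - 2). (Dif u b)\<^sup>2)" for R
      by (rule sum_diff) (auto intro: Bd_mono[THEN subsetD, rotated])
    show ?thesis unfolding e using tendsto_diff[OF t1 t2] by simp
  qed
  have "((\<lambda>R. m + e6 N R + mu * c0 * (?sh ff R + ?sh (Dif u) R)) \<longlongrightarrow> m + 0 + mu * c0 * (0 + 0)) at_top"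
    by (intro tendsto_add tendsto_const tendsto_mult_left e6_tendsto shell_ff_tendsto shu)
  then have lim: "((\<lambda>R. m + e6 N R + mu * c0 * (?sh ff R + ?sh (Dif u) R)) \<longlongrightarrow> m) at_top" by simp
  have "EE u \<le> m"
  proof (rule tendsto_le[OF _ lim])
    show "((\<lambda>R. \<Sum>b\<in>Bd 0 R. G b (Dif u b)) \<longlongrightarrow> EE u) at_top"
      unfolding EE_def by (rule sum_Bd_tendsto[OF G_summable[OF uW]])
    show "\<forall>\<^sub>F R in at_top. (\<Sum>b\<in>Bd 0 R. G b (Dif u b)) \<le> m + e6 N R + mu * c0 * (?sh ff R + ?sh (Dif u) R)"
      unfolding eventually_at_top_linorder using bound by blast
  qed simp
  then show ?thesis using uW by blast
qed

text \<open>The infimum over \<open>W0\<close> is the infimum over \<open>W12\<close> by density and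
  continuity, so it suffices to find an element of \<open>W12\<close> whose energy is at most
  \<open>m\<close>.\<close>

theorem minimiser_exists: "\<exists>u\<in>W12. \<forall>v\<in>W12. Energy psi u \<le> Energy psi v"
proof -
  obtain N C where NC: "\<And>u. u \<in> W0 \<Longrightarrow> Energy0 psi u \<ge> C"
    "\<And>u. u \<in> W0 \<Longrightarrow> Energy0 psi u \<le> 1 \<Longrightarrow> card (charges u) \<le> N"
    using charge_count_bound by blast
  define m where "m = (INF u\<in>W0. Energy0 psi u)"
  have bdd: "bdd_below (Energy0 psi ` W0)" using NC(1) by (intro bdd_belowI2[where m = C]) auto
  have z: "(\<lambda>_. 0) \<in> W0" by (auto simp: W0_def LatFun_def Dif_def)
  have E0: "Energy0 psi (\<lambda>_. 0) = 0" by (simp add: Energy0_def Dif_def)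
  have m_le: "m \<le> Energy0 psi u" if "u \<in> W0" for u
    unfolding m_def by (rule cINF_lower[OF bdd that])
  have m0: "m \<le> 0" using m_le[OF z] E0 by simp
  have "\<exists>u\<in>W0. Energy0 psi u < m + 1 / real (Suc n)" for n
  proof (rule ccontr)
    assume "\<not> (\<exists>u\<in>W0. Energy0 psi u < m + 1 / real (Suc n))"
    then have "m + 1 / real (Suc n) \<le> m"
      unfolding m_def[symmetric] by (subst (2) m_def, intro cINF_greatest) (use z in \<open>auto simp: not_less\<close>)
    then show False by simp
  qed
  then have "\<forall>n. \<exists>u. u \<in> W0 \<and> Energy0 psi u < m + 1 / real (Suc n)" by blast
  from choice[OF this] obtain u where u: "\<And>n. u n \<in> W0" "\<And>n. Energy0 psi (u n) < m + 1 / real (Suc n)" by blast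
  \<comment> \<open>The zero displacement has energy 0, so the infimum is nonpositive and the whole
    sequence falls under the threshold 1 of the charge count.\<close>
  have u1: "Energy0 psi (u n) \<le> 1" for n
  proof -
    have "1 / real (Suc n) \<le> 1" by simp
    then show ?thesis using u(2)[of n] m0 by linarith
  qed
  have cN: "card (charges (u n)) \<le> N" for n using NC(2) u(1) u1 by blast
  have Elim: "(\<lambda>n. Energy0 psi (u n)) \<longlonglongrightarrow> m"
  proof (rule tendsto_sandwich[where f = "\<lambda>_. m" and h = "\<lambda>n. m + 1 / real (Suc n)"])
    show "(\<lambda>n. m + 1 / real (Suc n)) \<longlonglongrightarrow> m" by real_asymp
  qed (use m_le u in \<open>auto intro!: always_eventually less_imp_le\<close>)
  obtain \<sigma> p \<rho> where s: "strict_mono (\<sigma> :: nat \<Rightarrow> nat)" and \<rho>: "\<rho> \<ge> 0"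
    and big: "\<forall>\<^sub>F n in sequentially. (\<Sum>T\<in>{T \<in> charges (u (\<sigma> n)). cmod (T - p n) \<le> \<rho>}. curl (al (u (\<sigma> n))) T) \<ge> 1"
    and gap: "\<And>K. \<forall>\<^sub>F n in sequentially. \<forall>T\<in>charges (u (\<sigma> n)). cmod (T - p n) \<le> K \<longrightarrow> cmod (T - p n) \<le> \<rho>"
    using positive_cluster[of "\<lambda>n. charges (u n)" N "\<lambda>n. curl (al (u n))"] charges_W0[OF u(1)] cN curl_strain_Ints
    by auto
  define P where "P n = prj (p n)" for n
  have P: "P n \<in> Lam" "cmod (p n - P n) \<le> 1" for n using prj by (auto simp: P_def)
  define A where "A n b = al (u (\<sigma> n)) (tr (P n) b)" for n b
  have Ah: "\<bar>A n b\<bar> \<le> 1/2" for n b unfolding A_def strain_def by (rule abs_rd_le)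
  \<comment> \<open>A diagonal subsequence: there are countably many bonds and the strains are
    bounded by 1/2.\<close>
  obtain k where k: "strict_mono (k :: nat \<Rightarrow> nat)" "\<And>b. b \<in> Bonds \<Longrightarrow> \<exists>l. (\<lambda>n. A (k n) b) \<longlonglongrightarrow> l"
    using function_convergent_subsequence[OF countable_Bonds, of A "1/2"] Ah by auto
  define \<alpha> where "\<alpha> b = lim (\<lambda>n. A (k n) b)" for b
  have lim: "(\<lambda>n. A (k n) b) \<longlonglongrightarrow> \<alpha> b" if "b \<in> Bonds" for b
    using k(2)[OF that] unfolding \<alpha>_def by (simp add: convergent_LIMSEQ_iff[symmetric] convergent_def)
  have altA: "alternating (A n)" for n
    unfolding alternating_def A_def
  proof
    fix b assume "b \<in> Bonds"
    then have "tr (P n) b \<in> Bonds" using tr_Bonds[OF P(1)] by simp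
    then show "al (u (\<sigma> n)) (tr (P n) (rv b)) = - al (u (\<sigma> n)) (tr (P n) b)"
      using alternating_strain[unfolded alternating_def] by (simp add: rv_tr[symmetric])
  qed
  have al: "alternating \<alpha>"
    unfolding alternating_def
  proof
    fix b assume b: "b \<in> Bonds"
    have "(\<lambda>n. A (k n) (rv b)) \<longlonglongrightarrow> - \<alpha> b"
      using tendsto_minus[OF lim[OF b]] altA b by (simp add: alternating_def)
    then show "\<alpha> (rv b) = - \<alpha> b" using lim[OF rv_Bonds[OF b]] LIMSEQ_unique by blast
  qed
  have half: "\<bar>\<alpha> b\<bar> \<le> 1/2" if "b \<in> Bonds" for b
    by (rule tendsto_upperbound[OF tendsto_rabs[OF lim[OF that]]]) (intro always_eventually allI Ah, simp)
  have cA: "curl (A n) T = curl (al (u (\<sigma> n))) (T + P n)" for n T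
    unfolding A_def by (rule curl_tr[OF P(1)])
  have clim: "(\<lambda>n. curl (A (k n)) T) \<longlonglongrightarrow> curl \<alpha> T" for T
    unfolding curl_def by (intro tendsto_sum lim) auto
  have cint: "curl (A (k n)) T \<in> \<int>" for n T unfolding cA by (rule curl_strain_Ints)
  have int: "curl \<alpha> T \<in> \<int>" for T by (rule Ints_limit(1)[OF clim cint])
  have ev: "\<forall>\<^sub>F n in sequentially. curl (A (k n)) T = curl \<alpha> T" for T by (rule Ints_limit(2)[OF clim cint])
  have gapk: "\<forall>\<^sub>F n in sequentially. \<forall>T\<in>charges (u (\<sigma> (k n))). cmod (T - p (k n)) \<le> K \<longrightarrow> cmod (T - p (k n)) \<le> \<rho>" for K
    using eventually_subseq[OF k(1) gap[of K]] .
  have bigk: "\<forall>\<^sub>F n in sequentially. (\<Sum>T\<in>{T \<in> charges (u (\<sigma> (k n))). cmod (T - p (k n)) \<le> \<rho>}. curl (al (u (\<sigma> (k n)))) T) \<ge> 1"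
    using eventually_subseq[OF k(1) big] .
  \<comment> \<open>The additional 1 is the distance between the cluster point and the lattice
    translation replacing it.\<close>
  have supp: "cmod T \<le> \<rho> + 1" if "curl \<alpha> T \<noteq> 0" for T
  proof -
    have "\<forall>\<^sub>F n in sequentially. cmod T \<le> \<rho> + 1"
      using eventually_conj[OF ev[of T] gapk[of "cmod T + 1"]]
    proof (rule eventually_mono)
      fix n
      assume a: "curl (A (k n)) T = curl \<alpha> T \<and>
        (\<forall>T'\<in>charges (u (\<sigma> (k n))). cmod (T' - p (k n)) \<le> cmod T + 1 \<longrightarrow> cmod (T' - p (k n)) \<le> \<rho>)"
      let ?T = "T + P (k n)"
      have "curl (al (u (\<sigma> (k n)))) ?T \<noteq> 0" using a that unfolding cA by simp
      then have "?T \<in> charges (u (\<sigma> (k n)))" using curl_not_Tri by (auto simp: charges_def)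
      moreover have e: "?T - p (k n) = T - (p (k n) - P (k n))" by simp
      have "cmod (?T - p (k n)) \<le> cmod T + 1" "cmod T \<le> cmod (?T - p (k n)) + 1"
        unfolding e using P(2)[of "k n"] norm_triangle_ineq4[of T "p (k n) - P (k n)"]
          norm_triangle_ineq2[of T "p (k n) - P (k n)"] by linarith+
      ultimately show "cmod T \<le> \<rho> + 1" using a by force
    qed
    then show ?thesis by simp
  qed
  have pos: "1 \<le> (\<Sum>T\<in>Tr 0 (\<rho> + 1). curl \<alpha> T)"
  proof -
    have "(\<lambda>n. \<Sum>T\<in>Tr 0 (\<rho> + 1). curl (A (k n)) T) \<longlonglongrightarrow> (\<Sum>T\<in>Tr 0 (\<rho> + 1). curl \<alpha> T)"
      by (intro tendsto_sum clim)
    moreover have "\<forall>\<^sub>F n in sequentially. 1 \<le> (\<Sum>T\<in>Tr 0 (\<rho> + 1). curl (A (k n)) T)"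
      using eventually_conj[OF bigk gapk[of "\<rho> + 2"]]
    proof (rule eventually_mono)
      fix n
      let ?X = "charges (u (\<sigma> (k n)))" and ?c = "curl (al (u (\<sigma> (k n))))" and ?p = "p (k n)" and ?P = "P (k n)"
      assume a: "1 \<le> (\<Sum>T\<in>{T \<in> ?X. cmod (T - ?p) \<le> \<rho>}. ?c T) \<and>
        (\<forall>T\<in>?X. cmod (T - ?p) \<le> \<rho> + 2 \<longrightarrow> cmod (T - ?p) \<le> \<rho>)"
      have "(\<Sum>T\<in>Tr 0 (\<rho> + 1). curl (A (k n)) T) = (\<Sum>T\<in>(\<lambda>T. T + ?P) ` Tr 0 (\<rho> + 1). ?c T)"
        unfolding cA by (subst sum.reindex) (auto simp: inj_on_def)
      also have "\<dots> = (\<Sum>T\<in>{T \<in> ?X. cmod (T - ?p) \<le> \<rho>}. ?c T)"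
      proof (rule sum.mono_neutral_right)
        show "finite ((\<lambda>T. T + ?P) ` Tr 0 (\<rho> + 1))" by simp
        show "{T \<in> ?X. cmod (T - ?p) \<le> \<rho>} \<subseteq> (\<lambda>T. T + ?P) ` Tr 0 (\<rho> + 1)"
        proof
          fix T assume T: "T \<in> {T \<in> ?X. cmod (T - ?p) \<le> \<rho>}"
          then have "T - ?P \<in> Tri" using Tri_add[OF Lam_minus[OF P(1)], of T "k n"] by (simp add: charges_def)
          moreover have "cmod (T - ?P) \<le> \<rho> + 1"
            using T P(2)[of "k n"] norm_triangle_ineq[of "T - ?p" "?p - ?P"] by simp
          ultimately show "T \<in> (\<lambda>T. T + ?P) ` Tr 0 (\<rho> + 1)"
            by (intro image_eqI[of _ _ "T - ?P"]) (auto simp: Tr_def)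
        qed
        show "\<forall>T\<in>(\<lambda>T. T + ?P) ` Tr 0 (\<rho> + 1) - {T \<in> ?X. cmod (T - ?p) \<le> \<rho>}. ?c T = 0"
        proof
          fix T assume T: "T \<in> (\<lambda>T. T + ?P) ` Tr 0 (\<rho> + 1) - {T \<in> ?X. cmod (T - ?p) \<le> \<rho>}"
          then have "cmod (T - ?P) \<le> \<rho> + 1" by (auto simp: Tr_def)
          then have "cmod (T - ?p) \<le> \<rho> + 2"
            using P(2)[of "k n"] norm_triangle_ineq4[of "T - ?P" "?p - ?P"] by simp
          then have "T \<notin> ?X" using a T by blast
          then show "?c T = 0" using curl_not_Tri by (auto simp: charges_def)
        qed
      qed
      finally show "1 \<le> (\<Sum>T\<in>Tr 0 (\<rho> + 1). curl (A (k n)) T)" using a by simp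
    qed
    ultimately show ?thesis by (rule tendsto_lowerbound) simp
  qed
  \<comment> \<open>The energies themselves are not translated: the local bound around
    \<open>P (k n)\<close> is stated for the original configuration, and only the finite sum over
    the ball is moved to the origin.\<close>
  have en: "(\<Sum>b\<in>Bd 0 R. psi (\<alpha> b)) \<le> Sh R + m + e6 N R" if R: "rho1 \<le> R" "4 \<le> R" for R
  proof -
    have l1: "(\<lambda>n. \<Sum>b\<in>Bd 0 R. psi (A (k n) b)) \<longlonglongrightarrow> (\<Sum>b\<in>Bd 0 R. psi (\<alpha> b))"
      by (intro tendsto_sum isCont_tendsto_compose[OF psi_isCont] lim) (auto simp: Bd_def)
    have "strict_mono (\<lambda>n. \<sigma> (k n))" using strict_mono_o[OF s k(1)] by (simp add: o_def)
    then have "(\<lambda>n. Energy0 psi (u (\<sigma> (k n)))) \<longlonglongrightarrow> m"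
      using LIMSEQ_subseq_LIMSEQ[OF Elim] by (simp add: o_def)
    then have l2: "(\<lambda>n. Sh R + Energy0 psi (u (\<sigma> (k n))) + e6 N R) \<longlonglongrightarrow> Sh R + m + e6 N R"
      by (intro tendsto_intros)
    have "(\<Sum>b\<in>Bd 0 R. psi (A (k n) b)) \<le> Sh R + Energy0 psi (u (\<sigma> (k n))) + e6 N R" for n
    proof -
      have "(\<Sum>b\<in>Bd (P (k n)) R. psi (al (u (\<sigma> (k n))) b)) - Sh R - e6 N R \<le> Energy0 psi (u (\<sigma> (k n)))"
        by (rule local_lower_bound[OF u(1) cN P(1) R])
      moreover have "(\<Sum>b\<in>Bd (P (k n)) R. psi (al (u (\<sigma> (k n))) b)) = (\<Sum>b\<in>Bd 0 R. psi (A (k n) b))"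
        using Bd_tr[OF P(1)[of "k n"], of 0 R] by (simp add: sum.reindex[OF inj_tr] A_def)
      ultimately show ?thesis by linarith
    qed
    then show ?thesis using LIMSEQ_le[OF l1 l2] by blast
  qed
  obtain w where w: "w \<in> W12" "EE w \<le> m"
    using limit_displacement[OF al half int supp _ pos en] \<rho> by auto
  have "m \<le> EE v" if v: "v \<in> W12" for v
  proof -
    obtain vs where vs: "\<And>n. vs n \<in> W0" "(\<lambda>n. Dnorm (\<lambda>x. vs n x - v x)) \<longlonglongrightarrow> 0"
      using W0_dense[OF v] by blast
    then have "(\<lambda>n. EE (vs n)) \<longlonglongrightarrow> EE v" by (intro EE_continuous v) (auto simp: W0_iff)
    moreover have "m \<le> EE (vs n)" for n using EE_W0 vs(1) m_le by simp
    ultimately show ?thesis by (intro LIMSEQ_le_const) auto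
  qed
  then have "Energy psi w \<le> Energy psi v" if "v \<in> W12" for v
    using that w Energy_eq_EE by force
  then show ?thesis using w(1) by blast
qed

end

theorem theorem4p5:
  fixes psi :: "real \<Rightarrow> real"
  assumes "admissible_psi psi"
  shows "\<exists>u \<in> W12. \<forall>v \<in> W12. Energy psi u \<le> Energy psi v"
proof -
  interpret potential psi by unfold_locales (rule assms)
  show ?thesis by (rule minimiser_exists)
qed

end
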